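(* Let $\triangle$ be a simplicial complex on $V=[n]$ with simplicial binoid $M_\triangle$. Let $U\subseteq\operatorname{Spec}^\bullet(M_\triangle)$ be an open subset minimally covered by the covering $\mathscr V=\{D(F_1),\dots,D(F_j)\}$ for some $F_1,\dots,F_j\in\triangle$. Then, for the constant sheaf $\mathbb Z$ and all $i\ge 0$, \[ \mathrm H^i(U,\mathbb Z)\cong\check{\mathrm H}^i(\mathscr V,\mathbb Z)\cong\mathrm H^i(\operatorname{nerve}(\mathscr V),\mathbb Z). \]
   Context: A simplicial complex $\triangle$ on $V=[n]$ is a collection of subsets (faces) of $V$ closed under taking subsets; all singletons are assumed to be faces. A (commutative) binoid is a commutative monoid $(M,+,0)$ with an absorbing element $\infty$. The simplicial binoid $M_\triangle$ is the binoid with generators $x_1,\dots,x_n$ and relations $x_{i_1}+\dots+x_{i_k}=\infty$ for every $\{i_1,\dots,i_k\}\subseteq[n]$ that is not a face of $\triangle$. A prime ideal of a binoid $M$ is a subset $\mathfrak p\ni\infty$ with $\mathfrak p+M\subseteq\mathfrak p$ and $M\smallsetminus\mathfrak p$ a submonoid; $\operatorname{Spec}M$ is the set of prime ideals with basis of open sets $D(f)=\{\mathfrak p\mid f\notin\mathfrak p\}$, and $\operatorname{Spec}^\bullet M$ is $\operatorname{Spec}M$ minus its unique maximal element $M_+$ (the ideal of non-units). Faces correspond bijectively (inclusion-reversing) to prime ideals of $M_\triangle$ via $F\mapsto\langle x_i\mid i\in V\smallsetminus F\rangle$. For a face $F$, $D(F)=D(\sum_{i\in F}x_i)=\bigcap_{i\in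 F}D(x_i)$. Every open $U\subseteq\operatorname{Spec}^\bullet M_\triangle$ is minimally covered by the sets $D(F_1),\dots,D(F_j)$, where $F_1,\dots,F_j$ are the faces corresponding to the maximal (with respect to inclusion) prime ideals in $U$; this is the minimal covering meant. The nerve of a finite collection $\{U_k\}_{k\in I}$ of open sets is the simplicial complex on $I$ consisting of $\varnothing$ and those $J\subseteq I$ with $\bigcap_{k\in J}U_k\neq\varnothing$. $\mathrm H^i(U,\mathbb Z)$ is sheaf cohomology, $\check{\mathrm H}^i(\mathscr V,\mathbb Z)$ is Čech cohomology with respect to $\mathscr V$, and $\mathrm H^i(\operatorname{nerve}(\mathscr V),\mathbb Z)$ is (non-reduced) simplicial cohomology. *)

theory Defs
  imports
    "HOL-Analysis.Function_Topology"
    "HOL-Algebra.Product_Groups"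
    "HOL-Algebra.Elementary_Groups"
    "HOL-Algebra.FiniteProduct"
    "HOL-Library.Multiset"
begin

section \<open>Binoids and their spectra\<close>

text \<open>Binoids are written multiplicatively, so that the monoids of \<open>HOL-Algebra\<close> can be used:
  \<open>x \<otimes> y\<close> is the sum \<open>x + y\<close>, \<open>\<one>\<close> is the neutral element \<open>0\<close>, and \<open>absorbing\<close> is \<open>\<infinity>\<close>.\<close>

record 'a binoid = "'a monoid" +
  absorbing :: 'a

definition binoid :: "('a, 'b) binoid_scheme \<Rightarrow> bool" where
  "binoid M \<longleftrightarrow> comm_monoid M \<and> absorbing M \<in> carrier M \<and>
     (\<forall>x\<in>carrier M. absorbing M \<otimes>\<^bsub>M\<^esub> x = absorbing M)"

definition binoid_ideal :: "'a set \<Rightarrow> ('a, 'b) binoid_scheme \<Rightarrow> bool" where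
  "binoid_ideal I M \<longleftrightarrow> I \<subseteq> carrier M \<and> absorbing M \<in> I \<and>
     (\<forall>x\<in>I. \<forall>y\<in>carrier M. x \<otimes>\<^bsub>M\<^esub> y \<in> I)"

definition binoid_genideal :: "('a, 'b) binoid_scheme \<Rightarrow> 'a set \<Rightarrow> 'a set" where
  "binoid_genideal M S = \<Inter>{I. binoid_ideal I M \<and> S \<subseteq> I}"

definition binoid_prime :: "'a set \<Rightarrow> ('a, 'b) binoid_scheme \<Rightarrow> bool" where
  "binoid_prime P M \<longleftrightarrow> binoid_ideal P M \<and> submonoid (carrier M - P) M"

definition binoid_Spec :: "('a, 'b) binoid_scheme \<Rightarrow> 'a set set" where
  "binoid_Spec M = {P. binoid_prime P M}"

definition basic_open :: "('a, 'b) binoid_scheme \<Rightarrow> 'a \<Rightarrow> 'a set set" where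
  "basic_open M f = {P \<in> binoid_Spec M. f \<notin> P}"

text \<open>The sets \<open>D(f)\<close> are closed under finite intersections, \<open>D(f) \<inter> D(g) = D(f + g)\<close>,
  hence form a basis of the topology which they generate.\<close>

definition Spec_topology :: "('a, 'b) binoid_scheme \<Rightarrow> 'a set topology" where
  "Spec_topology M = topology_generated_by (basic_open M ` carrier M)"

definition punctured_Spec_topology :: "('a, 'b) binoid_scheme \<Rightarrow> 'a set topology" where
  "punctured_Spec_topology M =
     subtopology (Spec_topology M) (binoid_Spec M - {carrier M - Units M})"


section \<open>Simplicial complexes and simplicial binoids\<close>

definition simplicial_complex :: "'v set \<Rightarrow> 'v set set \<Rightarrow> bool" where
  "simplicial_complex V K \<longleftrightarrow> finite V \<and> K \<subseteq> Pow V \<and>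
     (\<forall>A\<in>K. \<forall>B. B \<subseteq> A \<longrightarrow> B \<in> K) \<and> (\<forall>v\<in>V. {v} \<in> K)"

text \<open>The free binoid on \<open>V\<close>: finite formal sums of elements of \<open>V\<close> (\<^term>\<open>Some m\<close> for a
  multiset \<open>m\<close> over \<open>V\<close>), together with \<open>\<infinity>\<close> (\<^term>\<open>None\<close>).\<close>

fun free_add :: "'v multiset option \<Rightarrow> 'v multiset option \<Rightarrow> 'v multiset option" where
  "free_add (Some a) (Some b) = Some (a + b)"
| "free_add None _ = None"
| "free_add _ None = None"

definition free_carrier :: "'v set \<Rightarrow> 'v multiset option set" where
  "free_carrier V = insert None (Some ` {m. set_mset m \<subseteq> V})"

text \<open>The congruence on the free binoid generated by the relations \<open>\<Sum>i\<in>A. x\<^sub>i = \<infinity>\<close>,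
  where \<open>A\<close> ranges over the subsets of \<open>V\<close> that are not faces.\<close>

inductive simplicial_cong ::
    "'v set \<Rightarrow> 'v set set \<Rightarrow> 'v multiset option \<Rightarrow> 'v multiset option \<Rightarrow> bool"
  for V K where
  nonface: "A \<subseteq> V \<Longrightarrow> A \<notin> K \<Longrightarrow> simplicial_cong V K (Some (mset_set A)) None"
| refl: "x \<in> free_carrier V \<Longrightarrow> simplicial_cong V K x x"
| sym: "simplicial_cong V K x y \<Longrightarrow> simplicial_cong V K y x"
| trans: "simplicial_cong V K x y \<Longrightarrow> simplicial_cong V K y z \<Longrightarrow> simplicial_cong V K x z"
| add: "simplicial_cong V K x y \<Longrightarrow> z \<in> free_carrier V \<Longrightarrow>
         simplicial_cong V K (free_add x z) (free_add y z)"

definition simplicial_class ::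
    "'v set \<Rightarrow> 'v set set \<Rightarrow> 'v multiset option \<Rightarrow> 'v multiset option set" where
  "simplicial_class V K x = {y. simplicial_cong V K x y}"

definition simplicial_binoid ::
    "'v set \<Rightarrow> 'v set set \<Rightarrow> 'v multiset option set binoid" where
  "simplicial_binoid V K =
    \<lparr>carrier = simplicial_class V K ` free_carrier V,
     monoid.mult = (\<lambda>X Y. \<Union>x\<in>X. \<Union>y\<in>Y. simplicial_class V K (free_add x y)),
     one = simplicial_class V K (Some {#}),
     absorbing = simplicial_class V K None\<rparr>"

definition simplicial_gen ::
    "'v set \<Rightarrow> 'v set set \<Rightarrow> 'v \<Rightarrow> 'v multiset option set" where
  "simplicial_gen V K v = simplicial_class V K (Some {#v#})"

definition face_prime ::
    "'v set \<Rightarrow> 'v set set \<Rightarrow> 'v set \<Rightarrow> 'v multiset option set set" where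
  "face_prime V K F = binoid_genideal (simplicial_binoid V K) (simplicial_gen V K ` (V - F))"

definition face_open ::
    "'v set \<Rightarrow> 'v set set \<Rightarrow> 'v set \<Rightarrow> 'v multiset option set set set" where
  "face_open V K F =
     basic_open (simplicial_binoid V K) (finprod (simplicial_binoid V K) (simplicial_gen V K) F)"

definition minimally_covered ::
    "'v set \<Rightarrow> 'v set set \<Rightarrow> 'v multiset option set set set \<Rightarrow> 'i set \<Rightarrow> ('i \<Rightarrow> 'v set) \<Rightarrow> bool" where
  "minimally_covered V K U I F \<longleftrightarrow>
     (\<forall>k\<in>I. F k \<in> K) \<and>
     U = (\<Union>k\<in>I. face_open V K (F k)) \<and>
     bij_betw (\<lambda>k. face_prime V K (F k)) I {P \<in> U. \<forall>Q\<in>U. P \<subseteq> Q \<longrightarrow> Q = P}"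

lemma simplicial_cong_carrier:
  assumes "finite V" "simplicial_cong V K x y"
  shows "x \<in> free_carrier V \<and> y \<in> free_carrier V"
proof -
  have add_closed: "free_add a b \<in> free_carrier V"
    if "a \<in> free_carrier V" "b \<in> free_carrier V" for a b
    using that by (cases a; cases b) (auto simp: free_carrier_def)
  show ?thesis
    using assms(2)
  proof induction
    case (nonface A)
    then have "set_mset (mset_set A) \<subseteq> V"
      using finite_subset[OF _ assms(1)] by simp
    then show ?case
      by (simp add: free_carrier_def)
  qed (auto intro: add_closed)
qed

lemma binoid_simplicial_binoid:
  assumes "finite V"
  shows "binoid (simplicial_binoid V K)"
proof -
  let ?c = "simplicial_class V K" and ?M = "simplicial_binoid V K"
  have comm: "free_add a b = free_add b a" for a b :: "'a multiset option"
    by (cases a; cases b) auto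
  have assoc: "free_add (free_add a b) c = free_add a (free_add b c)" for a b c :: "'a multiset option"
    by (cases a; cases b; cases c) (auto simp: ac_simps)
  have closed: "free_add a b \<in> free_carrier V"
    if "a \<in> free_carrier V" "b \<in> free_carrier V" for a b
    using that by (cases a; cases b) (auto simp: free_carrier_def)
  have mem: "y \<in> ?c x \<longleftrightarrow> simplicial_cong V K x y" for x y
    by (simp add: simplicial_class_def)
  have class_eq: "?c x = ?c y" if "simplicial_cong V K x y" for x y
    using simplicial_cong.trans[OF that] simplicial_cong.trans[OF simplicial_cong.sym[OF that]]
    by (auto simp: mem)
  have mult: "?c x \<otimes>\<^bsub>?M\<^esub> ?c y = ?c (free_add x y)"
    if "x \<in> free_carrier V" "y \<in> free_carrier V" for x y
  proof -
    have "?c (free_add x' y') = ?c (free_add x y)"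
      if xy: "x' \<in> ?c x" "y' \<in> ?c y" for x' y'
    proof -
      have "simplicial_cong V K (free_add x y) (free_add x' y)"
        using xy \<open>y \<in> _\<close> by (auto simp: mem intro: simplicial_cong.add)
      moreover have "x' \<in> free_carrier V"
        using xy simplicial_cong_carrier[OF assms] by (auto simp: mem)
      then have "simplicial_cong V K (free_add x' y) (free_add x' y')"
        using xy simplicial_cong.add[of V K y y' x'] by (auto simp: mem comm)
      ultimately show ?thesis
        using class_eq by simp
    qed
    then have "(\<Union>x'\<in>?c x. \<Union>y'\<in>?c y. ?c (free_add x' y')) =
        (\<Union>x'\<in>?c x. \<Union>y'\<in>?c y. ?c (free_add x y))"
      by (intro SUP_cong refl) auto
    moreover have "x \<in> ?c x" "y \<in> ?c y"
      using that by (auto simp: mem intro: simplicial_cong.refl)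
    then have "(\<Union>x'\<in>?c x. \<Union>y'\<in>?c y. ?c (free_add x y)) = ?c (free_add x y)"
      by (simp only: UN_constant empty_iff if_False) (metis empty_iff)
    ultimately show ?thesis
      by (simp add: simplicial_binoid_def)
  qed
  have carr: "carrier ?M = ?c ` free_carrier V" "\<one>\<^bsub>?M\<^esub> = ?c (Some {#})" "absorbing ?M = ?c None"
    by (simp_all add: simplicial_binoid_def)
  have basic: "Some {#} \<in> free_carrier V" "None \<in> free_carrier V"
    by (auto simp: free_carrier_def)
  have zero: "free_add (Some {#}) a = a" for a :: "'a multiset option"
    by (cases a) auto
  have "comm_monoid ?M"
  proof (rule comm_monoidI)
    show "x \<otimes>\<^bsub>?M\<^esub> y \<otimes>\<^bsub>?M\<^esub> z = x \<otimes>\<^bsub>?M\<^esub> (y \<otimes>\<^bsub>?M\<^esub> z)"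
      if "x \<in> carrier ?M" "y \<in> carrier ?M" "z \<in> carrier ?M" for x y z
      using that by (auto simp: carr mult closed assoc)
    show "x \<otimes>\<^bsub>?M\<^esub> y = y \<otimes>\<^bsub>?M\<^esub> x" if "x \<in> carrier ?M" "y \<in> carrier ?M" for x y
      using that by (auto simp: carr mult comm)
  qed (auto simp: carr mult closed basic zero)
  then show ?thesis
    by (auto simp: binoid_def carr mult basic)
qed


section \<open>Cohomology of cochain complexes\<close>

text \<open>Abelian groups are commutative groups in the multiplicative notation of \<open>HOL-Algebra\<close>.\<close>

fun coboundaries :: "(nat \<Rightarrow> 'a monoid) \<Rightarrow> (nat \<Rightarrow> 'a \<Rightarrow> 'a) \<Rightarrow> nat \<Rightarrow> 'a set" where
  "coboundaries C d 0 = {\<one>\<^bsub>C 0\<^esub>}"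
| "coboundaries C d (Suc p) = d p ` carrier (C p)"

definition cohomology :: "(nat \<Rightarrow> 'a monoid) \<Rightarrow> (nat \<Rightarrow> 'a \<Rightarrow> 'a) \<Rightarrow> nat \<Rightarrow> 'a set monoid" where
  "cohomology C d p =
     (C p)\<lparr>carrier := kernel (C p) (C (Suc p)) (d p)\<rparr> Mod coboundaries C d p"


section \<open>Sheaves of abelian groups\<close>

text \<open>\<open>res F V W\<close> is the restriction map from \<open>F(V)\<close> to \<open>F(W)\<close>. The values of \<open>sec\<close> and \<open>res\<close>
  are only relevant on open sets \<open>W \<subseteq> V\<close>.\<close>

record ('p, 'a) presheaf =
  sec :: "'p set \<Rightarrow> 'a monoid"
  res :: "'p set \<Rightarrow> 'p set \<Rightarrow> 'a \<Rightarrow> 'a"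

definition presheaf :: "'p topology \<Rightarrow> ('p, 'a) presheaf \<Rightarrow> bool" where
  "presheaf X F \<longleftrightarrow>
     (\<forall>V. openin X V \<longrightarrow> comm_group (sec F V)) \<and>
     (\<forall>V W. openin X V \<and> openin X W \<and> W \<subseteq> V \<longrightarrow> res F V W \<in> hom (sec F V) (sec F W)) \<and>
     (\<forall>V. openin X V \<longrightarrow> (\<forall>s\<in>carrier (sec F V). res F V V s = s)) \<and>
     (\<forall>V W W'. openin X V \<and> openin X W \<and> openin X W' \<and> W' \<subseteq> W \<and> W \<subseteq> V \<longrightarrow>
        (\<forall>s\<in>carrier (sec F V). res F W W' (res F V W s) = res F V W' s))"

definition sheaf :: "'p topology \<Rightarrow> ('p, 'a) presheaf \<Rightarrow> bool" where
  "sheaf X F \<longleftrightarrow> presheaf X F \<and>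
     (\<forall>\<W> s. (\<forall>W\<in>\<W>. openin X W \<and> s W \<in> carrier (sec F W)) \<and>
        (\<forall>W\<in>\<W>. \<forall>W'\<in>\<W>. res F W (W \<inter> W') (s W) = res F W' (W \<inter> W') (s W')) \<longrightarrow>
        (\<exists>!t. t \<in> carrier (sec F (\<Union>\<W>)) \<and> (\<forall>W\<in>\<W>. res F (\<Union>\<W>) W t = s W)))"

definition sheaf_hom ::
    "'p topology \<Rightarrow> ('p, 'a) presheaf \<Rightarrow> ('p, 'b) presheaf \<Rightarrow> ('p set \<Rightarrow> 'a \<Rightarrow> 'b) \<Rightarrow> bool" where
  "sheaf_hom X A B \<phi> \<longleftrightarrow>
     (\<forall>V. openin X V \<longrightarrow> \<phi> V \<in> hom (sec A V) (sec B V)) \<and>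
     (\<forall>V W. openin X V \<and> openin X W \<and> W \<subseteq> V \<longrightarrow>
        (\<forall>s\<in>carrier (sec A V). res B V W (\<phi> V s) = \<phi> W (res A V W s)))"

definition sheaf_mono ::
    "'p topology \<Rightarrow> ('p, 'a) presheaf \<Rightarrow> ('p, 'b) presheaf \<Rightarrow> ('p set \<Rightarrow> 'a \<Rightarrow> 'b) \<Rightarrow> bool" where
  "sheaf_mono X A B \<phi> \<longleftrightarrow> sheaf_hom X A B \<phi> \<and>
     (\<forall>V. openin X V \<longrightarrow> inj_on (\<phi> V) (carrier (sec A V)))"

text \<open>Exactness of \<open>A \<rightarrow> B \<rightarrow> C\<close> at \<open>B\<close>; the image is the sheaf image, that is, membership in it
  is a local condition.\<close>

definition sheaf_exact ::
    "'p topology \<Rightarrow> ('p, 'a) presheaf \<Rightarrow> ('p, 'b) presheaf \<Rightarrow> ('p, 'c) presheaf \<Rightarrow>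
      ('p set \<Rightarrow> 'a \<Rightarrow> 'b) \<Rightarrow> ('p set \<Rightarrow> 'b \<Rightarrow> 'c) \<Rightarrow> bool" where
  "sheaf_exact X A B C \<phi> \<psi> \<longleftrightarrow>
     (\<forall>V. openin X V \<longrightarrow> (\<forall>t\<in>carrier (sec B V).
        \<psi> V t = \<one>\<^bsub>sec C V\<^esub> \<longleftrightarrow>
        (\<forall>x\<in>V. \<exists>W. openin X W \<and> x \<in> W \<and> W \<subseteq> V \<and>
           (\<exists>s\<in>carrier (sec A W). \<phi> W s = res B V W t))))"

text \<open>The test sheaves \<open>A\<close>, \<open>B\<close> have sections in the same type as \<open>I\<close>. For the type used below
  this is no restriction: as in Baer's criterion, it suffices to test with subsheaves \<open>A\<close> of the
  extensions by zero \<open>B = \<int>\<^sub>V\<close> of constant sheaves on open sets \<open>V\<close> (a generating family), and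
  these have isomorphic copies with sections in that type.\<close>

definition injective_sheaf :: "'p topology \<Rightarrow> ('p, 'u) presheaf \<Rightarrow> bool" where
  "injective_sheaf X I \<longleftrightarrow> sheaf X I \<and>
     (\<forall>(A :: ('p, 'u) presheaf) (B :: ('p, 'u) presheaf) \<iota> \<phi>.
        sheaf X A \<and> sheaf X B \<and> sheaf_mono X A B \<iota> \<and> sheaf_hom X A I \<phi> \<longrightarrow>
        (\<exists>\<psi>. sheaf_hom X B I \<psi> \<and>
           (\<forall>V. openin X V \<longrightarrow> (\<forall>s\<in>carrier (sec A V). \<psi> V (\<iota> V s) = \<phi> V s))))"

text \<open>\<open>0 \<rightarrow> F \<rightarrow> I\<^sub>0 \<rightarrow> I\<^sub>1 \<rightarrow> \<dots>\<close> with augmentation \<open>\<epsilon>\<close> and differentials \<open>d n\<close>.\<close>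

definition injective_resolution ::
    "'p topology \<Rightarrow> ('p, 'a) presheaf \<Rightarrow> ('p set \<Rightarrow> 'a \<Rightarrow> 'u) \<Rightarrow>
      (nat \<Rightarrow> ('p, 'u) presheaf) \<Rightarrow> (nat \<Rightarrow> 'p set \<Rightarrow> 'u \<Rightarrow> 'u) \<Rightarrow> bool" where
  "injective_resolution X F \<epsilon> I d \<longleftrightarrow>
     (\<forall>n. injective_sheaf X (I n)) \<and>
     (\<forall>n. sheaf_hom X (I n) (I (Suc n)) (d n)) \<and>
     sheaf_mono X F (I 0) \<epsilon> \<and>
     sheaf_exact X F (I 0) (I 1) \<epsilon> (d 0) \<and>
     (\<forall>n. sheaf_exact X (I n) (I (Suc n)) (I (Suc (Suc n))) (d n) (d (Suc n)))"

text \<open>A type that is large enough to contain an injective resolution of every sheaf with sections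
  in \<open>'a\<close> on every topology on \<open>'p\<close>: it has at least as many elements as there are germs of such
  sections, it is infinite, and it has the same cardinality as the functions from \<open>'p\<close> to it.\<close>

type_synonym ('p, 'a) sheaf_universe = "nat \<times> 'p \<Rightarrow> 'a + nat"

definition chosen_injective_resolution ::
    "'p topology \<Rightarrow> ('p, 'a) presheaf \<Rightarrow>
      (nat \<Rightarrow> ('p, ('p, 'a) sheaf_universe) presheaf) \<times>
      (nat \<Rightarrow> 'p set \<Rightarrow> ('p, 'a) sheaf_universe \<Rightarrow> ('p, 'a) sheaf_universe)" where
  "chosen_injective_resolution X F = (SOME (I, d). \<exists>\<epsilon>. injective_resolution X F \<epsilon> I d)"

text \<open>Sheaf cohomology on the whole space, as the right derived functors of the functor of global
  sections; up to isomorphism it does not depend on the chosen resolution.\<close>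

definition sheaf_cohomology ::
    "'p topology \<Rightarrow> ('p, 'a) presheaf \<Rightarrow> nat \<Rightarrow> ('p, 'a) sheaf_universe set monoid" where
  "sheaf_cohomology X F p =
     (case chosen_injective_resolution X F of
        (I, d) \<Rightarrow> cohomology (\<lambda>n. sec (I n) (topspace X)) (\<lambda>n. d n (topspace X)) p)"

text \<open>The sections over \<open>V\<close> are the locally constant functions from \<open>V\<close> to \<open>\<int>\<close>.\<close>

definition constant_sheaf_int :: "'p topology \<Rightarrow> ('p, 'p \<Rightarrow> int) presheaf" where
  "constant_sheaf_int X =
    \<lparr>sec = (\<lambda>V.
       \<lparr>carrier = {s \<in> extensional V. continuous_map (subtopology X V) (discrete_topology UNIV) s},
        monoid.mult = (\<lambda>s t. \<lambda>x\<in>V. s x + t x),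
        one = (\<lambda>x\<in>V. 0)\<rparr>),
     res = (\<lambda>V W s. restrict s W)\<rparr>"


section \<open>Cech cohomology, nerves and simplicial cohomology\<close>

text \<open>A strictly increasing sequence \<open>i\<^sub>0 < \<dots> < i\<^sub>p\<close> of indices (or of vertices) is represented by the
  set of its terms. In \<open>J = {i\<^sub>0 < \<dots> < i\<^sub>p}\<close>, the sign of the face omitting \<open>k = i\<^sub>r\<close> is \<open>(-1) ^ r\<close>.\<close>

definition face_sign :: "'i::linorder set \<Rightarrow> 'i \<Rightarrow> int" where
  "face_sign J k = (-1) ^ card {l \<in> J. l < k}"

definition subsets_dim :: "nat \<Rightarrow> 'i set \<Rightarrow> 'i set set" where
  "subsets_dim p I = {J. J \<subseteq> I \<and> finite J \<and> card J = Suc p}"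

definition cech_cochains ::
    "('p, 'a) presheaf \<Rightarrow> 'i set \<Rightarrow> ('i \<Rightarrow> 'p set) \<Rightarrow> nat \<Rightarrow> ('i set \<Rightarrow> 'a) monoid" where
  "cech_cochains F I \<U> p = product_group (subsets_dim p I) (\<lambda>J. sec F (\<Inter>k\<in>J. \<U> k))"

definition cech_coboundary ::
    "('p, 'a) presheaf \<Rightarrow> 'i::linorder set \<Rightarrow> ('i \<Rightarrow> 'p set) \<Rightarrow> nat \<Rightarrow> ('i set \<Rightarrow> 'a) \<Rightarrow> 'i set \<Rightarrow> 'a" where
  "cech_coboundary F I \<U> p s =
     (\<lambda>J\<in>subsets_dim (Suc p) I.
        finprod (sec F (\<Inter>l\<in>J. \<U> l))
          (\<lambda>k. res F (\<Inter>l\<in>J - {k}. \<U> l) (\<Inter>l\<in>J. \<U> l) (s (J - {k}))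
                 [^]\<^bsub>sec F (\<Inter>l\<in>J. \<U> l)\<^esub> face_sign J k) J)"

definition cech_cohomology ::
    "('p, 'a) presheaf \<Rightarrow> 'i::linorder set \<Rightarrow> ('i \<Rightarrow> 'p set) \<Rightarrow> nat \<Rightarrow> ('i set \<Rightarrow> 'a) set monoid" where
  "cech_cohomology F I \<U> p = cohomology (cech_cochains F I \<U>) (cech_coboundary F I \<U>) p"

definition nerve :: "'i set \<Rightarrow> ('i \<Rightarrow> 'p set) \<Rightarrow> 'i set set" where
  "nerve I \<U> = insert {} {J. J \<subseteq> I \<and> J \<noteq> {} \<and> (\<Inter>k\<in>J. \<U> k) \<noteq> {}}"

definition simplices :: "'v set set \<Rightarrow> nat \<Rightarrow> 'v set set" where
  "simplices K p = {J \<in> K. finite J \<and> card J = Suc p}"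

definition simplicial_cochains :: "'v set set \<Rightarrow> nat \<Rightarrow> ('v set \<Rightarrow> int) monoid" where
  "simplicial_cochains K p = product_group (simplices K p) (\<lambda>_. integer_group)"

definition simplicial_coboundary ::
    "'v::linorder set set \<Rightarrow> nat \<Rightarrow> ('v set \<Rightarrow> int) \<Rightarrow> 'v set \<Rightarrow> int" where
  "simplicial_coboundary K p s =
     (\<lambda>J\<in>simplices K (Suc p). \<Sum>k\<in>J. face_sign J k * s (J - {k}))"

definition simplicial_cohomology ::
    "'v::linorder set set \<Rightarrow> nat \<Rightarrow> ('v set \<Rightarrow> int) set monoid" where
  "simplicial_cohomology K p = cohomology (simplicial_cochains K) (simplicial_coboundary K) p"

end

theory Submission
  imports Defs "HOL-Library.Function_Algebras" "HOL-Algebra.Multiplicative_Group"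
begin

text \<open>The open set \<open>U\<close> is a finite space \<open>X\<close>, hence every point has a minimal open neighbourhood.
  The intersections of the sets \<open>D(F\<^sub>k)\<close> are again of the form \<open>D(f)\<close>, and a nonempty set \<open>D(f)\<close> is
  the minimal neighbourhood of the union of the prime ideals in it. On a minimal
  neighbourhood every exact sequence of sheaves stays exact on sections and the constant sheaf has
  only constant sections. So the Cech complex of the constant sheaf is the cochain complex of the
  nerve. For the injective resolution \<open>I\<close> that defines sheaf cohomology, the double complex
  of the sections of \<open>I q\<close> on the \<open>p\<close>-fold intersections has exact columns for this reason. Its rows
  are exact because injective sheaves are flabby, and a comparison of the two edges
  gives the isomorphism with sheaf cohomology.

  That an injective resolution with sections in the prescribed type exists also needs a proof:
  on the finite space \<open>X\<close> the cochains on the chains of the specialization order, with values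
  in \<open>\<rat>\<close> and \<open>\<rat>/\<int>\<close>, form a resolution of \<open>\<int>\<close> by products of skyscraper sheaves
  of divisible groups, and these have only countably many sections.\<close>

section \<open>Divisible groups\<close>

text \<open>\<open>sheaf_cohomology\<close> is defined by a choice among the injective resolutions
  with sections in one prescribed type. A resolution in that type has to be exhibited for the choice
  to mean anything; afterwards the chosen one is known only to be an injective resolution. So the
  comparison with the nerve is made for an arbitrary one, and homotopy uniqueness of resolutions
  never enters.

  Each group of sections has its own carrier and operation, whereas the double complex is computed
  with + and \<open>sum\<close> in a type of class \<open>ab_group_add\<close>. Characters into
  \<rat>/\<int> bridge the two: they separate the elements of every abelian group, so evaluation at
  characters embeds each group of sections into functions with values in \<rat>/\<int>. Divisibility
  thus serves twice, for this embedding and for the skyscrapers of the resolution.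

  The edges of the double complex are linked by a relation instead of a map, because every stair
  involves a choice of preimages; the choices disappear only on cohomology.

  Rational cochains alone would resolve \<rat>. As \<int> is the kernel of the surjection \<rat>
  \<rightarrow> \<rat>/\<int>, the cone of this map on cochains resolves \<int>.\<close>

definition divisible_group :: "('a, 'b) monoid_scheme \<Rightarrow> bool" where
  "divisible_group D \<longleftrightarrow> comm_group D \<and> (\<forall>y\<in>carrier D. \<forall>m>0. \<exists>z\<in>carrier D. z [^]\<^bsub>D\<^esub> (m::nat) = y)"

text \<open>The graph of a homomorphism from a subgroup of \<open>G\<close> to \<open>D\<close>. For
  a subgroup of the product, single-valuedness over the neutral element gives it over every element.
  With graphs, extension is inclusion and a chain is bounded by its union.\<close>

definition partial_hom :: "('a, 'c) monoid_scheme \<Rightarrow> ('b, 'd) monoid_scheme \<Rightarrow> ('a \<times> 'b) set \<Rightarrow> bool" where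
  "partial_hom G D R \<longleftrightarrow> subgroup R (G \<times>\<times> D) \<and> (\<forall>y. (\<one>\<^bsub>G\<^esub>, y) \<in> R \<longrightarrow> y = \<one>\<^bsub>D\<^esub>)"

lemma int_pow_DirProd:
  assumes "group G" "group D" "g \<in> carrier G" "x \<in> carrier D"
  shows "(g, x) [^]\<^bsub>G \<times>\<times> D\<^esub> (k::int) = (g [^]\<^bsub>G\<^esub> k, x [^]\<^bsub>D\<^esub> k)"
proof -
  interpret G: group G by fact
  interpret D: group D by fact
  have *: "(g, x) [^]\<^bsub>G \<times>\<times> D\<^esub> (n::nat) = (g [^]\<^bsub>G\<^esub> n, x [^]\<^bsub>D\<^esub> n)" for n
    by (induction n) simp_all
  have "inv\<^bsub>G \<times>\<times> D\<^esub> (g [^]\<^bsub>G\<^esub> n, x [^]\<^bsub>D\<^esub> n) = (inv\<^bsub>G\<^esub> (g [^]\<^bsub>G\<^esub> n), inv\<^bsub>D\<^esub> (x [^]\<^bsub>D\<^esub> n))"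
    for n :: nat
    using assms by (intro inv_DirProd) auto
  then show ?thesis
    by (auto simp only: int_pow_def2 * split: if_split)
qed

lemma partial_hom_rules:
  assumes "partial_hom G D R" "group G" "group D"
  shows "(\<one>\<^bsub>G\<^esub>, \<one>\<^bsub>D\<^esub>) \<in> R"
    and "(g, x) \<in> R \<Longrightarrow> g \<in> carrier G" and "(g, x) \<in> R \<Longrightarrow> x \<in> carrier D"
    and "(g, x) \<in> R \<Longrightarrow> (h, y) \<in> R \<Longrightarrow> (g \<otimes>\<^bsub>G\<^esub> h, x \<otimes>\<^bsub>D\<^esub> y) \<in> R"
    and "(g, x) \<in> R \<Longrightarrow> (inv\<^bsub>G\<^esub> g, inv\<^bsub>D\<^esub> x) \<in> R"
    and "(g, x) \<in> R \<Longrightarrow> (g [^]\<^bsub>G\<^esub> (k::int), x [^]\<^bsub>D\<^esub> k) \<in> R"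
    and "(g, x) \<in> R \<Longrightarrow> (g, y) \<in> R \<Longrightarrow> x = y"
proof -
  interpret G: group G by fact
  interpret D: group D by fact
  interpret GD: group "G \<times>\<times> D" by (rule DirProd_group) fact+
  have R: "subgroup R (G \<times>\<times> D)" and single: "\<And>y. (\<one>\<^bsub>G\<^esub>, y) \<in> R \<Longrightarrow> y = \<one>\<^bsub>D\<^esub>"
    using assms(1) by (auto simp: partial_hom_def)
  show one: "(\<one>\<^bsub>G\<^esub>, \<one>\<^bsub>D\<^esub>) \<in> R" using subgroup.one_closed[OF R] by simp
  show carr: "\<And>g x. (g, x) \<in> R \<Longrightarrow> g \<in> carrier G" "\<And>g x. (g, x) \<in> R \<Longrightarrow> x \<in> carrier D"
    using subgroup.mem_carrier[OF R] by auto
  show mult: "\<And>g x h y. (g, x) \<in> R \<Longrightarrow> (h, y) \<in> R \<Longrightarrow> (g \<otimes>\<^bsub>G\<^esub> h, x \<otimes>\<^bsub>D\<^esub> y) \<in> R"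
    using subgroup.m_closed[OF R] by force
  show minv: "\<And>g x. (g, x) \<in> R \<Longrightarrow> (inv\<^bsub>G\<^esub> g, inv\<^bsub>D\<^esub> x) \<in> R"
    using subgroup.m_inv_closed[OF R] carr by (metis assms(2,3) inv_DirProd)
  show "(g, x) \<in> R \<Longrightarrow> (g [^]\<^bsub>G\<^esub> (k::int), x [^]\<^bsub>D\<^esub> k) \<in> R"
    using GD.subgroup_int_pow_closed[OF R] int_pow_DirProd[OF assms(2,3)] carr by metis
  show "x = y" if xy: "(g, x) \<in> R" "(g, y) \<in> R"
  proof -
    have "(\<one>\<^bsub>G\<^esub>, x \<otimes>\<^bsub>D\<^esub> inv\<^bsub>D\<^esub> y) \<in> R"
      using mult[OF xy(1) minv[OF xy(2)]] carr[OF xy(1)] by simp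
    then have "x \<otimes>\<^bsub>D\<^esub> inv\<^bsub>D\<^esub> y = \<one>\<^bsub>D\<^esub>" by (rule single)
    then show "x = y" using carr xy by (simp add: D.inv_solve_right')
  qed
qed

text \<open>The new graph adds the multiples of \<open>(x, y)\<close> to \<open>R\<close>. In
  additive notation: if h + k x = 0 with \<open>(h, d)\<close> in \<open>R\<close>, then k x = -h
  has the value -d under \<open>R\<close>, so \<open>compat\<close> gives d + k y = 0, which is
  single-valuedness.\<close>

lemma partial_hom_adjoin:
  assumes G: "comm_group G" and D: "comm_group D" and R: "partial_hom G D R"
    and x: "x \<in> carrier G" and y: "y \<in> carrier D"
    and compat: "\<And>(k::int) d. (x [^]\<^bsub>G\<^esub> k, d) \<in> R \<Longrightarrow> d = y [^]\<^bsub>D\<^esub> k"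
  shows "\<exists>R'. partial_hom G D R' \<and> R \<subseteq> R' \<and> (x, y) \<in> R'"
proof -
  interpret G: comm_group G by fact
  interpret D: comm_group D by fact
  note [simp] = partial_hom_rules(2,3)[OF R G.is_group D.is_group]
  note rules = partial_hom_rules[OF R G.is_group D.is_group]
  interpret GD: group "G \<times>\<times> D" by (rule DirProd_group) (rule G.is_group D.is_group)+
  define R' where "R' = {(h \<otimes>\<^bsub>G\<^esub> x [^]\<^bsub>G\<^esub> k, d \<otimes>\<^bsub>D\<^esub> y [^]\<^bsub>D\<^esub> k) | h d (k::int). (h, d) \<in> R}"
  have I: "(h \<otimes>\<^bsub>G\<^esub> x [^]\<^bsub>G\<^esub> k, d \<otimes>\<^bsub>D\<^esub> y [^]\<^bsub>D\<^esub> k) \<in> R'" if "(h, d) \<in> R" for h d and k :: int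
    using that by (auto simp: R'_def)
  have "subgroup R' (G \<times>\<times> D)"
  proof (rule GD.subgroupI)
    show "R' \<subseteq> carrier (G \<times>\<times> D)" using x y by (auto simp: R'_def)
    show "R' \<noteq> {}" using I rules(1) by blast
    show "inv\<^bsub>G \<times>\<times> D\<^esub> a \<in> R'" if a': "a \<in> R'" for a
    proof -
      obtain h d and k :: int where a: "a = (h \<otimes>\<^bsub>G\<^esub> x [^]\<^bsub>G\<^esub> k, d \<otimes>\<^bsub>D\<^esub> y [^]\<^bsub>D\<^esub> k)" and hd: "(h, d) \<in> R"
        using a' unfolding R'_def by blast
      have c: "h \<in> carrier G" "d \<in> carrier D" using hd by (rule rules)+
      have "inv\<^bsub>G \<times>\<times> D\<^esub> a = (inv\<^bsub>G\<^esub> h \<otimes>\<^bsub>G\<^esub> x [^]\<^bsub>G\<^esub> (-k), inv\<^bsub>D\<^esub> d \<otimes>\<^bsub>D\<^esub> y [^]\<^bsub>D\<^esub> (-k))"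
        using c x y by (simp add: a G.is_group D.is_group G.inv_mult D.inv_mult G.int_pow_neg D.int_pow_neg)
      then show ?thesis using I[OF rules(5)[OF hd]] by simp
    qed
    show "a \<otimes>\<^bsub>G \<times>\<times> D\<^esub> b \<in> R'" if ab: "a \<in> R'" "b \<in> R'" for a b
    proof -
      obtain h d and k :: int where a: "a = (h \<otimes>\<^bsub>G\<^esub> x [^]\<^bsub>G\<^esub> k, d \<otimes>\<^bsub>D\<^esub> y [^]\<^bsub>D\<^esub> k)" and hd: "(h, d) \<in> R"
        using ab unfolding R'_def by blast
      obtain h' d' and k' :: int where b: "b = (h' \<otimes>\<^bsub>G\<^esub> x [^]\<^bsub>G\<^esub> k', d' \<otimes>\<^bsub>D\<^esub> y [^]\<^bsub>D\<^esub> k')" and hd': "(h', d') \<in> R"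
        using ab unfolding R'_def by blast
      have c: "h \<in> carrier G" "d \<in> carrier D" "h' \<in> carrier G" "d' \<in> carrier D" using hd hd' by (auto dest: rules(2,3))
      have "a \<otimes>\<^bsub>G \<times>\<times> D\<^esub> b = ((h \<otimes>\<^bsub>G\<^esub> h') \<otimes>\<^bsub>G\<^esub> x [^]\<^bsub>G\<^esub> (k + k'), (d \<otimes>\<^bsub>D\<^esub> d') \<otimes>\<^bsub>D\<^esub> y [^]\<^bsub>D\<^esub> (k + k'))"
        using c x y by (simp add: a b G.int_pow_mult[symmetric] D.int_pow_mult[symmetric] G.m_ac D.m_ac add.commute)
      then show ?thesis using I[OF rules(4)[OF hd hd']] by simp
    qed
  qed
  moreover have "e = \<one>\<^bsub>D\<^esub>" if e': "(\<one>\<^bsub>G\<^esub>, e) \<in> R'" for e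
  proof -
    obtain h d and k :: int where e: "\<one>\<^bsub>G\<^esub> = h \<otimes>\<^bsub>G\<^esub> x [^]\<^bsub>G\<^esub> k" "e = d \<otimes>\<^bsub>D\<^esub> y [^]\<^bsub>D\<^esub> k" and hd: "(h, d) \<in> R"
      using e' unfolding R'_def by blast
    have c: "h \<in> carrier G" "d \<in> carrier D" using hd by (rule rules)+
    have "inv\<^bsub>G\<^esub> h = x [^]\<^bsub>G\<^esub> k" using c x e(1) by (metis G.inv_equality G.int_pow_closed G.m_comm)
    then have "inv\<^bsub>D\<^esub> d = y [^]\<^bsub>D\<^esub> k" using compat rules(5)[OF hd] by metis
    then show ?thesis using c y e(2) by (metis D.r_inv)
  qed
  moreover have "R \<subseteq> R'"
  proof
    fix p assume "p \<in> R"
    then show "p \<in> R'" using I[of "fst p" "snd p" 0] rules(2,3)[of "fst p" "snd p"] by simp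
  qed
  moreover have "(x, y) \<in> R'"
    using I[OF rules(1), of 1] x y by simp
  ultimately show ?thesis by (auto simp: partial_hom_def)
qed

text \<open>The exponents \<open>k\<close> for which the power of \<open>x\<close> lies in the
  domain form a subgroup of \<int>. If \<open>m\<close> is its positive generator, with value
  \<open>d0\<close>, compatibility of \<open>y\<close> amounts to the one equation that the
  \<open>m\<close>-th power of \<open>y\<close> is \<open>d0\<close>, which divisibility
  solves.\<close>

lemma partial_hom_adjoin_divisible:
  assumes G: "comm_group G" and D: "divisible_group D" and R: "partial_hom G D R" and x: "x \<in> carrier G"
  shows "\<exists>R' y. partial_hom G D R' \<and> R \<subseteq> R' \<and> (x, y) \<in> R'"
proof -
  have Dc: "comm_group D" using D by (simp add: divisible_group_def)
  interpret G: comm_group G by fact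
  interpret D: comm_group D by fact
  note rules = partial_hom_rules[OF R G.is_group D.is_group]
  have "\<exists>y\<in>carrier D. \<forall>(k::int) d. (x [^]\<^bsub>G\<^esub> k, d) \<in> R \<longrightarrow> d = y [^]\<^bsub>D\<^esub> k"
  proof (cases "\<exists>m>0. \<exists>d. (x [^]\<^bsub>G\<^esub> (m::nat), d) \<in> R")
    case False
    have "k = 0" if "(x [^]\<^bsub>G\<^esub> k, d) \<in> R" for k :: int and d
    proof (rule ccontr)
      assume "k \<noteq> 0"
      then consider "k > 0" | "-k > 0" by linarith
      then show False
      proof cases
        case 1
        then have "(x [^]\<^bsub>G\<^esub> nat k, d) \<in> R" using that by (simp add: int_pow_int[symmetric])
        then show False using False 1 by (metis zero_less_nat_eq)
      next
        case 2
        have "(inv\<^bsub>G\<^esub> (x [^]\<^bsub>G\<^esub> k), inv\<^bsub>D\<^esub> d) \<in> R" using that by (rule rules)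
        then have "(x [^]\<^bsub>G\<^esub> nat (-k), inv\<^bsub>D\<^esub> d) \<in> R"
          using 2 x by (simp add: int_pow_int[symmetric] G.int_pow_neg)
        then show False using False 2 by (metis zero_less_nat_eq)
      qed
    qed
    \<comment> \<open>Only the exponent 0 occurs, so every value is compatible; the neutral element
      is taken.\<close>
    then have "\<forall>(k::int) d. (x [^]\<^bsub>G\<^esub> k, d) \<in> R \<longrightarrow> d = \<one>\<^bsub>D\<^esub> [^]\<^bsub>D\<^esub> k"
      using R by (fastforce simp: partial_hom_def)
    then show ?thesis by blast
  next
    case True
    define m where "m = (LEAST m. m > 0 \<and> (\<exists>d. (x [^]\<^bsub>G\<^esub> (m::nat), d) \<in> R))"
    have "m > 0 \<and> (\<exists>d. (x [^]\<^bsub>G\<^esub> m, d) \<in> R)"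
      unfolding m_def by (rule LeastI_ex) (use True in blast)
    then obtain d0 where m: "m > 0" and d0: "(x [^]\<^bsub>G\<^esub> m, d0) \<in> R" by blast
    have least: "r = 0" if "(x [^]\<^bsub>G\<^esub> r, d) \<in> R" "r < m" for r d
      using not_less_Least[of r "\<lambda>m. m > 0 \<and> (\<exists>d. (x [^]\<^bsub>G\<^esub> (m::nat), d) \<in> R)"] that
      unfolding m_def[symmetric] by auto
    obtain y where y: "y \<in> carrier D" "y [^]\<^bsub>D\<^esub> m = d0"
      using D m rules(3)[OF d0] by (auto simp: divisible_group_def)
    have "d = y [^]\<^bsub>D\<^esub> k" if kd: "(x [^]\<^bsub>G\<^esub> k, d) \<in> R" for k :: int and d
    proof -
      \<comment> \<open>Division with remainder: the remainder is again an exponent in the domain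
        and smaller than \<open>m\<close>, hence 0.\<close>
      define q r where "q = k div int m" and "r = nat (k mod int m)"
      have r: "int r = k mod int m" "r < m" using m by (auto simp: r_def nat_less_iff)
      have k: "k = int m * q + int r" by (simp add: q_def r(1))
      have mq: "(x [^]\<^bsub>G\<^esub> (int m * q), y [^]\<^bsub>D\<^esub> (int m * q)) \<in> R"
        using rules(6)[OF d0, of q] x y
        by (simp add: G.int_pow_pow D.int_pow_pow int_pow_int[symmetric] flip: y(2))
      have "x [^]\<^bsub>G\<^esub> k \<otimes>\<^bsub>G\<^esub> inv\<^bsub>G\<^esub> (x [^]\<^bsub>G\<^esub> (int m * q)) = x [^]\<^bsub>G\<^esub> r"
        using x by (simp add: k G.int_pow_diff[symmetric] int_pow_int)
      then have "(x [^]\<^bsub>G\<^esub> r, d \<otimes>\<^bsub>D\<^esub> inv\<^bsub>D\<^esub> (y [^]\<^bsub>D\<^esub> (int m * q))) \<in> R"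
        using rules(4)[OF kd rules(5)[OF mq]] by simp
      then have "r = 0" using least r(2) by blast
      then show ?thesis using rules(7)[OF mq] kd k by simp
    qed
    then show ?thesis using y(1) by blast
  qed
  then obtain y where "y \<in> carrier D" "\<And>(k::int) d. (x [^]\<^bsub>G\<^esub> k, d) \<in> R \<Longrightarrow> d = y [^]\<^bsub>D\<^esub> k" by blast
  then show ?thesis using partial_hom_adjoin[OF G Dc R x] by blast
qed

text \<open>Baer's criterion over the integers; partial homomorphisms are represented by their graphs.\<close>

theorem partial_hom_extends:
  assumes G: "comm_group G" and D: "divisible_group D" and R: "partial_hom G D R"
  shows "\<exists>\<chi>\<in>hom G D. \<forall>(g, x)\<in>R. \<chi> g = x"
proof -
  have Dc: "comm_group D" using D by (simp add: divisible_group_def)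
  interpret G: comm_group G by fact
  interpret D: comm_group D by fact
  interpret GD: group "G \<times>\<times> D" by (rule DirProd_group) (rule G.is_group D.is_group)+
  have "\<exists>M\<in>{S. partial_hom G D S \<and> R \<subseteq> S}. \<forall>S\<in>{S. partial_hom G D S \<and> R \<subseteq> S}. M \<subseteq> S \<longrightarrow> S = M"
  proof (rule subset_Zorn_nonempty)
    show "{S. partial_hom G D S \<and> R \<subseteq> S} \<noteq> {}" using R by blast
    fix C assume C: "C \<noteq> {}" "subset.chain {S. partial_hom G D S \<and> R \<subseteq> S} C"
    have "C \<subseteq> {S. partial_hom G D S \<and> R \<subseteq> S}" using C(2) unfolding subset.chain_def by blast
    then have ph: "partial_hom G D S" and sub: "R \<subseteq> S" if "S \<in> C" for S
      using that by blast+
    have sg: "subgroup S (G \<times>\<times> D)" if "S \<in> C" for S using ph[OF that] by (simp add: partial_hom_def)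
    have "subgroup (\<Union>C) (G \<times>\<times> D)"
    proof (rule GD.subgroupI)
      show "\<Union>C \<subseteq> carrier (G \<times>\<times> D)" using subgroup.subset[OF sg] by fast
      show "\<Union>C \<noteq> {}" using C(1) subgroup.one_closed[OF sg] by fast
      show "inv\<^bsub>G \<times>\<times> D\<^esub> a \<in> \<Union>C" if "a \<in> \<Union>C" for a using that subgroup.m_inv_closed[OF sg] by fast
      show "a \<otimes>\<^bsub>G \<times>\<times> D\<^esub> b \<in> \<Union>C" if ab: "a \<in> \<Union>C" "b \<in> \<Union>C" for a b
      proof -
        obtain S T where ST: "S \<in> C" "T \<in> C" "a \<in> S" "b \<in> T" using ab by blast
        then have "S \<subseteq> T \<or> T \<subseteq> S" using C(2) unfolding subset_chain_def by blast
        then obtain W where "W \<in> C" "a \<in> W" "b \<in> W" using ST by blast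
        then show ?thesis using subgroup.m_closed[OF sg] by fast
      qed
    qed
    moreover have "y = \<one>\<^bsub>D\<^esub>" if "(\<one>\<^bsub>G\<^esub>, y) \<in> \<Union>C" for y
      using that ph by (auto simp: partial_hom_def)
    moreover have "R \<subseteq> \<Union>C" using C(1) sub by blast
    ultimately show "\<Union>C \<in> {S. partial_hom G D S \<and> R \<subseteq> S}"
      by (simp add: partial_hom_def)
  qed
  then obtain M where M': "M \<in> {S. partial_hom G D S \<and> R \<subseteq> S}"
    and max': "\<forall>S\<in>{S. partial_hom G D S \<and> R \<subseteq> S}. M \<subseteq> S \<longrightarrow> S = M" by (rule bexE)
  then have M: "partial_hom G D M" "R \<subseteq> M" by auto
  note rules = partial_hom_rules[OF M(1) G.is_group D.is_group]
  have total: "\<exists>y. (x, y) \<in> M" if x: "x \<in> carrier G" for x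
  proof -
    obtain R' y where R': "partial_hom G D R'" "M \<subseteq> R'" "(x, y) \<in> R'"
      using partial_hom_adjoin_divisible[OF G D M(1) x] by (elim exE conjE)
    then have "R' = M" using max' M(2) by (metis (mono_tags, lifting) mem_Collect_eq order_trans)
    then show ?thesis using R'(3) by blast
  qed
  define \<chi> where "\<chi> x = (SOME y. (x, y) \<in> M)" for x
  have \<chi>: "(x, \<chi> x) \<in> M" if "x \<in> carrier G" for x
    unfolding \<chi>_def using total[OF that] by (rule someI_ex)
  have "\<chi> \<in> hom G D"
  proof (rule homI)
    fix x y assume xy: "x \<in> carrier G" "y \<in> carrier G"
    then show "\<chi> x \<in> carrier D" using rules(3)[OF \<chi>] by blast
    show "\<chi> (x \<otimes>\<^bsub>G\<^esub> y) = \<chi> x \<otimes>\<^bsub>D\<^esub> \<chi> y"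
      using rules(7)[OF \<chi> rules(4)[OF \<chi>[OF xy(1)] \<chi>[OF xy(2)]]] xy by simp
  qed
  moreover have "\<chi> g = x" if gx: "(g, x) \<in> R" for g x
  proof -
    have "(g, x) \<in> M" using gx M(2) by (rule subsetD[rotated])
    then show ?thesis using rules(7)[OF \<chi>[OF rules(2)]] by metis
  qed
  ultimately show ?thesis by (intro bexI[of _ \<chi>]) auto
qed

text \<open>Turns subgroups of a class type into groups with a carrier; proper subsets are needed
  for the stalks of the resolution.\<close>

definition additive_group :: "'a::ab_group_add set \<Rightarrow> 'a monoid" where
  "additive_group A = \<lparr>carrier = A, monoid.mult = (+), one = 0\<rparr>"

lemma additive_group_simps [simp]:
  "carrier (additive_group A) = A" "x \<otimes>\<^bsub>additive_group A\<^esub> y = x + y" "\<one>\<^bsub>additive_group A\<^esub> = 0"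
  by (simp_all add: additive_group_def)

lemma comm_group_additive_group:
  assumes "0 \<in> A" "\<And>x y. x \<in> A \<Longrightarrow> y \<in> A \<Longrightarrow> x + y \<in> A" "\<And>x. x \<in> A \<Longrightarrow> - x \<in> A"
  shows "comm_group (additive_group A)"
proof (rule comm_groupI)
  show "\<exists>y\<in>carrier (additive_group A). y \<otimes>\<^bsub>additive_group A\<^esub> x = \<one>\<^bsub>additive_group A\<^esub>"
    if "x \<in> carrier (additive_group A)" for x
    using that assms(3)[of x] by (auto intro!: bexI[of _ "- x"])
qed (use assms in \<open>auto simp: add_ac\<close>)

section \<open>The rational numbers modulo the integers\<close>

quotient_type ratmod = rat / "\<lambda>x y :: rat. x - y \<in> \<int>"
  morphisms rep_ratmod ratmod_of
proof (rule equivpI)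
  show "reflp (\<lambda>x y :: rat. x - y \<in> \<int>)" by (simp add: reflp_def)
  show "symp (\<lambda>x y :: rat. x - y \<in> \<int>)"
    by (rule sympI) (metis Ints_minus minus_diff_eq)
  show "transp (\<lambda>x y :: rat. x - y \<in> \<int>)"
    by (rule transpI) (use Ints_add in force)
qed

instantiation ratmod :: ab_group_add
begin

lift_definition zero_ratmod :: ratmod is 0 .

lift_definition plus_ratmod :: "ratmod \<Rightarrow> ratmod \<Rightarrow> ratmod" is "(+)"
proof -
  fix a b c d :: rat assume "a - b \<in> \<int>" "c - d \<in> \<int>"
  then have "(a - b) + (c - d) \<in> \<int>" by (rule Ints_add)
  then show "a + c - (b + d) \<in> \<int>" by (simp add: algebra_simps)
qed

lift_definition uminus_ratmod :: "ratmod \<Rightarrow> ratmod" is uminus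
proof -
  fix a b :: rat assume "a - b \<in> \<int>"
  then have "- (a - b) \<in> \<int>" by (rule Ints_minus)
  then show "- a - - b \<in> \<int>" by (simp add: algebra_simps)
qed

lift_definition minus_ratmod :: "ratmod \<Rightarrow> ratmod \<Rightarrow> ratmod" is "(-)"
proof -
  fix a b c d :: rat assume "a - b \<in> \<int>" "c - d \<in> \<int>"
  then have "(a - b) - (c - d) \<in> \<int>" by (rule Ints_diff)
  then show "a - c - (b - d) \<in> \<int>" by (simp add: algebra_simps)
qed

instance
  by standard (transfer; simp)+

end

lemma ratmod_of_add: "ratmod_of (x + y) = ratmod_of x + ratmod_of y"
  by transfer simp

lemma ratmod_of_diff: "ratmod_of (x - y) = ratmod_of x - ratmod_of y"
  by transfer simp

lemma ratmod_of_eq_0_iff: "ratmod_of x = 0 \<longleftrightarrow> x \<in> \<int>"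
  by transfer simp

lemma ratmod_of_zero [simp]: "ratmod_of 0 = 0"
  by transfer simp

lemma ratmod_of_surj: "\<exists>x. ratmod_of x = y"
  by transfer (metis Ints_0 diff_self)

lemma pow_ratmod: "ratmod_of x [^]\<^bsub>additive_group A\<^esub> (m::nat) = ratmod_of (of_nat m * x)"
  by (induction m) (simp_all add: ratmod_of_add[symmetric] algebra_simps)

lemma divisible_ratmod: "divisible_group (additive_group (UNIV :: ratmod set))"
  unfolding divisible_group_def
proof (intro conjI ballI allI impI)
  show "comm_group (additive_group (UNIV :: ratmod set))"
    by (rule comm_group_additive_group) auto
  fix y :: ratmod and m :: nat assume "m > 0"
  obtain x where "ratmod_of x = y" using ratmod_of_surj by blast
  then have "ratmod_of (x / of_nat m) [^]\<^bsub>additive_group UNIV\<^esub> m = y"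
    using \<open>m > 0\<close> by (simp add: pow_ratmod)
  then show "\<exists>z\<in>carrier (additive_group UNIV). z [^]\<^bsub>additive_group UNIV\<^esub> m = y" by auto
qed

text \<open>\<rat>/\<int> is an injective cogenerator: \<open>x\<close> may be sent to the class of
  1/m with \<open>m\<close> its order, and to any class if its order is infinite; the character on
  the cyclic group then extends by divisibility.\<close>

lemma character_nontrivial:
  assumes G: "comm_group G" and x: "x \<in> carrier G" "x \<noteq> \<one>\<^bsub>G\<^esub>"
  shows "\<exists>\<chi>\<in>hom G (additive_group (UNIV :: ratmod set)). \<chi> x \<noteq> 0"
proof -
  let ?D = "additive_group (UNIV :: ratmod set)"
  interpret G: comm_group G by fact
  interpret D: comm_group ?D using divisible_ratmod by (simp add: divisible_group_def)
  interpret GD: group "G \<times>\<times> ?D" by (rule DirProd_group) (rule G.is_group D.is_group)+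
  \<comment> \<open>\<open>ord x = 0\<close> stands for infinite order, where 2 serves as well as
    any other number. As \<open>x\<close> is not neutral, \<open>m\<close> is at least 2 and 1/m is
    not an integer.\<close>
  define m where "m = (if G.ord x = 0 then 2 else G.ord x)"
  have m: "m \<ge> 2" using x G.ord_eq_1[OF x(1)] by (auto simp: m_def)
  have "ratmod_of (1 / of_nat m) \<noteq> 0"
  proof
    assume "ratmod_of (1 / of_nat m) = 0"
    then obtain k :: int where "1 / of_nat m = (of_int k :: rat)"
      by (auto simp: ratmod_of_eq_0_iff elim: Ints_cases)
    then have "of_int (k * int m) = (1 :: rat)" using m by (simp add: field_simps)
    then have "k * int m = 1" by linarith
    then show False using m by (auto simp: zmult_eq_1_iff)
  qed
  moreover have "\<exists>R. partial_hom G ?D R \<and> {(\<one>\<^bsub>G\<^esub>, 0)} \<subseteq> R \<and> (x, ratmod_of (1 / of_nat m)) \<in> R"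
  proof (rule partial_hom_adjoin[OF G D.comm_group_axioms])
    show "partial_hom G ?D {(\<one>\<^bsub>G\<^esub>, 0)}"
      using GD.triv_subgroup by (simp add: partial_hom_def)
    fix k :: int and d assume "(x [^]\<^bsub>G\<^esub> k, d) \<in> {(\<one>\<^bsub>G\<^esub>, 0 :: ratmod)}"
    then have k: "x [^]\<^bsub>G\<^esub> k = \<one>\<^bsub>G\<^esub>" and d: "d = 0" by auto
    have "int m dvd k"
      using k x by (cases "G.ord x = 0") (auto simp: G.int_pow_eq_id m_def)
    then obtain c where c: "k = int m * c" by blast
    have "ratmod_of (1 / of_nat m) [^]\<^bsub>?D\<^esub> m = \<one>\<^bsub>?D\<^esub>"
      using m by (simp add: pow_ratmod ratmod_of_eq_0_iff)
    then have "ratmod_of (1 / of_nat m) [^]\<^bsub>?D\<^esub> k = \<one>\<^bsub>?D\<^esub>"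
      unfolding c by (metis D.int_pow_one D.int_pow_pow UNIV_I additive_group_simps(1) int_pow_int)
    then show "d = ratmod_of (1 / of_nat m) [^]\<^bsub>?D\<^esub> k" using d by simp
  qed (use x in auto)
  ultimately show ?thesis
    using partial_hom_extends[OF G divisible_ratmod] by (metis (mono_tags, lifting) case_prodD)
qed

text \<open>Embeds an abelian group given by a carrier into a type of class \<open>ab_group_add\<close>, so that
  cochains with values in it can be added by means of \<open>sum\<close>.\<close>

definition double_dual :: "('a, 'b) monoid_scheme \<Rightarrow> 'a \<Rightarrow> ('a \<Rightarrow> ratmod) \<Rightarrow> ratmod" where
  "double_dual G x = (\<lambda>\<chi>. if \<chi> \<in> hom G (additive_group UNIV) then \<chi> x else 0)"

text \<open>The default 0 outside the homomorphisms makes this an equation of functions.\<close>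

lemma double_dual_mult:
  "x \<in> carrier G \<Longrightarrow> y \<in> carrier G \<Longrightarrow> double_dual G (x \<otimes>\<^bsub>G\<^esub> y) = double_dual G x + double_dual G y"
  by (auto simp: double_dual_def hom_mult plus_fun_def)

lemma double_dual_one:
  assumes "group G"
  shows "double_dual G \<one>\<^bsub>G\<^esub> = 0"
proof -
  interpret group G by fact
  have "double_dual G \<one>\<^bsub>G\<^esub> + double_dual G \<one>\<^bsub>G\<^esub> = double_dual G \<one>\<^bsub>G\<^esub>"
    using double_dual_mult[of "\<one>\<^bsub>G\<^esub>" G "\<one>\<^bsub>G\<^esub>"] by simp
  then show ?thesis using add_cancel_right_right by metis
qed

lemma double_dual_inv:
  assumes "group G" "x \<in> carrier G"
  shows "double_dual G (inv\<^bsub>G\<^esub> x) = - double_dual G x"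
proof -
  interpret group G by fact
  have "double_dual G (inv\<^bsub>G\<^esub> x) + double_dual G x = 0"
    using double_dual_mult[of "inv\<^bsub>G\<^esub> x" G x] assms by (simp add: double_dual_one)
  then show ?thesis by (simp only: eq_neg_iff_add_eq_0)
qed

text \<open>If x and y differ, then some character is nontrivial on their quotient.\<close>

lemma inj_on_double_dual:
  assumes "comm_group G"
  shows "inj_on (double_dual G) (carrier G)"
proof (rule inj_onI)
  interpret comm_group G by fact
  fix x y assume xy: "x \<in> carrier G" "y \<in> carrier G" "double_dual G x = double_dual G y"
  then have "double_dual G (x \<otimes>\<^bsub>G\<^esub> inv\<^bsub>G\<^esub> y) = 0"
    by (simp add: double_dual_mult double_dual_inv is_group)
  then have "\<chi> (x \<otimes>\<^bsub>G\<^esub> inv\<^bsub>G\<^esub> y) = 0" if "\<chi> \<in> hom G (additive_group UNIV)" for \<chi> :: "_ \<Rightarrow> ratmod"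
    using that by (simp add: double_dual_def fun_eq_iff split: if_splits)
  then have "x \<otimes>\<^bsub>G\<^esub> inv\<^bsub>G\<^esub> y = \<one>\<^bsub>G\<^esub>"
    using character_nontrivial[OF assms, of "x \<otimes>\<^bsub>G\<^esub> inv\<^bsub>G\<^esub> y"] xy by auto
  then show "x = y" using xy by (simp add: inv_solve_right')
qed

section \<open>Isomorphisms of quotients and double complexes\<close>

text \<open>A multiplicative relation, total on both sides and matching \<open>N\<close> with
  \<open>N'\<close>, is an isomorphism modulo these subgroups. It replaces a homomorphism where
  images depend on choices. That \<open>N\<close> is normal comes out at the end, as the kernel of
  \<open>h\<close>; that the quotient is a group is recorded because symmetry of
  \<open>\<cong>\<close> asks for it.\<close>

lemma quotient_iso_of_relation:
  assumes G: "group G" and H: "comm_group H" and N': "subgroup N' H"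
    and carr: "\<And>a b. R a b \<Longrightarrow> a \<in> carrier G \<and> b \<in> carrier H"
    and mult: "\<And>a b a' b'. R a b \<Longrightarrow> R a' b' \<Longrightarrow> R (a \<otimes>\<^bsub>G\<^esub> a') (b \<otimes>\<^bsub>H\<^esub> b')"
    and minv: "\<And>a b. R a b \<Longrightarrow> R (inv\<^bsub>G\<^esub> a) (inv\<^bsub>H\<^esub> b)"
    and left: "\<And>a. a \<in> carrier G \<Longrightarrow> \<exists>b. R a b"
    and right: "\<And>b. b \<in> carrier H \<Longrightarrow> \<exists>a. R a b"
    and N: "N \<subseteq> carrier G" "\<And>a b. R a b \<Longrightarrow> a \<in> N \<longleftrightarrow> b \<in> N'"
  shows "group (G Mod N)" and "G Mod N \<cong> H Mod N'"
proof -
  interpret G: group G by fact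
  interpret H: comm_group H by fact
  interpret N': normal N' H using N' by (rule H.subgroup_imp_normal)
  have "\<one>\<^bsub>G\<^esub> \<in> N"
  proof -
    obtain a where a: "R a \<one>\<^bsub>H\<^esub>" using right by blast
    then have "R (a \<otimes>\<^bsub>G\<^esub> inv\<^bsub>G\<^esub> a) (\<one>\<^bsub>H\<^esub> \<otimes>\<^bsub>H\<^esub> inv\<^bsub>H\<^esub> \<one>\<^bsub>H\<^esub>)" by (intro mult minv)
    then have "R \<one>\<^bsub>G\<^esub> \<one>\<^bsub>H\<^esub>" using carr[OF a] by simp
    then show ?thesis using N(2) N'.one_closed by blast
  qed
  define h where "h a = N' #>\<^bsub>H\<^esub> (SOME b. R a b)" for a
  have h: "h a = N' #>\<^bsub>H\<^esub> b" if ab: "R a b" for a b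
  proof -
    define c where "c = (SOME b. R a b)"
    have ac: "R a c" unfolding c_def using ab by (rule someI)
    \<comment> \<open>Two partners of the same \<open>a\<close> have a quotient that is related to
      the neutral element, so they lie in the same coset of \<open>N'\<close>.\<close>
    have "R (a \<otimes>\<^bsub>G\<^esub> inv\<^bsub>G\<^esub> a) (c \<otimes>\<^bsub>H\<^esub> inv\<^bsub>H\<^esub> b)" using ab ac by (intro mult minv)
    then have "c \<otimes>\<^bsub>H\<^esub> inv\<^bsub>H\<^esub> b \<in> N'" using carr[OF ab] N(2) \<open>\<one>\<^bsub>G\<^esub> \<in> N\<close> by simp
    then have "c \<in> N' #>\<^bsub>H\<^esub> b"
      using carr[OF ab] carr[OF ac] unfolding r_coset_def
      by (auto intro!: bexI[of _ "c \<otimes>\<^bsub>H\<^esub> inv\<^bsub>H\<^esub> b"] simp: H.m_assoc)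
    then show ?thesis
      using H.repr_independence[OF _ _ N'] carr[OF ab] by (simp add: h_def c_def)
  qed
  have hom: "h \<in> hom G (H Mod N')"
  proof (rule homI)
    fix a a' assume "a \<in> carrier G" "a' \<in> carrier G"
    then obtain b b' where b: "R a b" "R a' b'" using left by blast
    show "h a \<in> carrier (H Mod N')"
      using b carr by (auto simp: h[OF b(1)] FactGroup_def intro!: H.rcosetsI N'.subset)
    show "h (a \<otimes>\<^bsub>G\<^esub> a') = h a \<otimes>\<^bsub>H Mod N'\<^esub> h a'"
      using b carr by (simp add: h[OF b(1)] h[OF b(2)] h[OF mult[OF b]] N'.rcos_sum)
  qed
  interpret gh: group_hom G "H Mod N'" h
    using hom G N'.factorgroup_is_group by (simp add: group_hom_def group_hom_axioms_def)
  have ker: "kernel G (H Mod N') h = N"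
  proof -
    have "h a = N' \<longleftrightarrow> a \<in> N" if a: "a \<in> carrier G" for a
    proof -
      obtain b where b: "R a b" using left a by blast
      have "N' #>\<^bsub>H\<^esub> b = N' \<longleftrightarrow> b \<in> N'"
        using carr[OF b] H.rcos_self[of b N'] N' H.coset_join2[of b N'] by blast
      then show ?thesis using h[OF b] N(2)[OF b] by simp
    qed
    then show ?thesis using N(1) by (auto simp: kernel_def)
  qed
  have surj: "h ` carrier G = carrier (H Mod N')"
  proof
    show "h ` carrier G \<subseteq> carrier (H Mod N')" using hom by (auto simp: hom_def)
    show "carrier (H Mod N') \<subseteq> h ` carrier G"
    proof
      fix X assume "X \<in> carrier (H Mod N')"
      then obtain b where b: "b \<in> carrier H" "X = N' #>\<^bsub>H\<^esub> b" by (auto simp: FactGroup_def RCOSETS_def)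
      then obtain a where "R a b" using right by blast
      then show "X \<in> h ` carrier G" using h carr b(2) by blast
    qed
  qed
  show "group (G Mod N)" using normal.factorgroup_is_group[OF gh.normal_kernel] ker by simp
  show "G Mod N \<cong> H Mod N'" using gh.FactGroup_iso[OF surj] ker by simp
qed

text \<open>The row with index \<open>q\<close> is \<open>K 0 q \<rightarrow> K 1 q \<rightarrow> \<dots>\<close> and exact everywhere; the column with
  index \<open>p\<close> is exact for \<open>p > 0\<close>, except at \<open>K p 0\<close>, where its kernel is given by the complex \<open>B\<close>.\<close>

locale double_complex =
  fixes K :: "nat \<Rightarrow> nat \<Rightarrow> 'k::ab_group_add set"
    and \<delta> d :: "nat \<Rightarrow> nat \<Rightarrow> 'k \<Rightarrow> 'k"
    and B :: "nat \<Rightarrow> 'b::ab_group_add set"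
    and e :: "nat \<Rightarrow> 'b \<Rightarrow> 'b"
    and \<eta> :: "nat \<Rightarrow> 'b \<Rightarrow> 'k"
  assumes K_zero: "0 \<in> K p q"
    and K_add: "x \<in> K p q \<Longrightarrow> y \<in> K p q \<Longrightarrow> x + y \<in> K p q"
    and K_uminus: "x \<in> K p q \<Longrightarrow> - x \<in> K p q"
    and \<delta>_in: "x \<in> K p q \<Longrightarrow> \<delta> p q x \<in> K (Suc p) q"
    and \<delta>_add: "x \<in> K p q \<Longrightarrow> y \<in> K p q \<Longrightarrow> \<delta> p q (x + y) = \<delta> p q x + \<delta> p q y"
    and d_in: "x \<in> K p q \<Longrightarrow> d p q x \<in> K p (Suc q)"
    and d_add: "x \<in> K p q \<Longrightarrow> y \<in> K p q \<Longrightarrow> d p q (x + y) = d p q x + d p q y"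
    and \<delta>\<delta>: "x \<in> K p q \<Longrightarrow> \<delta> (Suc p) q (\<delta> p q x) = 0"
    and dd: "x \<in> K p q \<Longrightarrow> d p (Suc q) (d p q x) = 0"
    and comm: "x \<in> K p q \<Longrightarrow> \<delta> p (Suc q) (d p q x) = d (Suc p) q (\<delta> p q x)"
    and row_inj: "x \<in> K 0 q \<Longrightarrow> \<delta> 0 q x = 0 \<Longrightarrow> x = 0"
    and row_exact: "x \<in> K (Suc p) q \<Longrightarrow> \<delta> (Suc p) q x = 0 \<Longrightarrow> \<exists>y\<in>K p q. \<delta> p q y = x"
    and col_exact: "x \<in> K (Suc p) (Suc q) \<Longrightarrow> d (Suc p) (Suc q) x = 0 \<Longrightarrow> \<exists>y\<in>K (Suc p) q. d (Suc p) q y = x"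
    and B_add: "b \<in> B p \<Longrightarrow> c \<in> B p \<Longrightarrow> b + c \<in> B p"
    and B_uminus: "b \<in> B p \<Longrightarrow> - b \<in> B p"
    and e_in: "b \<in> B p \<Longrightarrow> e p b \<in> B (Suc p)"
    and \<eta>_in: "b \<in> B p \<Longrightarrow> \<eta> p b \<in> K (Suc p) 0"
    and \<eta>_add: "b \<in> B p \<Longrightarrow> c \<in> B p \<Longrightarrow> \<eta> p (b + c) = \<eta> p b + \<eta> p c"
    and \<eta>_inj: "b \<in> B p \<Longrightarrow> \<eta> p b = 0 \<Longrightarrow> b = 0"
    and \<eta>_comm: "b \<in> B p \<Longrightarrow> \<eta> (Suc p) (e p b) = \<delta> (Suc p) 0 (\<eta> p b)"
    and \<eta>_exact: "x \<in> K (Suc p) 0 \<Longrightarrow> d (Suc p) 0 x = 0 \<longleftrightarrow> x \<in> \<eta> p ` B p"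
begin

lemma K_diff: "x \<in> K p q \<Longrightarrow> y \<in> K p q \<Longrightarrow> x - y \<in> K p q"
  using K_add[of x p q "- y"] K_uminus by simp

lemma \<delta>_zero [simp]: "\<delta> p q 0 = 0"
  using \<delta>_add[OF K_zero K_zero, of p q] by simp

lemma d_zero [simp]: "d p q 0 = 0"
  using d_add[OF K_zero K_zero, of p q] by simp

lemma \<delta>_uminus: "x \<in> K p q \<Longrightarrow> \<delta> p q (- x) = - \<delta> p q x"
  using \<delta>_add[of x p q "- x"] K_uminus by (simp add: eq_neg_iff_add_eq_0 add.commute)

lemma d_uminus: "x \<in> K p q \<Longrightarrow> d p q (- x) = - d p q x"
  using d_add[of x p q "- x"] K_uminus by (simp add: eq_neg_iff_add_eq_0 add.commute)

lemma \<delta>_diff: "x \<in> K p q \<Longrightarrow> y \<in> K p q \<Longrightarrow> \<delta> p q (x - y) = \<delta> p q x - \<delta> p q y"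
  using \<delta>_add[of x p q "- y"] \<delta>_uminus[of y] K_uminus by simp

lemma d_diff: "x \<in> K p q \<Longrightarrow> y \<in> K p q \<Longrightarrow> d p q (x - y) = d p q x - d p q y"
  using d_add[of x p q "- y"] d_uminus[of y] K_uminus by simp

lemma B_zero: "b \<in> B p \<Longrightarrow> 0 \<in> B p"
  using B_add[of b p "- b"] B_uminus by simp

lemma \<eta>_uminus: "b \<in> B p \<Longrightarrow> \<eta> p (- b) = - \<eta> p b"
  using \<eta>_add[of b p "- b"] \<eta>_add[of 0 p 0] B_uminus B_zero
  by (simp add: eq_neg_iff_add_eq_0 add.commute)

lemma \<eta>_inj': "b \<in> B p \<Longrightarrow> c \<in> B p \<Longrightarrow> \<eta> p b = \<eta> p c \<Longrightarrow> b = c"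
  using \<eta>_inj[of "b + - c" p] \<eta>_add[of b p "- c"] \<eta>_uminus[of c p] B_uminus[of c p] B_add[of b p "- c"]
  by simp

section \<open>The staircase correspondence between the two edges\<close>

fun bd :: "nat \<Rightarrow> 'k set" where
  "bd 0 = {0}"
| "bd (Suc q) = d 0 q ` K 0 q"

fun bdB :: "nat \<Rightarrow> 'b set" where
  "bdB 0 = {0}"
| "bdB (Suc p) = e p ` B p"

text \<open>For \<open>q > 0\<close> these are the images of \<open>d\<close> in every column: by
  definition in column 0, which need not be exact, and by exactness in the others. At the bottom of
  a column with \<open>p > 0\<close> they are the image of \<open>\<eta>\<close>.\<close>

definition null :: "nat \<Rightarrow> nat \<Rightarrow> 'k set" where
  "null p q = (if p = 0 then bd q else {x \<in> K p q. d p q x = 0})"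

text \<open>A cocycle \<open>a\<close> in \<open>K 0 i\<close> is joined to \<open>w\<close> in \<open>K (Suc m) (i - m)\<close> by a staircase whose steps
  alternately invert \<open>d\<close> and apply \<open>\<delta>\<close>. Such a \<open>w\<close> is annihilated by both maps, and \<open>a\<close> is a
  coboundary if and only if \<open>w\<close> is in \<open>\<delta> ` null\<close>.\<close>

fun zigzag :: "nat \<Rightarrow> nat \<Rightarrow> 'k \<Rightarrow> 'k \<Rightarrow> bool" where
  "zigzag i 0 a w \<longleftrightarrow> a \<in> K 0 i \<and> d 0 i a = 0 \<and> w = \<delta> 0 i a"
| "zigzag i (Suc m) a w \<longleftrightarrow> (\<exists>x. zigzag i m a (d (Suc m) (i - Suc m) x) \<and>
     x \<in> K (Suc m) (i - Suc m) \<and> w = \<delta> (Suc m) (i - Suc m) x)"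

lemma bd_subset: "bd q \<subseteq> K 0 q"
  by (cases q) (use K_zero d_in in auto)

text \<open>Both equations survive a stair: for w = \<delta> x, the first holds since d \<delta> x =
  \<delta> d x and d x ends the shorter staircase, the second since \<delta> \<delta> = 0.\<close>

lemma zigzag_mem:
  "m \<le> i \<Longrightarrow> zigzag i m a w \<Longrightarrow>
     a \<in> K 0 i \<and> d 0 i a = 0 \<and> w \<in> K (Suc m) (i - m) \<and> d (Suc m) (i - m) w = 0 \<and> \<delta> (Suc m) (i - m) w = 0"
proof (induction m arbitrary: w)
  case 0
  then show ?case using \<delta>_in comm[of a 0 i] \<delta>\<delta>[of a 0 i] by auto
next
  case (Suc m)
  then obtain x where x: "zigzag i m a (d (Suc m) (i - Suc m) x)" "x \<in> K (Suc m) (i - Suc m)"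
    "w = \<delta> (Suc m) (i - Suc m) x" by auto
  have i: "i - m = Suc (i - Suc m)" using Suc.prems by simp
  have "d (Suc (Suc m)) (i - Suc m) w = \<delta> (Suc m) (i - m) (d (Suc m) (i - Suc m) x)"
    using comm[OF x(2)] x(3) i by simp
  then show ?case using Suc.IH[OF _ x(1)] Suc.prems \<delta>_in[OF x(2)] \<delta>\<delta>[OF x(2)] x(3) by simp
qed

lemma zigzag_add:
  "m \<le> i \<Longrightarrow> zigzag i m a w \<Longrightarrow> zigzag i m b v \<Longrightarrow> zigzag i m (a + b) (w + v)"
proof (induction m arbitrary: w v)
  case 0
  then show ?case using K_add d_add \<delta>_add by auto
next
  case (Suc m)
  then obtain x y where x: "zigzag i m a (d (Suc m) (i - Suc m) x)" "x \<in> K (Suc m) (i - Suc m)"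
    "w = \<delta> (Suc m) (i - Suc m) x"
    and y: "zigzag i m b (d (Suc m) (i - Suc m) y)" "y \<in> K (Suc m) (i - Suc m)"
    "v = \<delta> (Suc m) (i - Suc m) y" by auto
  have "zigzag i m (a + b) (d (Suc m) (i - Suc m) (x + y))"
    using Suc.IH[OF _ x(1) y(1)] Suc.prems d_add[OF x(2) y(2)] by simp
  then show ?case using K_add[OF x(2) y(2)] \<delta>_add[OF x(2) y(2)] x(3) y(3) by auto
qed

lemma zigzag_uminus:
  "m \<le> i \<Longrightarrow> zigzag i m a w \<Longrightarrow> zigzag i m (- a) (- w)"
proof (induction m arbitrary: w)
  case 0
  then show ?case using K_uminus d_uminus \<delta>_uminus by auto
next
  case (Suc m)
  then obtain x where x: "zigzag i m a (d (Suc m) (i - Suc m) x)" "x \<in> K (Suc m) (i - Suc m)"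
    "w = \<delta> (Suc m) (i - Suc m) x" by auto
  have "zigzag i m (- a) (d (Suc m) (i - Suc m) (- x))"
    using Suc.IH[OF _ x(1)] Suc.prems d_uminus[OF x(2)] by simp
  then show ?case using K_uminus[OF x(2)] \<delta>_uminus[OF x(2)] x(3) by auto
qed

text \<open>The end of a staircase is a cycle for \<open>d\<close> in a column of positive index, so
  exactness of that column supplies the next stair.\<close>

lemma zigzag_left:
  "m \<le> i \<Longrightarrow> a \<in> K 0 i \<Longrightarrow> d 0 i a = 0 \<Longrightarrow> \<exists>w. zigzag i m a w"
proof (induction m)
  case (Suc m)
  then obtain w where w: "zigzag i m a w" by auto
  have i: "i - m = Suc (i - Suc m)" using Suc.prems by simp
  have "w \<in> K (Suc m) (Suc (i - Suc m))" "d (Suc m) (Suc (i - Suc m)) w = 0"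
    using zigzag_mem[OF _ w] Suc.prems i by auto
  then obtain x where "x \<in> K (Suc m) (i - Suc m)" "d (Suc m) (i - Suc m) x = w"
    using col_exact by blast
  then show ?case using w by auto
qed auto

text \<open>The staircase is walked backwards along the exact rows. At its start, \<delta> d a = d
  \<delta> a = 0, and injectivity of \<delta> on column 0 gives d a = 0.\<close>

lemma zigzag_right:
  "m \<le> i \<Longrightarrow> w \<in> K (Suc m) (i - m) \<Longrightarrow> d (Suc m) (i - m) w = 0 \<Longrightarrow> \<delta> (Suc m) (i - m) w = 0 \<Longrightarrow>
     \<exists>a. zigzag i m a w"
proof (induction m arbitrary: w)
  case 0
  then obtain a where a: "a \<in> K 0 i" "\<delta> 0 i a = w" using row_exact[of w 0 i] by auto
  have "\<delta> 0 (Suc i) (d 0 i a) = 0" using comm[OF a(1)] a(2) 0 by simp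
  then have "d 0 i a = 0" using row_inj d_in[OF a(1)] by blast
  then show ?case using a by auto
next
  case (Suc m)
  have i: "i - m = Suc (i - Suc m)" using Suc.prems by simp
  obtain x where x: "x \<in> K (Suc m) (i - Suc m)" "\<delta> (Suc m) (i - Suc m) x = w"
    using row_exact[OF Suc.prems(2,4)] by blast
  have "\<exists>a. zigzag i m a (d (Suc m) (i - Suc m) x)"
  proof (rule Suc.IH)
    show "\<delta> (Suc m) (i - m) (d (Suc m) (i - Suc m) x) = 0"
      using comm[OF x(1)] x(2) Suc.prems i by simp
  qed (use Suc.prems i d_in[OF x(1)] dd[OF x(1)] in auto)
  then show ?case using x by auto
qed

text \<open>This makes the correspondence well defined on cohomology: the ambiguity of each stair is
  exactly what \<open>\<delta>\<close> maps from \<open>null\<close>. The induction transfers the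
  criterion from \<open>d x\<close> to \<open>\<delta> x\<close> by changing \<open>x\<close> by an
  element of the image of \<open>\<delta>\<close> in one direction and by a cycle of
  \<open>d\<close> in the other.\<close>

lemma zigzag_bd:
  "m \<le> i \<Longrightarrow> zigzag i m a w \<Longrightarrow> a \<in> bd i \<longleftrightarrow> w \<in> \<delta> m (i - m) ` null m (i - m)"
proof (induction m arbitrary: w)
  case 0
  have "a = b" if "\<delta> 0 i a = \<delta> 0 i b" "b \<in> bd i" for b
  proof -
    have b: "b \<in> K 0 i" using that(2) bd_subset by blast
    have "\<delta> 0 i (a - b) = 0" using \<delta>_diff[of a 0 i b] b 0 that(1) by simp
    then show "a = b" using row_inj[of "a - b" i] K_diff[of a 0 i b] b 0 by simp
  qed
  then show ?case using 0 by (auto simp: null_def)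
next
  case (Suc m)
  define q where "q = i - Suc m"
  have i: "i - m = Suc q" "i - Suc m = q" using Suc.prems by (auto simp: q_def)
  obtain x where x: "zigzag i m a (d (Suc m) q x)" "x \<in> K (Suc m) q"
    "w = \<delta> (Suc m) q x" using Suc.prems by (auto simp: q_def)
  have "a \<in> bd i \<longleftrightarrow> d (Suc m) q x \<in> \<delta> m (Suc q) ` null m (Suc q)"
    using Suc.IH[OF _ x(1)] Suc.prems i by simp
  also have "\<dots> \<longleftrightarrow> w \<in> \<delta> (Suc m) q ` null (Suc m) q"
  proof
    assume "d (Suc m) q x \<in> \<delta> m (Suc q) ` null m (Suc q)"
    then obtain z' where z': "d (Suc m) q x = \<delta> m (Suc q) z'" "z' \<in> null m (Suc q)" by blast
    \<comment> \<open>In column 0 this is the definition of \<open>null\<close>, in the other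
      columns exactness.\<close>
    have "\<exists>z\<in>K m q. z' = d m q z"
    proof (cases m)
      case 0
      then show ?thesis using z'(2) by (auto simp: null_def)
    next
      case (Suc m')
      then show ?thesis using z'(2) col_exact[of z' m' q] by (auto simp: null_def)
    qed
    then obtain z where z: "z \<in> K m q" "z' = d m q z" by blast
    \<comment> \<open>The correction by \<delta> z makes \<open>x\<close> a cycle for
      \<open>d\<close> without changing its image under \<delta>.\<close>
    have y: "x - \<delta> m q z \<in> K (Suc m) q" using K_diff[OF x(2) \<delta>_in[OF z(1)]] .
    have "d (Suc m) q (x - \<delta> m q z) = 0"
      using d_diff[OF x(2) \<delta>_in[OF z(1)]] comm[OF z(1)] z'(1) z(2) by simp
    moreover have "\<delta> (Suc m) q (x - \<delta> m q z) = w"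
      using \<delta>_diff[OF x(2) \<delta>_in[OF z(1)]] \<delta>\<delta>[OF z(1)] x(3) by simp
    ultimately show "w \<in> \<delta> (Suc m) q ` null (Suc m) q" using y by (force simp: null_def)
  next
    assume "w \<in> \<delta> (Suc m) q ` null (Suc m) q"
    then obtain y where y: "w = \<delta> (Suc m) q y" "y \<in> K (Suc m) q" "d (Suc m) q y = 0"
      by (auto simp: null_def)
    \<comment> \<open>Both \<open>x\<close> and \<open>y\<close> lie over \<open>w\<close>, so they
      differ by some \<delta> z; since \<open>y\<close> is a cycle for \<open>d\<close>, d x =
      \<delta> d z.\<close>
    have "\<delta> (Suc m) q (x - y) = 0" using \<delta>_diff[OF x(2) y(2)] y(1) x(3) by simp
    then obtain z where z: "z \<in> K m q" "\<delta> m q z = x - y" using row_exact K_diff[OF x(2) y(2)] by blast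
    have "d (Suc m) q x = d (Suc m) q (x - y)" using d_diff[OF x(2) y(2)] y(3) by simp
    also have "\<dots> = \<delta> m (Suc q) (d m q z)" using comm[OF z(1)] z(2) by simp
    finally have "d (Suc m) q x = \<delta> m (Suc q) (d m q z)" .
    moreover have "d m q z \<in> null m (Suc q)"
      using z(1) d_in[OF z(1)] dd[OF z(1)] by (auto simp: null_def)
    ultimately show "d (Suc m) q x \<in> \<delta> m (Suc q) ` null m (Suc q)" by blast
  qed
  finally show ?case by (simp only: i)
qed

text \<open>After \<open>i\<close> further stairs the staircase ends in row 0, at
  \<open>K (Suc i) 0\<close>, where cycles of \<open>d\<close> are images of \<open>B i\<close>. The
  shift by one arises because column 0 is the augmentation of the rows.\<close>

definition rel :: "nat \<Rightarrow> 'k \<Rightarrow> 'b \<Rightarrow> bool" where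
  "rel i a b \<longleftrightarrow> b \<in> B i \<and> zigzag i i a (\<eta> i b)"

lemma rel_mem: "rel i a b \<Longrightarrow> a \<in> K 0 i \<and> d 0 i a = 0 \<and> b \<in> B i \<and> e i b = 0"
proof -
  assume ab: "rel i a b"
  then have b: "b \<in> B i" and z: "zigzag i i a (\<eta> i b)" by (auto simp: rel_def)
  have "\<eta> (Suc i) (e i b) = 0" using \<eta>_comm[OF b] zigzag_mem[OF _ z] by simp
  then have "e i b = 0" using \<eta>_inj e_in[OF b] by blast
  then show ?thesis using zigzag_mem[OF _ z] b by simp
qed

lemma rel_add: "rel i a b \<Longrightarrow> rel i a' b' \<Longrightarrow> rel i (a + a') (b + b')"
  using zigzag_add[of i i a "\<eta> i b" a' "\<eta> i b'"] by (auto simp: rel_def B_add \<eta>_add)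

lemma rel_uminus: "rel i a b \<Longrightarrow> rel i (- a) (- b)"
  using zigzag_uminus[of i i a "\<eta> i b"] by (auto simp: rel_def B_uminus \<eta>_uminus)

lemma rel_left: "a \<in> K 0 i \<Longrightarrow> d 0 i a = 0 \<Longrightarrow> \<exists>b. rel i a b"
proof -
  assume "a \<in> K 0 i" "d 0 i a = 0"
  then obtain w where w: "zigzag i i a w" using zigzag_left[of i i a] by auto
  then have "w \<in> \<eta> i ` B i" using zigzag_mem[OF _ w] \<eta>_exact[of w i] by simp
  then show ?thesis using w by (auto simp: rel_def)
qed

lemma rel_right: "b \<in> B i \<Longrightarrow> e i b = 0 \<Longrightarrow> \<exists>a. rel i a b"
proof -
  assume b: "b \<in> B i" "e i b = 0"
  have "\<eta> (Suc i) 0 = 0" using \<eta>_add[of 0 "Suc i" 0] B_zero[OF e_in[OF b(1)]] by simp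
  then have "\<delta> (Suc i) 0 (\<eta> i b) = 0" using \<eta>_comm[OF b(1)] b(2) by simp
  moreover have "d (Suc i) 0 (\<eta> i b) = 0" using \<eta>_exact[OF \<eta>_in[OF b(1)]] b by blast
  ultimately show ?thesis using zigzag_right[of i i "\<eta> i b"] \<eta>_in[OF b(1)] b(1) by (auto simp: rel_def)
qed

text \<open>In row 0, \<open>null i 0\<close> is the image of the cochains of degree
  \<open>i - 1\<close> under \<open>\<eta>\<close>, and zero for \<open>i = 0\<close>; injectivity
  of \<open>\<eta>\<close> then turns the criterion of \<open>zigzag_bd\<close> into one about
  \<open>b\<close>.\<close>

lemma rel_bd: "rel i a b \<Longrightarrow> a \<in> bd i \<longleftrightarrow> b \<in> bdB i"
proof -
  assume ab: "rel i a b"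
  then have b: "b \<in> B i" and z: "zigzag i i a (\<eta> i b)" by (auto simp: rel_def)
  have "a \<in> bd i \<longleftrightarrow> \<eta> i b \<in> \<delta> i 0 ` null i 0" using zigzag_bd[OF _ z] by simp
  also have "\<dots> \<longleftrightarrow> b \<in> bdB i"
  proof (cases i)
    case 0
    have "\<eta> 0 0 = 0" using \<eta>_add[of 0 0 0] B_zero b 0 by simp
    then show ?thesis using 0 b \<eta>_inj by (auto simp: null_def)
  next
    case (Suc j)
    have "null i 0 = \<eta> j ` B j" using \<eta>_exact[of _ j] \<eta>_in[of _ j] by (auto simp: null_def Suc)
    then have "\<eta> i b \<in> \<delta> i 0 ` null i 0 \<longleftrightarrow> (\<exists>c\<in>B j. \<eta> i b = \<eta> i (e j c))"
      by (auto simp: Suc \<eta>_comm)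
    also have "\<dots> \<longleftrightarrow> b \<in> bdB i" using b \<eta>_inj'[of b i] e_in[of _ j] by (auto simp: Suc)
    finally show ?thesis .
  qed
  finally show ?thesis .
qed

end

section \<open>Cech complexes of flabby sheaves\<close>

text \<open>The sign of a face as an operation by negation, for coefficients in an arbitrary abelian
  group instead of a ring.\<close>

definition sgn_act :: "nat set \<Rightarrow> nat \<Rightarrow> 'g \<Rightarrow> 'g::ab_group_add" where
  "sgn_act J k a = (if even (card {l \<in> J. l < k}) then a else - a)"

lemma sgn_act_simps [simp]:
  "sgn_act J k 0 = 0" "sgn_act J k (a + b) = sgn_act J k a + sgn_act J k b"
  "sgn_act J k (- a) = - sgn_act J k a" "sgn_act J k (a - b) = sgn_act J k a - sgn_act J k b"
  by (auto simp: sgn_act_def)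

lemma sgn_act_sum: "sgn_act J k (sum f A) = (\<Sum>a\<in>A. sgn_act J k (f a))"
  by (auto simp: sgn_act_def sum_negf)

text \<open>A larger index does not shift the positions of the smaller ones. This is why the
  induction for \<open>cech_exact\<close> splits off the largest index.\<close>

lemma sgn_act_insert_greater: "k < j \<Longrightarrow> sgn_act (insert j J) k = sgn_act J k"
proof -
  assume "k < j"
  then have "{l \<in> insert j J. l < k} = {l \<in> J. l < k}" by auto
  then show ?thesis by (auto simp: sgn_act_def fun_eq_iff)
qed

text \<open>Removing the smaller index first moves the larger one down by one position; removing the
  larger one first moves nothing.\<close>

lemma sgn_act_antisym:
  assumes "finite J" "k \<in> J" "l \<in> J" "k < l"
  shows "sgn_act J k (sgn_act (J - {k}) l a) = - sgn_act J l (sgn_act (J - {l}) k a)"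
proof -
  have "{m \<in> J - {l}. m < k} = {m \<in> J. m < k}" using assms by auto
  moreover have "{m \<in> J. m < l} = insert k {m \<in> J - {k}. m < l}" using assms by auto
  then have "card {m \<in> J. m < l} = Suc (card {m \<in> J - {k}. m < l})" using assms(1) by simp
  ultimately show ?thesis by (simp add: sgn_act_def)
qed

text \<open>The pairs (k, l) and (l, k) cancel. The diagonal is excluded, so 2-torsion in the
  coefficients does no harm.\<close>

lemma sum_antisym_eq_0:
  fixes g :: "'i::linorder \<Rightarrow> 'i \<Rightarrow> 'g::ab_group_add"
  assumes "finite J" "\<And>k l. k \<in> J \<Longrightarrow> l \<in> J \<Longrightarrow> k < l \<Longrightarrow> g k l = - g l k"
  shows "(\<Sum>k\<in>J. \<Sum>l\<in>J - {k}. g k l) = 0"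
  using assms
proof (induction J rule: finite_induct)
  case (insert b A)
  have anti: "g k b + g b k = 0" if "k \<in> A" for k
    using insert.prems[of k b] insert.prems[of b k] insert.hyps that by (cases k b rule: linorder_cases) (auto simp: eq_neg_iff_add_eq_0 add.commute)
  have "(\<Sum>l\<in>insert b A - {k}. g k l) = (\<Sum>l\<in>A - {k}. g k l) + g k b" if "k \<in> A" for k
  proof -
    have "insert b A - {k} = insert b (A - {k})" using insert.hyps that by auto
    then show ?thesis using insert.hyps by (simp add: add.commute)
  qed
  then have "(\<Sum>k\<in>insert b A. \<Sum>l\<in>insert b A - {k}. g k l) =
      (\<Sum>l\<in>A. g b l) + (\<Sum>k\<in>A. (\<Sum>l\<in>A - {k}. g k l) + g k b)"
    using insert.hyps by simp
  also have "\<dots> = (\<Sum>k\<in>A. \<Sum>l\<in>A - {k}. g k l) + (\<Sum>k\<in>A. g k b + g b k)"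
    by (simp add: sum.distrib add_ac)
  also have "\<dots> = 0" using insert.IH insert.prems anti by simp
  finally show ?case .
qed simp

text \<open>\<open>glue_extend\<close> merges gluing with flabbiness: compatible sections glue on
  the union of the sets \<open>U k\<close> and extend from there to \<open>Z\<close>. This is the
  form in which exactness at the beginning of the Cech complex uses them.\<close>

locale flabby_sheaf =
  fixes op :: "'p set \<Rightarrow> bool"
    and S :: "'p set \<Rightarrow> 'g::ab_group_add set"
    and r :: "'p set \<Rightarrow> 'p set \<Rightarrow> 'g \<Rightarrow> 'g"
  assumes op_Int: "op V \<Longrightarrow> op W \<Longrightarrow> op (V \<inter> W)"
    and S_zero: "op V \<Longrightarrow> 0 \<in> S V"
    and S_add: "op V \<Longrightarrow> s \<in> S V \<Longrightarrow> t \<in> S V \<Longrightarrow> s + t \<in> S V"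
    and S_uminus: "op V \<Longrightarrow> s \<in> S V \<Longrightarrow> - s \<in> S V"
    and r_in: "op V \<Longrightarrow> op W \<Longrightarrow> W \<subseteq> V \<Longrightarrow> s \<in> S V \<Longrightarrow> r V W s \<in> S W"
    and r_add: "op V \<Longrightarrow> op W \<Longrightarrow> W \<subseteq> V \<Longrightarrow> s \<in> S V \<Longrightarrow> t \<in> S V \<Longrightarrow> r V W (s + t) = r V W s + r V W t"
    and r_comp: "op V \<Longrightarrow> op W \<Longrightarrow> op W' \<Longrightarrow> W' \<subseteq> W \<Longrightarrow> W \<subseteq> V \<Longrightarrow> s \<in> S V \<Longrightarrow> r W W' (r V W s) = r V W' s"
    and glue_extend: "finite A \<Longrightarrow> op Z \<Longrightarrow>
      (\<And>k. k \<in> A \<Longrightarrow> op (U k) \<and> U k \<subseteq> Z \<and> f k \<in> S (U k)) \<Longrightarrow>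
      (\<And>k l. k \<in> A \<Longrightarrow> l \<in> A \<Longrightarrow> r (U k) (U k \<inter> U l) (f k) = r (U l) (U k \<inter> U l) (f l)) \<Longrightarrow>
      \<exists>t\<in>S Z. \<forall>k\<in>(A::nat set). r Z (U k) t = f k"
begin

lemma r_zero: "op V \<Longrightarrow> op W \<Longrightarrow> W \<subseteq> V \<Longrightarrow> r V W 0 = 0"
  using r_add[of V W 0 0] S_zero[of V] by simp

lemma r_uminus: "op V \<Longrightarrow> op W \<Longrightarrow> W \<subseteq> V \<Longrightarrow> s \<in> S V \<Longrightarrow> r V W (- s) = - r V W s"
  using r_add[of V W s "- s"] S_uminus[of V s] r_zero by (simp add: eq_neg_iff_add_eq_0 add.commute)

lemma S_sgn: "op V \<Longrightarrow> s \<in> S V \<Longrightarrow> sgn_act J k s \<in> S V"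
  using S_uminus by (simp add: sgn_act_def)

lemma r_sgn: "op V \<Longrightarrow> op W \<Longrightarrow> W \<subseteq> V \<Longrightarrow> s \<in> S V \<Longrightarrow> r V W (sgn_act J k s) = sgn_act J k (r V W s)"
  using r_uminus by (simp add: sgn_act_def)

lemma S_sum: "op V \<Longrightarrow> finite A \<Longrightarrow> (\<And>a. a \<in> A \<Longrightarrow> f a \<in> S V) \<Longrightarrow> sum f A \<in> S V"
  by (rotate_tac 1, induction A rule: finite_induct) (simp_all add: S_zero S_add)

lemma r_sum:
  assumes "op V" "op W" "W \<subseteq> V" "finite A" "\<And>a. a \<in> A \<Longrightarrow> f a \<in> S V"
  shows "r V W (sum f A) = (\<Sum>a\<in>A. r V W (f a))"
  using assms(4,5)
proof (induction A rule: finite_induct)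
  case (insert b A)
  then have "sum f A \<in> S V" using S_sum[OF assms(1), of A f] by simp
  then show ?case using insert r_add[OF assms(1,2,3)] by simp
qed (simp add: r_zero assms)

end

text \<open>For \<open>J = {}\<close> this is \<open>Z\<close>: cochains are indexed below by the cardinality of \<open>J\<close>, that is,
  with degrees shifted by one, and the Cech complex is augmented by the sections on \<open>Z\<close>.\<close>

definition cover_Int :: "(nat \<Rightarrow> 'p set) \<Rightarrow> 'p set \<Rightarrow> nat set \<Rightarrow> 'p set" where
  "cover_Int V Z J = Z \<inter> (\<Inter>k\<in>J. V k)"

locale flabby_cover = flabby_sheaf op S r
  for op :: "'p set \<Rightarrow> bool" and S :: "'p set \<Rightarrow> 'g::ab_group_add set" and r +
  fixes V :: "nat \<Rightarrow> 'p set" and I :: "nat set"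
  assumes finite_I: "finite I" and op_V: "k \<in> I \<Longrightarrow> op (V k)"
begin

abbreviation "VJ \<equiv> cover_Int V"

lemma op_VJ:
  assumes "op Z" "J \<subseteq> I"
  shows "op (VJ Z J)"
proof -
  have "finite J" using assms(2) finite_I finite_subset by blast
  then show ?thesis using assms(2)
  proof (induction J rule: finite_induct)
    case (insert k J)
    then have "op (VJ Z J \<inter> V k)" using op_V by (intro op_Int) auto
    moreover have "VJ Z J \<inter> V k = VJ Z (insert k J)" by (auto simp: cover_Int_def)
    ultimately show ?case by simp
  qed (simp add: cover_Int_def assms(1))
qed

lemma VJ_mono: "J \<subseteq> J' \<Longrightarrow> VJ Z J' \<subseteq> VJ Z J"
  by (auto simp: cover_Int_def)

text \<open>The value 0 off the index sets concerned makes the cochains a subgroup of a function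
  type under pointwise addition. The index set \<open>A\<close> is a parameter since the exactness
  proof runs by induction on it.\<close>

definition cochains :: "nat set \<Rightarrow> 'p set \<Rightarrow> nat \<Rightarrow> (nat set \<Rightarrow> 'g) set" where
  "cochains A Z p = {x. \<forall>J. (J \<subseteq> A \<and> card J = p \<longrightarrow> x J \<in> S (VJ Z J)) \<and> (\<not> (J \<subseteq> A \<and> card J = p) \<longrightarrow> x J = 0)}"

definition cobd :: "nat set \<Rightarrow> 'p set \<Rightarrow> nat \<Rightarrow> (nat set \<Rightarrow> 'g) \<Rightarrow> nat set \<Rightarrow> 'g" where
  "cobd A Z p x = (\<lambda>J. if J \<subseteq> A \<and> card J = Suc p
     then \<Sum>k\<in>J. sgn_act J k (r (VJ Z (J - {k})) (VJ Z J) (x (J - {k}))) else 0)"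

lemma cochains_in: "x \<in> cochains A Z p \<Longrightarrow> J \<subseteq> A \<Longrightarrow> card J = p \<Longrightarrow> x J \<in> S (VJ Z J)"
  by (simp add: cochains_def)

lemma cochains_out: "x \<in> cochains A Z p \<Longrightarrow> \<not> (J \<subseteq> A \<and> card J = p) \<Longrightarrow> x J = 0"
  by (simp add: cochains_def)

lemma cochains_zero: "op Z \<Longrightarrow> A \<subseteq> I \<Longrightarrow> 0 \<in> cochains A Z p"
  by (auto simp: cochains_def intro!: S_zero op_VJ)

lemma cochains_add: "op Z \<Longrightarrow> A \<subseteq> I \<Longrightarrow> x \<in> cochains A Z p \<Longrightarrow> y \<in> cochains A Z p \<Longrightarrow> x + y \<in> cochains A Z p"
  by (auto simp: cochains_def intro!: S_add op_VJ)

lemma cochains_uminus: "op Z \<Longrightarrow> A \<subseteq> I \<Longrightarrow> x \<in> cochains A Z p \<Longrightarrow> - x \<in> cochains A Z p"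
  by (auto simp: cochains_def intro!: S_uminus op_VJ)

lemma cochains_diff: "op Z \<Longrightarrow> A \<subseteq> I \<Longrightarrow> x \<in> cochains A Z p \<Longrightarrow> y \<in> cochains A Z p \<Longrightarrow> x - y \<in> cochains A Z p"
  using cochains_add[of Z A x p "- y"] cochains_uminus[of Z A y p] by simp

lemma cobd_term:
  assumes "op Z" "A \<subseteq> I" "x \<in> cochains A Z p" "J \<subseteq> A" "card J = Suc p" "k \<in> J"
  shows "x (J - {k}) \<in> S (VJ Z (J - {k}))"
    and "r (VJ Z (J - {k})) (VJ Z J) (x (J - {k})) \<in> S (VJ Z J)"
proof -
  have "finite J" using assms(5) card.infinite by fastforce
  then have "card (J - {k}) = p" using assms(5,6) by simp
  then show *: "x (J - {k}) \<in> S (VJ Z (J - {k}))" using assms by (intro cochains_in[of x A Z p]) auto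
  have "op (VJ Z (J - {k}))" "op (VJ Z J)" "VJ Z J \<subseteq> VJ Z (J - {k})"
    using assms by (auto intro!: op_VJ VJ_mono)
  then show "r (VJ Z (J - {k})) (VJ Z J) (x (J - {k})) \<in> S (VJ Z J)" using r_in * by blast
qed

lemma cobd_in:
  assumes "op Z" "A \<subseteq> I" "x \<in> cochains A Z p"
  shows "cobd A Z p x \<in> cochains A Z (Suc p)"
  unfolding cochains_def mem_Collect_eq
proof (intro allI conjI impI)
  fix J assume J: "J \<subseteq> A \<and> card J = Suc p"
  then have "finite J" using card.infinite by fastforce
  then show "cobd A Z p x J \<in> S (VJ Z J)"
    using J cobd_term(2)[OF assms] op_VJ[OF assms(1), of J] assms(2)
    by (auto simp: cobd_def intro!: S_sum S_sgn)
qed (auto simp: cobd_def)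

lemma cobd_add:
  assumes "op Z" "A \<subseteq> I" "x \<in> cochains A Z p" "y \<in> cochains A Z p"
  shows "cobd A Z p (x + y) = cobd A Z p x + cobd A Z p y"
proof
  fix J
  show "cobd A Z p (x + y) J = (cobd A Z p x + cobd A Z p y) J"
  proof (cases "J \<subseteq> A \<and> card J = Suc p")
    case True
    have "r (VJ Z (J - {k})) (VJ Z J) ((x + y) (J - {k})) =
        r (VJ Z (J - {k})) (VJ Z J) (x (J - {k})) + r (VJ Z (J - {k})) (VJ Z J) (y (J - {k}))" if "k \<in> J" for k
      using cobd_term(1)[OF assms(1,2,3)] cobd_term(1)[OF assms(1,2,4)] that True assms(1,2)
      by (auto intro!: r_add op_VJ VJ_mono)
    then show ?thesis using True by (simp add: cobd_def sum.distrib)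
  qed (auto simp: cobd_def)
qed

lemma cobd_uminus:
  assumes "op Z" "A \<subseteq> I" "x \<in> cochains A Z p"
  shows "cobd A Z p (- x) = - cobd A Z p x"
proof -
  have "cobd A Z p (0 + 0) = cobd A Z p 0 + cobd A Z p 0"
    using assms cochains_zero by (intro cobd_add) auto
  then have "cobd A Z p 0 = 0" by simp
  then have "cobd A Z p x + cobd A Z p (- x) = 0"
    using cobd_add[OF assms cochains_uminus[OF assms]] by simp
  then show ?thesis by (simp add: eq_neg_iff_add_eq_0 add.commute)
qed

lemma cobd_diff:
  assumes "op Z" "A \<subseteq> I" "x \<in> cochains A Z p" "y \<in> cochains A Z p"
  shows "cobd A Z p (x - y) = cobd A Z p x - cobd A Z p y"
  using cobd_add[OF assms(1,2,3) cochains_uminus[OF assms(1,2,4)]] cobd_uminus[OF assms(1,2,4)] by simp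

text \<open>Each term is obtained by omitting two indices in some order, and the two orders carry
  opposite signs.\<close>

lemma cobd_cobd:
  assumes Z: "op Z" and A: "A \<subseteq> I" and x: "x \<in> cochains A Z p"
  shows "cobd A Z (Suc p) (cobd A Z p x) = 0"
proof
  fix J
  show "cobd A Z (Suc p) (cobd A Z p x) J = 0 J"
  proof (cases "J \<subseteq> A \<and> card J = Suc (Suc p)")
    case J: True
    then have fin: "finite J" using card.infinite by fastforce
    \<comment> \<open>The term in which \<open>k\<close> is omitted first and \<open>l\<close> next,
      with the two successive restrictions merged into one.\<close>
    define g where "g k l = sgn_act J k (sgn_act (J - {k}) l (r (VJ Z (J - {k} - {l})) (VJ Z J) (x (J - {k} - {l}))))" for k l
    have "r (VJ Z (J - {k})) (VJ Z J) (cobd A Z p x (J - {k})) =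
        (\<Sum>l\<in>J - {k}. sgn_act (J - {k}) l (r (VJ Z (J - {k} - {l})) (VJ Z J) (x (J - {k} - {l}))))"
      if k: "k \<in> J" for k
    proof -
      have Jk: "J - {k} \<subseteq> A" "card (J - {k}) = Suc p" using J k fin by auto
      have op: "op (VJ Z (J - {k}))" "op (VJ Z J)" "VJ Z J \<subseteq> VJ Z (J - {k})"
        using J A Z by (auto intro!: op_VJ VJ_mono)
      have op': "op (VJ Z (J - {k} - {l}))" "VJ Z (J - {k}) \<subseteq> VJ Z (J - {k} - {l})" for l
        using J A Z by (auto intro!: op_VJ VJ_mono)
      note t = cobd_term[OF Z A x Jk]
      have "r (VJ Z (J - {k})) (VJ Z J) (cobd A Z p x (J - {k})) =
        (\<Sum>l\<in>J - {k}. r (VJ Z (J - {k})) (VJ Z J)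
          (sgn_act (J - {k}) l (r (VJ Z (J - {k} - {l})) (VJ Z (J - {k})) (x (J - {k} - {l})))))"
        using Jk t(2) fin op unfolding cobd_def by (simp only: if_True simp_thms) (intro r_sum; auto intro!: S_sgn)
      also have "\<dots> = (\<Sum>l\<in>J - {k}. sgn_act (J - {k}) l (r (VJ Z (J - {k} - {l})) (VJ Z J) (x (J - {k} - {l}))))"
      proof (rule sum.cong)
        fix l assume l: "l \<in> J - {k}"
        show "r (VJ Z (J - {k})) (VJ Z J) (sgn_act (J - {k}) l (r (VJ Z (J - {k} - {l})) (VJ Z (J - {k})) (x (J - {k} - {l})))) =
            sgn_act (J - {k}) l (r (VJ Z (J - {k} - {l})) (VJ Z J) (x (J - {k} - {l})))"
          unfolding r_sgn[OF op t(2)[OF l]] r_comp[OF op'(1) op(1,2,3) op'(2) t(1)[OF l]] ..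
      qed simp
      finally show ?thesis .
    qed
    then have "cobd A Z (Suc p) (cobd A Z p x) J = (\<Sum>k\<in>J. \<Sum>l\<in>J - {k}. g k l)"
      using J by (simp add: cobd_def[of A Z "Suc p"] sgn_act_sum g_def)
    also have "\<dots> = 0"
    proof (rule sum_antisym_eq_0[OF fin])
      fix k l assume kl: "k \<in> J" "l \<in> J" "k < l"
      have "J - {k} - {l} = J - {l} - {k}" by auto
      then show "g k l = - g l k" unfolding g_def using sgn_act_antisym[OF fin kl] by simp
    qed
    finally show ?thesis by simp
  qed (auto simp: cobd_def)
qed

text \<open>A cocycle here is a family of sections that agree on overlaps, and a preimage is a
  common extension to \<open>Z\<close>: this is \<open>glue_extend\<close>.\<close>

lemma exact_first:
  assumes Z: "op Z" and A: "A \<subseteq> I" and x: "x \<in> cochains A Z 1" and cocyc: "cobd A Z 1 x = 0"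
  shows "\<exists>y\<in>cochains A Z 0. cobd A Z 0 y = x"
proof -
  have fin: "finite A" using A finite_I finite_subset by blast
  have op: "op (VJ Z {k})" "VJ Z {k} \<subseteq> Z" "x {k} \<in> S (VJ Z {k})" if "k \<in> A" for k
    using that A op_VJ[OF Z, of "{k}"] cochains_in[OF x, of "{k}"] by (auto simp: cover_Int_def)
  have agree: "r (VJ Z {k}) (VJ Z {k} \<inter> VJ Z {l}) (x {k}) = r (VJ Z {l}) (VJ Z {k} \<inter> VJ Z {l}) (x {l})"
    if kl: "k \<in> A" "l \<in> A" "k < l" for k l
  proof -
    have V: "VJ Z {k} \<inter> VJ Z {l} = VJ Z {k, l}" by (auto simp: cover_Int_def)
    \<comment> \<open>For k < l, omitting \<open>k\<close> has sign + and omitting \<open>l\<close>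
      has sign -, so the cocycle condition is an equality of restrictions.\<close>
    have c: "{m. (m = k \<or> m = l) \<and> m < k} = {}" "{m. (m = k \<or> m = l) \<and> m < l} = {k}" using kl by auto
    have d: "{k, l} - {k} = {l}" "{k, l} - {l} = {k}" using kl by auto
    have "cobd A Z 1 x {k, l} = 0" using cocyc by simp
    then show ?thesis using kl by (simp add: cobd_def sgn_act_def c d V)
  qed
  have "\<exists>t\<in>S Z. \<forall>k\<in>A. r Z (VJ Z {k}) t = x {k}"
  proof (rule glue_extend[OF fin Z])
    fix k l assume kl: "k \<in> A" "l \<in> A"
    show "r (VJ Z {k}) (VJ Z {k} \<inter> VJ Z {l}) (x {k}) = r (VJ Z {l}) (VJ Z {k} \<inter> VJ Z {l}) (x {l})"
      using agree[of k l] agree[of l k] kl by (cases k l rule: linorder_cases) (auto simp: Int_commute)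
  qed (use op in auto)
  then obtain t where t: "t \<in> S Z" "\<And>k. k \<in> A \<Longrightarrow> r Z (VJ Z {k}) t = x {k}" by blast
  define y where "y J = (if J = {} then t else 0)" for J :: "nat set"
  have V0: "VJ Z {} = Z" by (simp add: cover_Int_def)
  have "y \<in> cochains A Z 0"
    using t(1) fin finite_subset by (fastforce simp: cochains_def y_def V0)
  moreover have "cobd A Z 0 y J = x J" for J
  proof (cases "J \<subseteq> A \<and> card J = 1")
    case True
    then obtain k where "J = {k}" by (auto simp: card_1_singleton_iff)
    moreover have "{l. l = k' \<and> l < k'} = {}" for k' :: nat by auto
    ultimately show ?thesis using t(2) True by (simp add: cobd_def y_def V0 sgn_act_def del: Collect_empty_eq)
  next
    case False
    then show ?thesis using cochains_out[OF x False] by (auto simp: cobd_def)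
  qed
  ultimately show ?thesis by blast
qed

text \<open>On index sets containing the largest index \<open>j\<close>, the only face without
  \<open>j\<close> is \<open>J\<close> itself, where \<open>f\<close> vanishes. What remains is the
  coboundary of the cochain with \<open>j\<close> deleted, over the smaller set
  \<open>Z \<inter> V j\<close> and with unchanged signs.\<close>

lemma cobd_insert:
  assumes Z: "op Z" and B: "insert j A \<subseteq> I" and j: "\<And>a. a \<in> A \<Longrightarrow> a < j"
    and J: "J \<subseteq> A" "card J = Suc q" and f: "f J = 0"
  shows "cobd (insert j A) Z (Suc q) f (insert j J) =
    cobd A (Z \<inter> V j) q (\<lambda>J. if J \<subseteq> A then f (insert j J) else 0) J"
proof -
  have fin: "finite J" using J card.infinite by fastforce
  have jJ: "j \<notin> J" using j J by blast
  have V: "VJ (Z \<inter> V j) J' = VJ Z (insert j J')" for J' by (auto simp: cover_Int_def)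
  have "insert j J - {j} = J" using jJ by auto
  moreover have "r (VJ Z J) (VJ Z (insert j J)) 0 = 0"
    using J B Z by (intro r_zero op_VJ VJ_mono) auto
  ultimately have "cobd (insert j A) Z (Suc q) f (insert j J) = (\<Sum>k\<in>J. sgn_act (insert j J) k
      (r (VJ Z (insert j J - {k})) (VJ Z (insert j J)) (f (insert j J - {k}))))"
    using J jJ fin f by (auto simp: cobd_def)
  also have "\<dots> = cobd A (Z \<inter> V j) q (\<lambda>J. if J \<subseteq> A then f (insert j J) else 0) J"
  proof -
    have "sgn_act (insert j J) k (r (VJ Z (insert j J - {k})) (VJ Z (insert j J)) (f (insert j J - {k}))) =
       sgn_act J k (r (VJ (Z \<inter> V j) (J - {k})) (VJ (Z \<inter> V j) J) (if J - {k} \<subseteq> A then f (insert j (J - {k})) else 0))"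
      if "k \<in> J" for k
    proof -
      have "insert j J - {k} = insert j (J - {k})" using that jJ by auto
      then show ?thesis using that J j by (auto simp: V sgn_act_insert_greater subset_iff)
    qed
    then show ?thesis using J by (simp add: cobd_def)
  qed
  finally show ?thesis .
qed

text \<open>The Cech complex of \<open>insert j A\<close> on \<open>Z\<close> is an extension of the
  one of \<open>A\<close> on \<open>Z\<close> by the one of \<open>A\<close> on
  \<open>Z \<inter> V j\<close>, shifted by one degree. A cocycle is first corrected to vanish on
  index sets without \<open>j\<close>; the rest is a cocycle on \<open>Z \<inter> V j\<close>. Hence
  the statement is for all \<open>Z\<close> at once.\<close>

theorem cech_exact:
  assumes "A \<subseteq> I" "op Z" "x \<in> cochains A Z (Suc p)" "cobd A Z (Suc p) x = 0"
  shows "\<exists>y\<in>cochains A Z p. cobd A Z p y = x"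
proof -
  have "finite A" using assms(1) finite_I finite_subset by blast
  then show ?thesis using assms
  proof (induction A arbitrary: Z x p rule: finite_linorder_max_induct)
    case empty
    then have "x = 0" by (auto simp: cochains_def fun_eq_iff)
    moreover have "cobd {} Z p 0 = 0" by (auto simp: cobd_def)
    ultimately show ?case using cochains_zero[OF empty(2)] by blast
  next
    case (insert j A)
    let ?B = "insert j A"
    have B: "?B \<subseteq> I" and A: "A \<subseteq> I" and j: "j \<notin> A" and Z: "op Z" and x: "x \<in> cochains ?B Z (Suc p)"
      using insert.prems insert.hyps by auto
    have Zj: "op (Z \<inter> V j)" using B Z op_V by (intro op_Int) auto
    show ?case
    proof (cases p)
      case 0
      \<comment> \<open>Deleting \<open>j\<close> would lead to degree 0, while the induction
        hypothesis speaks of positive degrees; here the sections are glued directly.\<close>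
      then show ?thesis using exact_first[OF Z B] insert.prems(3,4) unfolding 0 One_nat_def by blast
    next
      case (Suc p')
      \<comment> \<open>The part of the cocycle that does not involve \<open>j\<close>.\<close>
      define x' where "x' J = (if J \<subseteq> A then x J else 0)" for J
      have x': "x' \<in> cochains A Z (Suc p)" using x by (auto simp: cochains_def x'_def)
      have "cobd A Z (Suc p) x' = 0"
      proof
        fix J
        show "cobd A Z (Suc p) x' J = 0 J"
        proof (cases "J \<subseteq> A \<and> card J = Suc (Suc p)")
          case True
          have "x' (J - {k}) = x (J - {k})" for k using True by (auto simp: x'_def)
          then have "cobd A Z (Suc p) x' J = cobd ?B Z (Suc p) x J"
            using True by (auto simp: cobd_def)
          then show ?thesis using insert.prems(4) by simp
        qed (auto simp: cobd_def)
      qed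
      then obtain y' where y': "y' \<in> cochains A Z p" "cobd A Z p y' = x'"
        using insert.IH[OF A Z x'] by blast
      have "y' J \<in> S (VJ Z J)" if "J \<subseteq> ?B" for J
        using cochains_in[OF y'(1), of J] cochains_out[OF y'(1), of J] S_zero[OF op_VJ[OF Z, of J]] that B
        by (cases "J \<subseteq> A \<and> card J = p") auto
      then have y'B: "y' \<in> cochains ?B Z p"
        using cochains_out[OF y'(1)] by (auto simp: cochains_def)
      \<comment> \<open>The difference is supported on index sets that contain
        \<open>j\<close>.\<close>
      define x2 where "x2 = x - cobd ?B Z p y'"
      have x2: "x2 \<in> cochains ?B Z (Suc p)"
        unfolding x2_def by (intro cochains_diff cobd_in y'B Z B x)
      have "cobd ?B Z (Suc p) x2 = 0"
        unfolding x2_def cobd_diff[OF Z B x cobd_in[OF Z B y'B]]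
        using insert.prems(4) cobd_cobd[OF Z B y'B] by (simp add: fun_eq_iff)
      have x2A: "x2 J = 0" if "J \<subseteq> A" for J
      proof (cases "card J = Suc p")
        case True
        then have "cobd ?B Z p y' J = cobd A Z p y' J" using that by (auto simp: cobd_def)
        then show ?thesis using that y'(2) by (simp add: x2_def x'_def)
      qed (use cochains_out[OF x2] in auto)
      \<comment> \<open>Deletion of \<open>j\<close>, which lowers the degree by one and replaces
        \<open>Z\<close> by \<open>Z \<inter> V j\<close>.\<close>
      define u where "u J = (if J \<subseteq> A then x2 (insert j J) else 0)" for J
      have VJj: "VJ (Z \<inter> V j) J = VJ Z (insert j J)" for J by (auto simp: cover_Int_def)
      have card_insert: "card (insert j J) = Suc (card J)" if "J \<subseteq> A" for J
        using that j \<open>finite A\<close> finite_subset by (metis card_insert_disjoint subsetD)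
      have u: "u \<in> cochains A (Z \<inter> V j) (Suc p')"
        using x2 card_insert by (auto simp: cochains_def u_def VJj Suc subset_insertI2)
      have "cobd A (Z \<inter> V j) (Suc p') u = 0"
      proof
        fix J
        show "cobd A (Z \<inter> V j) (Suc p') u J = 0 J"
        proof (cases "J \<subseteq> A \<and> card J = Suc (Suc p')")
          case True
          then show ?thesis
            using cobd_insert[OF Z B insert.hyps(2)[rule_format], of J "Suc p'" x2] x2A[of J]
              \<open>cobd ?B Z (Suc p) x2 = 0\<close> Suc by (simp add: u_def[abs_def])
        qed (auto simp: cobd_def)
      qed
      then obtain w where w: "w \<in> cochains A (Z \<inter> V j) p'" "cobd A (Z \<inter> V j) p' w = u"
        using insert.IH[OF A Zj u] by blast
      \<comment> \<open>Reinsertion of \<open>j\<close> into the solution found over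
        \<open>Z \<inter> V j\<close>; index sets without \<open>j\<close> get 0, so
        \<open>cobd_insert\<close> applies.\<close>
      define y2 where "y2 J = (if J \<subseteq> ?B \<and> j \<in> J then w (J - {j}) else 0)" for J
      have y2_insert: "y2 (insert j J) = w J" if "J \<subseteq> A" for J
      proof -
        have "insert j J - {j} = J" using that j by auto
        then show ?thesis using that by (auto simp: y2_def)
      qed
      have y2: "y2 \<in> cochains ?B Z p"
        unfolding cochains_def mem_Collect_eq
      proof (intro allI conjI impI)
        fix J assume J: "J \<subseteq> ?B \<and> card J = p"
        show "y2 J \<in> S (VJ Z J)"
        proof (cases "j \<in> J")
          case True
          then obtain J0 where J0: "J = insert j J0" "j \<notin> J0" by (metis mk_disjoint_insert)
          then have "J0 \<subseteq> A" "card J0 = p'" using J card_insert[of J0] Suc by auto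
          then show ?thesis using y2_insert cochains_in[OF w(1)] by (simp add: J0(1) VJj)
        next
          case False
          then show ?thesis using J S_zero[OF op_VJ[OF Z, of J]] B by (auto simp: y2_def)
        qed
      next
        fix J assume J: "\<not> (J \<subseteq> ?B \<and> card J = p)"
        show "y2 J = 0"
        proof (cases "J \<subseteq> ?B \<and> j \<in> J")
          case True
          then obtain J0 where J0: "J = insert j J0" "j \<notin> J0" by (metis mk_disjoint_insert)
          then have "J0 \<subseteq> A" using True by auto
          then have "card J0 \<noteq> p'" using J True J0(1) card_insert[of J0] Suc by auto
          then show ?thesis using y2_insert[OF \<open>J0 \<subseteq> A\<close>] cochains_out[OF w(1), of J0] by (simp add: J0(1))
        qed (auto simp: y2_def)
      qed
      have "cobd ?B Z p y2 J = x2 J" for J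
      proof (cases "J \<subseteq> ?B \<and> card J = Suc p")
        case True
        show ?thesis
        proof (cases "j \<in> J")
          case True
          then obtain J0 where J0: "J = insert j J0" "j \<notin> J0" by (metis mk_disjoint_insert)
          have "J0 \<subseteq> A" using \<open>J \<subseteq> ?B \<and> card J = Suc p\<close> J0 by auto
          moreover have "card J0 = Suc p'"
            using \<open>J \<subseteq> ?B \<and> card J = Suc p\<close> card_insert[OF \<open>J0 \<subseteq> A\<close>] Suc J0(1) by simp
          ultimately have J0A: "J0 \<subseteq> A" "card J0 = Suc p'" by auto
          have w_eq: "(\<lambda>J. if J \<subseteq> A then y2 (insert j J) else 0) = w"
            using y2_insert cochains_out[OF w(1)] by (auto simp: fun_eq_iff)
          have "j \<notin> J0" using J0 by simp
          then have "y2 J0 = 0" by (simp add: y2_def)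
          then have "cobd ?B Z p y2 J = cobd A (Z \<inter> V j) p' w J0"
            using cobd_insert[OF Z B insert.hyps(2)[rule_format] J0A, of y2] w_eq Suc J0(1) by simp
          then show ?thesis using w(2) J0A by (simp add: u_def J0(1))
        next
          case False
          then have "y2 (J - {k}) = 0" for k by (simp add: y2_def)
          moreover have "r (VJ Z (J - {k})) (VJ Z J) 0 = 0" for k
            using True B Z by (intro r_zero op_VJ VJ_mono) auto
          moreover have "J \<subseteq> A" using True False by auto
          ultimately show ?thesis using x2A by (simp add: cobd_def)
        qed
      next
        case False
        then show ?thesis using cochains_out[OF x2 False] by (auto simp: cobd_def)
      qed
      then have "cobd ?B Z p (y' + y2) = x"
        using cobd_add[OF Z B y'B y2] by (auto simp: fun_eq_iff x2_def)
      then show ?thesis using cochains_add[OF Z B y'B y2] by blast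
    qed
  qed
qed

end

section \<open>Comparison of cohomology groups\<close>

definition cochain_complex :: "(nat \<Rightarrow> 'a monoid) \<Rightarrow> (nat \<Rightarrow> 'a \<Rightarrow> 'a) \<Rightarrow> bool" where
  "cochain_complex C d \<longleftrightarrow> (\<forall>n. comm_group (C n) \<and> d n \<in> hom (C n) (C (Suc n)) \<and>
     (\<forall>x\<in>carrier (C n). d (Suc n) (d n x) = \<one>\<^bsub>C (Suc (Suc n))\<^esub>))"

lemma cochain_complex_cocycles:
  assumes "cochain_complex C d"
  shows "comm_group ((C n)\<lparr>carrier := kernel (C n) (C (Suc n)) (d n)\<rparr>)"
    and "subgroup (coboundaries C d n) ((C n)\<lparr>carrier := kernel (C n) (C (Suc n)) (d n)\<rparr>)"
    and "x \<in> kernel (C n) (C (Suc n)) (d n) \<Longrightarrow>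
      inv\<^bsub>(C n)\<lparr>carrier := kernel (C n) (C (Suc n)) (d n)\<rparr>\<^esub> x = inv\<^bsub>C n\<^esub> x"
proof -
  have hom: "group_hom (C n) (C (Suc n)) (d n)" for n
    using assms by (simp add: cochain_complex_def group_hom_def group_hom_axioms_def comm_group_def)
  interpret Cn: comm_group "C n" using assms by (simp add: cochain_complex_def)
  interpret h: group_hom "C n" "C (Suc n)" "d n" by (rule hom)
  have sub: "subgroup (kernel (C n) (C (Suc n)) (d n)) (C n)" by (rule h.subgroup_kernel)
  show "comm_group ((C n)\<lparr>carrier := kernel (C n) (C (Suc n)) (d n)\<rparr>)"
    using Cn.subgroup_imp_group[OF sub] subgroup.subset[OF sub]
    by (intro group.group_comm_groupI) (auto intro: Cn.m_comm)
  show "x \<in> kernel (C n) (C (Suc n)) (d n) \<Longrightarrow>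
      inv\<^bsub>(C n)\<lparr>carrier := kernel (C n) (C (Suc n)) (d n)\<rparr>\<^esub> x = inv\<^bsub>C n\<^esub> x"
    using Cn.m_inv_consistent[OF sub] by simp
  have "subgroup (coboundaries C d n) (C n) \<and> coboundaries C d n \<subseteq> kernel (C n) (C (Suc n)) (d n)"
  proof (cases n)
    case 0
    then show ?thesis using Cn.triv_subgroup Cn.one_closed h.hom_one by (auto simp: kernel_def)
  next
    case (Suc m)
    have "subgroup (d m ` carrier (C m)) (C n)"
      using group_hom.img_is_subgroup[OF hom[of m]] Suc by simp
    moreover have "d m ` carrier (C m) \<subseteq> kernel (C n) (C (Suc n)) (d n)"
      using assms by (auto simp: Suc cochain_complex_def kernel_def hom_def)
    ultimately show ?thesis by (simp add: Suc)
  qed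
  then show "subgroup (coboundaries C d n) ((C n)\<lparr>carrier := kernel (C n) (C (Suc n)) (d n)\<rparr>)"
    using Cn.subgroup_incl sub by blast
qed

text \<open>The relation is given on cocycles only, as for the staircases, which need not come from
  a cochain map in either direction.\<close>

lemma cohomology_iso_of_relation:
  assumes C: "cochain_complex C d" and C': "cochain_complex C' d'"
    and carr: "\<And>a b. R a b \<Longrightarrow> a \<in> carrier (C n) \<and> d n a = \<one>\<^bsub>C (Suc n)\<^esub> \<and> b \<in> carrier (C' n) \<and> d' n b = \<one>\<^bsub>C' (Suc n)\<^esub>"
    and mult: "\<And>a b a' b'. R a b \<Longrightarrow> R a' b' \<Longrightarrow> R (a \<otimes>\<^bsub>C n\<^esub> a') (b \<otimes>\<^bsub>C' n\<^esub> b')"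
    and minv: "\<And>a b. R a b \<Longrightarrow> R (inv\<^bsub>C n\<^esub> a) (inv\<^bsub>C' n\<^esub> b)"
    and left: "\<And>a. a \<in> carrier (C n) \<Longrightarrow> d n a = \<one>\<^bsub>C (Suc n)\<^esub> \<Longrightarrow> \<exists>b. R a b"
    and right: "\<And>b. b \<in> carrier (C' n) \<Longrightarrow> d' n b = \<one>\<^bsub>C' (Suc n)\<^esub> \<Longrightarrow> \<exists>a. R a b"
    and cobd: "\<And>a b. R a b \<Longrightarrow> a \<in> coboundaries C d n \<longleftrightarrow> b \<in> coboundaries C' d' n"
  shows "group (cohomology C d n)" and "cohomology C d n \<cong> cohomology C' d' n"
proof -
  note Z = cochain_complex_cocycles[OF C, where n = n] and Z' = cochain_complex_cocycles[OF C', where n = n]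
  have k: "a \<in> kernel (C n) (C (Suc n)) (d n) \<and> b \<in> kernel (C' n) (C' (Suc n)) (d' n)" if "R a b" for a b
    using carr[OF that] by (simp add: kernel_def)
  let ?Z = "(C n)\<lparr>carrier := kernel (C n) (C (Suc n)) (d n)\<rparr>"
  let ?Z' = "(C' n)\<lparr>carrier := kernel (C' n) (C' (Suc n)) (d' n)\<rparr>"
  have Zg: "group ?Z" using Z(1) by (simp add: comm_group_def)
  have 1: "R a b \<Longrightarrow> a \<in> carrier ?Z \<and> b \<in> carrier ?Z'" for a b using k by simp
  have 2: "R a b \<Longrightarrow> R a' b' \<Longrightarrow> R (a \<otimes>\<^bsub>?Z\<^esub> a') (b \<otimes>\<^bsub>?Z'\<^esub> b')" for a b a' b' using mult by simp
  have 3: "R a b \<Longrightarrow> R (inv\<^bsub>?Z\<^esub> a) (inv\<^bsub>?Z'\<^esub> b)" for a b using minv k[of a b] Z(3) Z'(3) by simp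
  have 4: "a \<in> carrier ?Z \<Longrightarrow> \<exists>b. R a b" for a using left by (auto simp: kernel_def)
  have 5: "b \<in> carrier ?Z' \<Longrightarrow> \<exists>a. R a b" for b using right by (auto simp: kernel_def)
  have 6: "coboundaries C d n \<subseteq> carrier ?Z" using Z(2) by (rule subgroup.subset)
  show "group (cohomology C d n)" "cohomology C d n \<cong> cohomology C' d' n"
    unfolding cohomology_def
    using quotient_iso_of_relation[where R = R, OF Zg Z'(1) Z'(2) 1 2 3 4 5 6 cobd] by blast+
qed

lemma face_sign_mult: "face_sign J k * c = sgn_act J k c"
  by (simp add: face_sign_def sgn_act_def)

lemma comm_group_product_group:
  assumes "\<And>i. i \<in> A \<Longrightarrow> comm_group (G i)"
  shows "comm_group (product_group A G)"
  using assms comm_group.axioms(2)[OF assms] comm_groupE(4)[OF assms]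
  by (intro group.group_comm_groupI) (auto intro!: restrict_ext simp: PiE_iff)

lemma comm_group_simplicial_cochains: "comm_group (simplicial_cochains K p)"
  by (simp add: simplicial_cochains_def comm_group_product_group abelian_integer_group)

lemma cochain_complex_simplicial:
  fixes K :: "nat set set"
  assumes K: "\<And>J J'. J \<in> K \<Longrightarrow> J' \<subseteq> J \<Longrightarrow> J' \<in> K"
  shows "cochain_complex (simplicial_cochains K) (simplicial_coboundary K)"
  unfolding cochain_complex_def
proof (intro allI conjI ballI)
  fix n
  show "comm_group (simplicial_cochains K n)" by (rule comm_group_simplicial_cochains)
  have face: "J - {k} \<in> simplices K m" if "J \<in> simplices K (Suc m)" "k \<in> J" for J k m
    using that K[of J "J - {k}"] by (auto simp: simplices_def)
  show "simplicial_coboundary K n \<in> hom (simplicial_cochains K n) (simplicial_cochains K (Suc n))"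
  proof (rule homI)
    fix s t assume "s \<in> carrier (simplicial_cochains K n)" "t \<in> carrier (simplicial_cochains K n)"
    show "simplicial_coboundary K n s \<in> carrier (simplicial_cochains K (Suc n))"
      by (auto simp: simplicial_cochains_def simplicial_coboundary_def)
    show "simplicial_coboundary K n (s \<otimes>\<^bsub>simplicial_cochains K n\<^esub> t) =
        simplicial_coboundary K n s \<otimes>\<^bsub>simplicial_cochains K (Suc n)\<^esub> simplicial_coboundary K n t"
      using face by (auto simp: simplicial_cochains_def simplicial_coboundary_def fun_eq_iff restrict_def
          sum.distrib[symmetric] algebra_simps intro!: sum.cong)
  qed
  fix s assume "s \<in> carrier (simplicial_cochains K n)"
  have "(\<Sum>k\<in>J. face_sign J k * (\<Sum>l\<in>J - {k}. face_sign (J - {k}) l * s (J - {k} - {l}))) = 0"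
    if J: "J \<in> simplices K (Suc (Suc n))" for J
    unfolding sum_distrib_left
  proof (rule sum_antisym_eq_0)
    show "finite J" using J by (simp add: simplices_def)
    fix k l assume "k \<in> J" "l \<in> J" "k < l"
    moreover have "J - {k} - {l} = J - {l} - {k}" by auto
    ultimately show "face_sign J k * (face_sign (J - {k}) l * s (J - {k} - {l})) =
       - (face_sign J l * (face_sign (J - {l}) k * s (J - {l} - {k})))"
      using sgn_act_antisym[of J k l "s (J - {l} - {k})"] \<open>finite J\<close> by (simp add: face_sign_mult)
  qed
  then show "simplicial_coboundary K (Suc n) (simplicial_coboundary K n s) = \<one>\<^bsub>simplicial_cochains K (Suc (Suc n))\<^esub>"
    using face by (auto simp: simplicial_cochains_def simplicial_coboundary_def fun_eq_iff restrict_def)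
qed

text \<open>What the double complex takes from a resolution and a cover, with all groups inside one
  class type. Exactness is asked for nonempty \<open>J\<close>, that is, on intersections of the
  cover: the complex for \<open>J = {}\<close>, on all of \<open>X\<close>, is the one whose
  cohomology is to be found. The augmentation \<open>\<epsilon>\<close> by constants concerns
  nonempty intersections, which are the simplices of the nerve.\<close>

locale resolved_cover =
  fixes op :: "'p set \<Rightarrow> bool"
    and S :: "nat \<Rightarrow> 'p set \<Rightarrow> 'g::ab_group_add set"
    and r :: "nat \<Rightarrow> 'p set \<Rightarrow> 'p set \<Rightarrow> 'g \<Rightarrow> 'g"
    and d :: "nat \<Rightarrow> 'p set \<Rightarrow> 'g \<Rightarrow> 'g"
    and \<epsilon> :: "'p set \<Rightarrow> int \<Rightarrow> 'g"
    and V :: "nat \<Rightarrow> 'p set" and I :: "nat set" and X :: "'p set"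
  assumes flabby: "flabby_cover op (S q) (r q) V I"
    and op_X: "op X"
    and d_in: "op W \<Longrightarrow> s \<in> S q W \<Longrightarrow> d q W s \<in> S (Suc q) W"
    and d_add: "op W \<Longrightarrow> s \<in> S q W \<Longrightarrow> t \<in> S q W \<Longrightarrow> d q W (s + t) = d q W s + d q W t"
    and d_res: "op W \<Longrightarrow> op W' \<Longrightarrow> W' \<subseteq> W \<Longrightarrow> s \<in> S q W \<Longrightarrow> r (Suc q) W W' (d q W s) = d q W' (r q W W' s)"
    and dd: "op W \<Longrightarrow> s \<in> S q W \<Longrightarrow> d (Suc q) W (d q W s) = 0"
    and separated: "s \<in> S q X \<Longrightarrow> (\<And>k. k \<in> I \<Longrightarrow> r q X (X \<inter> V k) s = 0) \<Longrightarrow> s = 0"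
    and S_empty: "S q {} = {0}"
    and exact: "J \<subseteq> I \<Longrightarrow> J \<noteq> {} \<Longrightarrow> s \<in> S (Suc q) (cover_Int V X J) \<Longrightarrow> d (Suc q) (cover_Int V X J) s = 0 \<Longrightarrow>
      \<exists>t\<in>S q (cover_Int V X J). d q (cover_Int V X J) t = s"
    and \<epsilon>_add: "J \<subseteq> I \<Longrightarrow> J \<noteq> {} \<Longrightarrow> cover_Int V X J \<noteq> {} \<Longrightarrow>
      \<epsilon> (cover_Int V X J) (a + b) = \<epsilon> (cover_Int V X J) a + \<epsilon> (cover_Int V X J) b"
    and \<epsilon>_inj: "J \<subseteq> I \<Longrightarrow> J \<noteq> {} \<Longrightarrow> cover_Int V X J \<noteq> {} \<Longrightarrow> \<epsilon> (cover_Int V X J) a = 0 \<Longrightarrow> a = 0"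
    and \<epsilon>_exact: "J \<subseteq> I \<Longrightarrow> J \<noteq> {} \<Longrightarrow> cover_Int V X J \<noteq> {} \<Longrightarrow>
      (s \<in> S 0 (cover_Int V X J) \<and> d 0 (cover_Int V X J) s = 0) \<longleftrightarrow> s \<in> range (\<epsilon> (cover_Int V X J))"
    and \<epsilon>_res: "J \<subseteq> J' \<Longrightarrow> J' \<subseteq> I \<Longrightarrow> J \<noteq> {} \<Longrightarrow> cover_Int V X J' \<noteq> {} \<Longrightarrow>
      r 0 (cover_Int V X J) (cover_Int V X J') (\<epsilon> (cover_Int V X J) a) = \<epsilon> (cover_Int V X J') a"
begin

abbreviation "VX \<equiv> cover_Int V X"

lemma finite_I: "finite I"
  using flabby flabby_cover.finite_I by blast

lemma op_VX: "J \<subseteq> I \<Longrightarrow> op (VX J)"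
  using flabby_cover.op_VJ[OF flabby op_X] .

lemma d_zero: "op W \<Longrightarrow> d q W 0 = 0"
proof -
  assume "op W"
  moreover have "flabby_sheaf op (S q) (r q)" using flabby by (simp add: flabby_cover_def)
  ultimately show ?thesis using d_add[of W 0 q 0] flabby_sheaf.S_zero by fastforce
qed

lemma \<epsilon>_zero: "J \<subseteq> I \<Longrightarrow> J \<noteq> {} \<Longrightarrow> VX J \<noteq> {} \<Longrightarrow> \<epsilon> (VX J) 0 = 0"
  using \<epsilon>_add[of J 0 0] by simp

lemma \<epsilon>_uminus: "J \<subseteq> I \<Longrightarrow> J \<noteq> {} \<Longrightarrow> VX J \<noteq> {} \<Longrightarrow> \<epsilon> (VX J) (- a) = - \<epsilon> (VX J) a"
  using \<epsilon>_add[of J a "- a"] \<epsilon>_zero[of J] by (simp add: eq_neg_iff_add_eq_0 add.commute)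

lemma \<epsilon>_sgn: "J \<subseteq> I \<Longrightarrow> J \<noteq> {} \<Longrightarrow> VX J \<noteq> {} \<Longrightarrow> \<epsilon> (VX J) (sgn_act J' k a) = sgn_act J' k (\<epsilon> (VX J) a)"
  using \<epsilon>_uminus by (simp add: sgn_act_def)

lemma \<epsilon>_sum:
  assumes "J \<subseteq> I" "J \<noteq> {}" "VX J \<noteq> {}" "finite A"
  shows "\<epsilon> (VX J) (sum f A) = (\<Sum>a\<in>A. \<epsilon> (VX J) (f a))"
  using assms(4) by (induction A rule: finite_induct) (simp_all add: \<epsilon>_add \<epsilon>_zero assms)

text \<open>The index \<open>p\<close> counts the sets that are intersected: column 0 holds the
  sections on \<open>X\<close>, and column \<open>Suc p\<close> belongs to the simplices of
  dimension \<open>p\<close>.\<close>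

definition K :: "nat \<Rightarrow> nat \<Rightarrow> (nat set \<Rightarrow> 'g) set" where
  "K p q = flabby_cover.cochains (S q) V I X p"

definition \<delta> :: "nat \<Rightarrow> nat \<Rightarrow> (nat set \<Rightarrow> 'g) \<Rightarrow> nat set \<Rightarrow> 'g" where
  "\<delta> p q = flabby_cover.cobd (r q) V I X p"

definition D :: "nat \<Rightarrow> nat \<Rightarrow> (nat set \<Rightarrow> 'g) \<Rightarrow> nat set \<Rightarrow> 'g" where
  "D p q x = (\<lambda>J. if J \<subseteq> I \<and> card J = p then d q (VX J) (x J) else 0)"

definition N :: "nat \<Rightarrow> nat set set" where
  "N p = {J. J \<subseteq> I \<and> card J = Suc p \<and> VX J \<noteq> {}}"

definition B :: "nat \<Rightarrow> (nat set \<Rightarrow> int) set" where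
  "B p = {b. \<forall>J. J \<notin> N p \<longrightarrow> b J = 0}"

definition E :: "nat \<Rightarrow> (nat set \<Rightarrow> int) \<Rightarrow> nat set \<Rightarrow> int" where
  "E p b = (\<lambda>J. if J \<in> N (Suc p) then \<Sum>k\<in>J. face_sign J k * b (J - {k}) else 0)"

definition \<eta> :: "nat \<Rightarrow> (nat set \<Rightarrow> int) \<Rightarrow> nat set \<Rightarrow> 'g" where
  "\<eta> p b = (\<lambda>J. if J \<in> N p then \<epsilon> (VX J) (b J) else 0)"

lemma K_iff: "x \<in> K p q \<longleftrightarrow> (\<forall>J. (J \<subseteq> I \<and> card J = p \<longrightarrow> x J \<in> S q (VX J)) \<and> (\<not> (J \<subseteq> I \<and> card J = p) \<longrightarrow> x J = 0))"
proof -
  interpret flabby_cover op "S q" "r q" V I by (rule flabby)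
  show ?thesis by (simp add: K_def cochains_def)
qed

lemma \<delta>_eq: "\<delta> p q x J = (if J \<subseteq> I \<and> card J = Suc p
     then \<Sum>k\<in>J. sgn_act J k (r q (VX (J - {k})) (VX J) (x (J - {k}))) else 0)"
proof -
  interpret flabby_cover op "S q" "r q" V I by (rule flabby)
  show ?thesis by (simp add: \<delta>_def cobd_def)
qed

lemma NI:
  assumes "J \<in> N p"
  shows "J \<subseteq> I \<and> J \<noteq> {} \<and> VX J \<noteq> {} \<and> card J = Suc p \<and> finite J"
proof -
  have J: "J \<subseteq> I" "card J = Suc p" "VX J \<noteq> {}" using assms unfolding N_def by blast+
  then have "finite J" "J \<noteq> {}" using card_ge_0_finite[of J] card.empty by force+
  then show ?thesis using J by blast
qed

lemma N_face:
  assumes "J \<in> N (Suc p)" "k \<in> J"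
  shows "J - {k} \<in> N p"
proof -
  note J = NI[OF assms(1)]
  have "VX J \<subseteq> VX (J - {k})" unfolding cover_Int_def by blast
  moreover have "card (J - {k}) = Suc p" using J assms(2) by simp
  ultimately show ?thesis using J unfolding N_def by blast
qed

text \<open>Rows are exact by \<open>cech_exact\<close> and \<open>separated\<close>; columns are
  exact for each index set separately. The two differentials commute instead of anticommuting, since
  staircases are followed and no total complex is formed.\<close>

sublocale double_complex K \<delta> D B E \<eta>
proof
  fix p q
  interpret F: flabby_cover op "S q" "r q" V I by (rule flabby)
  interpret F': flabby_cover op "S (Suc q)" "r (Suc q)" V I by (rule flabby)
  interpret F0: flabby_cover op "S 0" "r 0" V I by (rule flabby)
  note K_q = K_def[of _ q] and \<delta>_q = \<delta>_def[of _ q]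
  show "0 \<in> K p q" unfolding K_q by (rule F.cochains_zero[OF op_X order.refl])
  show "x + y \<in> K p q" if "x \<in> K p q" "y \<in> K p q" for x y
    using F.cochains_add[OF op_X order.refl] that unfolding K_q .
  show "- x \<in> K p q" if "x \<in> K p q" for x
    using F.cochains_uminus[OF op_X order.refl] that unfolding K_q .
  show "\<delta> p q x \<in> K (Suc p) q" if "x \<in> K p q" for x
    using F.cobd_in[OF op_X order.refl] that unfolding K_q \<delta>_q .
  show "\<delta> p q (x + y) = \<delta> p q x + \<delta> p q y" if "x \<in> K p q" "y \<in> K p q" for x y
    using F.cobd_add[OF op_X order.refl] that unfolding K_q \<delta>_q .
  show "\<delta> (Suc p) q (\<delta> p q x) = 0" if "x \<in> K p q" for x
    using F.cobd_cobd[OF op_X order.refl] that unfolding K_q \<delta>_q .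
  show "\<exists>y\<in>K p q. \<delta> p q y = x" if "x \<in> K (Suc p) q" "\<delta> (Suc p) q x = 0" for x
    using F.cech_exact[OF order.refl op_X] that unfolding K_q \<delta>_q .
  show "D p q x \<in> K p (Suc q)" if "x \<in> K p q" for x
    using that d_in op_VX by (auto simp: K_iff D_def)
  show "D p q (x + y) = D p q x + D p q y" if "x \<in> K p q" "y \<in> K p q" for x y
    using that d_add op_VX by (auto simp: K_iff D_def fun_eq_iff)
  show "D p (Suc q) (D p q x) = 0" if "x \<in> K p q" for x
    using that dd op_VX by (auto simp: K_iff D_def fun_eq_iff)
  show "\<delta> p (Suc q) (D p q x) = D (Suc p) q (\<delta> p q x)" if x: "x \<in> K p q" for x
  proof
    fix J
    show "\<delta> p (Suc q) (D p q x) J = D (Suc p) q (\<delta> p q x) J"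
    proof (cases "J \<subseteq> I \<and> card J = Suc p")
      case J: True
      then have fin: "finite J" using card.infinite by fastforce
      have d_sum: "d q (VX J) (sum f A) = (\<Sum>a\<in>A. d q (VX J) (f a))"
        if "finite A" "\<And>a. a \<in> A \<Longrightarrow> f a \<in> S q (VX J)" for f and A :: "nat set"
        using that
      proof (induction A rule: finite_induct)
        case (insert a A)
        then have "sum f A \<in> S q (VX J)" using op_VX[of J] J by (intro F.S_sum) auto
        then show ?case using insert d_add[OF op_VX] J by simp
      qed (use d_zero op_VX J in simp)
      have d_sgn: "d q (VX J) (sgn_act J k s) = sgn_act J k (d q (VX J) s)" if "s \<in> S q (VX J)" for k s
        using d_add[OF op_VX _ F.S_uminus[OF op_VX], of J s s] d_zero[OF op_VX, of J q] J that
        by (simp add: sgn_act_def eq_neg_iff_add_eq_0 add.commute)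
      have "x (J - {k}) \<in> S q (VX (J - {k}))" "card (J - {k}) = p" "op (VX (J - {k}))" "op (VX J)" "VX J \<subseteq> VX (J - {k})"
        "r q (VX (J - {k})) (VX J) (x (J - {k})) \<in> S q (VX J)" if "k \<in> J" for k
        using that J fin F.cobd_term[OF op_X order.refl, of x p J k] x op_VX[of J] op_VX[of "J - {k}"] F.VJ_mono[of "J - {k}" J] unfolding K_q by (auto intro: subset_trans[OF Diff_subset])
      then show ?thesis using J fin
        by (auto simp: \<delta>_eq D_def d_sum d_sgn F.S_sgn d_res intro!: sum.cong)
    qed (auto simp: \<delta>_eq D_def)
  qed
  show "x = 0" if x: "x \<in> K 0 q" "\<delta> 0 q x = 0" for x
  proof -
    have fin: "J = {}" if "J \<subseteq> I" "card J = 0" for J using that finite_I finite_subset by fastforce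
    have V0: "VX {} = X" and V1: "VX {k} = X \<inter> V k" for k by (auto simp: cover_Int_def)
    have "x {} = 0"
    proof (rule separated)
      show "x {} \<in> S q X" using x(1) V0 by (auto simp: K_iff)
      show "r q X (X \<inter> V k) (x {}) = 0" if "k \<in> I" for k
      proof -
        have "\<delta> 0 q x {k} = 0" using x(2) by simp
        then have "sgn_act {k} k (r q X (X \<inter> V k) (x {})) = 0" using that by (simp add: \<delta>_eq V0 V1)
        then show ?thesis by (simp add: sgn_act_def split: if_splits)
      qed
    qed
    moreover have "x J = 0" if "J \<noteq> {}" for J using that x(1) fin[of J] by (auto simp: K_iff)
    ultimately have "x J = 0" for J by (cases "J = {}") simp_all
    then show ?thesis by (simp add: fun_eq_iff)
  qed
  show "\<exists>y\<in>K (Suc p) q. D (Suc p) q y = x" if x: "x \<in> K (Suc p) (Suc q)" "D (Suc p) (Suc q) x = 0" for x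
  proof -
    have "\<exists>t\<in>S q (VX J). d q (VX J) t = x J" if J: "J \<subseteq> I \<and> card J = Suc p" for J
    proof (rule exact)
      show "d (Suc q) (VX J) (x J) = 0" using fun_cong[OF x(2), of J] J by (simp add: D_def)
    qed (use J x(1) in \<open>auto simp: K_iff\<close>)
    then obtain y where y: "\<And>J. J \<subseteq> I \<and> card J = Suc p \<Longrightarrow> y J \<in> S q (VX J) \<and> d q (VX J) (y J) = x J"
      by metis
    define y' where "y' J = (if J \<subseteq> I \<and> card J = Suc p then y J else 0)" for J
    have "y' \<in> K (Suc p) q" "D (Suc p) q y' = x"
      using y x(1) by (auto simp: K_iff y'_def D_def fun_eq_iff)
    then show ?thesis by blast
  qed
  show "b + c \<in> B p" if "b \<in> B p" "c \<in> B p" for b c using that by (auto simp: B_def)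
  show "- b \<in> B p" if "b \<in> B p" for b using that by (auto simp: B_def)
  show "E p b \<in> B (Suc p)" for b by (auto simp: B_def E_def)
  show \<eta>_K: "\<eta> p b \<in> K (Suc p) 0" if "b \<in> B p" for b
    unfolding K_iff
  proof (intro allI conjI impI)
    fix J assume J: "J \<subseteq> I \<and> card J = Suc p"
    show "\<eta> p b J \<in> S 0 (VX J)"
    proof (cases "J \<in> N p")
      case True
      then show ?thesis using \<epsilon>_exact[of J "\<epsilon> (VX J) (b J)"] NI[OF True] by (simp add: \<eta>_def)
    next
      case False
      then show ?thesis using F0.S_zero[OF op_VX[of J]] J by (simp add: \<eta>_def)
    qed
  qed (auto simp: \<eta>_def N_def)
  show "\<eta> p (b + c) = \<eta> p b + \<eta> p c" if "b \<in> B p" "c \<in> B p" for b c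
    using NI \<epsilon>_add by (auto simp: \<eta>_def fun_eq_iff)
  show "b = 0" if b: "b \<in> B p" "\<eta> p b = 0" for b
  proof
    fix J
    show "b J = 0 J"
      using b(1) fun_cong[OF b(2), of J] \<epsilon>_inj[of J "b J"] NI[of J p] by (cases "J \<in> N p") (auto simp: B_def \<eta>_def)
  qed
  show "\<eta> (Suc p) (E p b) = \<delta> (Suc p) 0 (\<eta> p b)" if b: "b \<in> B p" for b
  proof
    fix J
    show "\<eta> (Suc p) (E p b) J = \<delta> (Suc p) 0 (\<eta> p b) J"
    proof (cases "J \<in> N (Suc p)")
      case True
      note J = NI[OF True]
      have "\<epsilon> (VX J) (b (J - {k})) = r 0 (VX (J - {k})) (VX J) (\<eta> p b (J - {k}))" if "k \<in> J" for k
        using N_face[OF True that] NI[OF N_face[OF True that]] J \<epsilon>_res[of "J - {k}" J] by (simp add: \<eta>_def)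
      then show ?thesis using J True
        by (simp add: \<eta>_def[of "Suc p"] E_def \<delta>_eq face_sign_mult \<epsilon>_sum \<epsilon>_sgn)
    next
      case False
      show ?thesis
      proof (cases "J \<subseteq> I \<and> card J = Suc (Suc p)")
        case True
        \<comment> \<open>The only section on an empty intersection is 0, so index sets outside the
          nerve contribute nothing.\<close>
        then have "VX J = {}" using False by (auto simp: N_def)
        then have "\<delta> (Suc p) 0 (\<eta> p b) J = 0"
          using F0.cobd_in[OF op_X order.refl \<eta>_K[OF b, unfolded K_def]] True S_empty
          unfolding \<delta>_def by (auto simp: F0.cochains_def)
        then show ?thesis using False by (simp add: \<eta>_def[of "Suc p"])
      next
        case False
        then have "J \<notin> N (Suc p)" by (auto simp: N_def)
        then show ?thesis using False by (auto simp: \<eta>_def[of "Suc p"] \<delta>_eq)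
      qed
    qed
  qed
  show "D (Suc p) 0 x = 0 \<longleftrightarrow> x \<in> \<eta> p ` B p" if x: "x \<in> K (Suc p) 0" for x
  proof
    assume Dx: "D (Suc p) 0 x = 0"
    have "\<exists>c. x J = \<epsilon> (VX J) c" if J: "J \<in> N p" for J
    proof -
      have "d 0 (VX J) (x J) = 0" using fun_cong[OF Dx, of J] NI[OF J] by (simp add: D_def)
      then show ?thesis using \<epsilon>_exact[of J "x J"] NI[OF J] x by (auto simp: K_iff)
    qed
    then obtain c where c: "\<And>J. J \<in> N p \<Longrightarrow> x J = \<epsilon> (VX J) (c J)" by metis
    define c' where "c' J = (if J \<in> N p then c J else 0)" for J
    have "x J = \<eta> p c' J" for J
    proof (cases "J \<in> N p")
      case True
      then show ?thesis using c by (simp add: \<eta>_def c'_def)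
    next
      case False
      then have "J \<subseteq> I \<and> card J = Suc p \<longrightarrow> VX J = {}" by (auto simp: N_def)
      then have "x J = 0" using x S_empty unfolding K_iff by (metis singletonD)
      then show ?thesis using False by (simp add: \<eta>_def)
    qed
    then have "x = \<eta> p c'" by blast
    moreover have "c' \<in> B p" by (auto simp: B_def c'_def)
    ultimately show "x \<in> \<eta> p ` B p" by blast
  next
    assume "x \<in> \<eta> p ` B p"
    then obtain b where b: "b \<in> B p" "x = \<eta> p b" by blast
    show "D (Suc p) 0 x = 0"
    proof
      fix J
      show "D (Suc p) 0 x J = 0 J"
        using \<epsilon>_exact[of J "x J"] NI[of J p] d_zero op_VX[of J]
        by (cases "J \<in> N p") (auto simp: D_def b(2) \<eta>_def)
    qed
  qed
qed

text \<open>Views a section on \<open>X\<close> as a cochain on the empty index set, which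
  identifies column 0 with the complex of global sections.\<close>

definition base :: "'g \<Rightarrow> nat set \<Rightarrow> 'g" where
  "base g = (\<lambda>J. if J = {} then g else 0)"

lemma base_K: "base g \<in> K 0 q \<longleftrightarrow> g \<in> S q X"
proof -
  have "J = {}" if "J \<subseteq> I" "card J = 0" for J
    using that finite_subset[OF _ finite_I] by (metis card_0_eq)
  moreover have "VX {} = X" by (simp add: cover_Int_def)
  ultimately show ?thesis by (auto simp: K_iff base_def)
qed

lemma K_base: "x \<in> K 0 q \<Longrightarrow> x = base (x {})"
proof
  fix J assume x: "x \<in> K 0 q"
  have "J = {}" if "J \<subseteq> I" "card J = 0"
    using that finite_subset[OF _ finite_I] by (metis card_0_eq)
  then show "x J = base (x {}) J" using x by (auto simp: K_iff base_def)
qed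

lemma D_base: "D 0 q (base g) = base (d q X g)"
proof
  fix J
  have "J = {}" if "J \<subseteq> I" "card J = 0"
    using that finite_subset[OF _ finite_I] by (metis card_0_eq)
  moreover have "VX {} = X" by (simp add: cover_Int_def)
  ultimately show "D 0 q (base g) J = base (d q X g) J" by (auto simp: D_def base_def)
qed

lemma base_inj: "base g = base h \<longleftrightarrow> g = h"
  by (auto simp: base_def fun_eq_iff)

text \<open>The relation \<open>rel\<close> lives in class types. It is pulled back along
  \<open>m\<close>, followed by \<open>base\<close>, on the side of the sections, and along
  \<open>z\<close> on the side of the nerve.\<close>

theorem cohomology_iso:
  assumes C: "cochain_complex C c"
    and m_image: "\<And>q. S q X = m q ` carrier (C q)"
    and m_inj: "\<And>q. inj_on (m q) (carrier (C q))"
    and m_mult: "\<And>q a b. a \<in> carrier (C q) \<Longrightarrow> b \<in> carrier (C q) \<Longrightarrow> m q (a \<otimes>\<^bsub>C q\<^esub> b) = m q a + m q b"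
    and m_d: "\<And>q a. a \<in> carrier (C q) \<Longrightarrow> m (Suc q) (c q a) = d q X (m q a)"
    and L: "\<And>J J'. J \<in> L \<Longrightarrow> J' \<subseteq> J \<Longrightarrow> J' \<in> L" "\<And>p. simplices L p = N p"
  shows "group (cohomology C c i)" and "cohomology C c i \<cong> simplicial_cohomology L i"
proof -
  have Cg: "comm_group (C q)" and c_hom: "c q \<in> hom (C q) (C (Suc q))" for q
    using C by (auto simp: cochain_complex_def)
  interpret Cq: comm_group "C q" for q by (rule Cg)
  have c_in: "a \<in> carrier (C q) \<Longrightarrow> c q a \<in> carrier (C (Suc q))" for a q using c_hom by (auto simp: hom_def)
  have m_one: "m q \<one>\<^bsub>C q\<^esub> = 0" for q using m_mult[of "\<one>\<^bsub>C q\<^esub>" q "\<one>\<^bsub>C q\<^esub>"] by simp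
  have m_inv: "m q (inv\<^bsub>C q\<^esub> a) = - m q a" if "a \<in> carrier (C q)" for q a
    using m_mult[of "inv\<^bsub>C q\<^esub> a" q a] that m_one by (simp add: eq_neg_iff_add_eq_0)
  have m_eq: "m q a = m q b \<longleftrightarrow> a = b" if "a \<in> carrier (C q)" "b \<in> carrier (C q)" for q a b
    using m_inj that by (meson inj_on_eq_iff)
  have c_one: "c q a = \<one>\<^bsub>C (Suc q)\<^esub> \<longleftrightarrow> D 0 q (base (m q a)) = 0" if a: "a \<in> carrier (C q)" for q a
  proof -
    have "D 0 q (base (m q a)) = 0 \<longleftrightarrow> base (m (Suc q) (c q a)) = base (m (Suc q) \<one>\<^bsub>C (Suc q)\<^esub>)"
      unfolding D_base m_d[OF a] m_one by (simp add: base_def fun_eq_iff)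
    then show ?thesis using m_eq[OF c_in[OF a]] by (simp add: base_inj)
  qed
  have m_K: "base (m q a) \<in> K 0 q" if "a \<in> carrier (C q)" for q a using that m_image base_K by blast
  have bd: "base (m i a) \<in> bd i \<longleftrightarrow> a \<in> coboundaries C c i" if a: "a \<in> carrier (C i)" for a
  proof (cases i)
    case 0
    have "base (m i a) = 0 \<longleftrightarrow> m i a = m i \<one>\<^bsub>C i\<^esub>" by (auto simp: base_def fun_eq_iff m_one)
    then show ?thesis using m_eq[OF a] 0 by simp
  next
    case (Suc q)
    have "K 0 q = (\<lambda>b. base (m q b)) ` carrier (C q)"
    proof (intro equalityI subsetI)
      fix x assume x: "x \<in> K 0 q"
      then have x': "x = base (x {})" by (rule K_base)
      then have "x {} \<in> S q X" using x base_K[of "x {}" q] by simp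
      then obtain b where "b \<in> carrier (C q)" "x {} = m q b" unfolding m_image by (rule imageE)
      then show "x \<in> (\<lambda>b. base (m q b)) ` carrier (C q)" using x' by simp
    next
      fix x assume "x \<in> (\<lambda>b. base (m q b)) ` carrier (C q)"
      then show "x \<in> K 0 q" using m_K by (elim imageE) simp
    qed
    then have "base (m i a) \<in> bd i \<longleftrightarrow> (\<exists>b\<in>carrier (C q). m i a = m i (c q b))"
      unfolding Suc by (simp add: image_image image_iff D_base base_inj m_d cong: bex_cong)
    also have "\<dots> \<longleftrightarrow> a \<in> coboundaries C c i" using m_eq[of a i] a c_in[of _ q] by (auto simp: Suc)
    finally show ?thesis .
  qed
  \<comment> \<open>Simplicial cochains are \<open>undefined\<close> outside the simplices, whereas
    the elements of \<open>B p\<close> are 0 there; \<open>z\<close> converts.\<close>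
  define z where "z p b = (\<lambda>J. if J \<in> N p then b J else 0 :: int)" for p b
  let ?C' = "simplicial_cochains L" and ?c' = "simplicial_coboundary L"
  have C': "cochain_complex ?C' ?c'" using L(1) by (rule cochain_complex_simplicial)
  have C'_simps: "carrier (?C' p) = extensional (N p)" "\<one>\<^bsub>?C' p\<^esub> = (\<lambda>J\<in>N p. 0)"
    "x \<otimes>\<^bsub>?C' p\<^esub> y = (\<lambda>J\<in>N p. x J + y J)" for p x y
    by (auto simp: simplicial_cochains_def L(2) PiE_def)
  have z_inv: "z p (inv\<^bsub>?C' p\<^esub> x) = - z p x" if "x \<in> carrier (?C' p)" for p x
    using that by (auto simp: simplicial_cochains_def z_def fun_eq_iff L(2) PiE_def)
  have z_B: "z p b \<in> B p" for p b by (auto simp: z_def B_def)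
  have z_E: "E p (z p b) = z (Suc p) (?c' p b)" for p b
    using N_face by (auto simp: E_def z_def simplicial_coboundary_def L(2) fun_eq_iff intro!: sum.cong)
  have z_add: "z p (x \<otimes>\<^bsub>?C' p\<^esub> y) = z p x + z p y" for p x y by (auto simp: z_def C'_simps fun_eq_iff)
  have z_inj: "z p x = z p y \<longleftrightarrow> x = y" if "x \<in> carrier (?C' p)" "y \<in> carrier (?C' p)" for p x y
    using that unfolding C'_simps z_def extensional_def by (auto simp: fun_eq_iff) metis
  have z_one: "z p \<one>\<^bsub>?C' p\<^esub> = 0" for p by (auto simp: z_def C'_simps)
  have z_surj: "\<exists>x\<in>carrier (?C' p). b = z p x" if "b \<in> B p" for b p
    by (rule bexI[of _ "restrict b (N p)"]) (use that in \<open>auto simp: B_def z_def C'_simps fun_eq_iff\<close>)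
  have c'_in: "?c' p x \<in> carrier (?C' (Suc p))" for p x
    by (simp add: C'_simps simplicial_coboundary_def L(2))
  have C'_one: "\<one>\<^bsub>?C' p\<^esub> \<in> carrier (?C' p)" for p by (simp add: C'_simps)
  have c'_one: "?c' p x = \<one>\<^bsub>?C' (Suc p)\<^esub> \<longleftrightarrow> E p (z p x) = 0" for p x
    using z_inj[OF c'_in[of p x] C'_one] by (simp only: z_E z_one)
  have bdB: "z i b \<in> bdB i \<longleftrightarrow> b \<in> coboundaries ?C' ?c' i" if b: "b \<in> carrier (?C' i)" for b
  proof (cases i)
    case 0
    have "z i b = 0 \<longleftrightarrow> b = \<one>\<^bsub>?C' i\<^esub>" using z_inj[OF b C'_one] by (simp only: z_one)
    then show ?thesis using 0 by simp
  next
    case (Suc p)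
    have "B p = z p ` carrier (?C' p)" using z_surj z_B by blast
    then have "z i b \<in> bdB i \<longleftrightarrow> (\<exists>x\<in>carrier (?C' p). z i b = z i (?c' p x))"
      unfolding Suc by (simp add: image_image image_iff z_E)
    also have "\<dots> \<longleftrightarrow> b \<in> coboundaries ?C' ?c' i" using z_inj[OF b] c'_in[of p] by (auto simp: Suc)
    finally show ?thesis .
  qed
  define R where "R a b \<longleftrightarrow> a \<in> carrier (C i) \<and> b \<in> carrier (?C' i) \<and> rel i (base (m i a)) (z i b)" for a b
  interpret C'i: comm_group "?C' i" by (rule comm_group_simplicial_cochains)
  have base_add: "base (g + h) = base g + base h" and base_uminus: "base (- g) = - base g" for g h
    by (auto simp: base_def fun_eq_iff)
  note * = cohomology_iso_of_relation[OF C C', where n = i and R = R]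
  have 1: "R a b \<Longrightarrow> a \<in> carrier (C i) \<and> c i a = \<one>\<^bsub>C (Suc i)\<^esub> \<and> b \<in> carrier (?C' i) \<and> ?c' i b = \<one>\<^bsub>?C' (Suc i)\<^esub>" for a b
    using rel_mem[of i "base (m i a)" "z i b"] c_one[of a i] c'_one[of i b] by (simp add: R_def)
  have 2: "R (a \<otimes>\<^bsub>C i\<^esub> a') (b \<otimes>\<^bsub>?C' i\<^esub> b')" if "R a b" "R a' b'" for a b a' b'
    using that rel_add[of i "base (m i a)" "z i b" "base (m i a')" "z i b'"]
    by (simp add: R_def z_add m_mult base_add)
  have 3: "R (inv\<^bsub>C i\<^esub> a) (inv\<^bsub>?C' i\<^esub> b)" if "R a b" for a b
    using that rel_uminus[of i "base (m i a)" "z i b"] by (simp add: R_def z_inv m_inv base_uminus)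
  have 4: "\<exists>b. R a b" if a: "a \<in> carrier (C i)" "c i a = \<one>\<^bsub>C (Suc i)\<^esub>" for a
  proof -
    obtain b where b: "rel i (base (m i a)) b" using rel_left[OF m_K[OF a(1)]] a(2) c_one[OF a(1)] by auto
    then obtain x where "x \<in> carrier (?C' i)" "b = z i x" using z_surj rel_mem by blast
    then show ?thesis using a b by (auto simp: R_def)
  qed
  have 5: "\<exists>a. R a b" if b: "b \<in> carrier (?C' i)" "?c' i b = \<one>\<^bsub>?C' (Suc i)\<^esub>" for b
  proof -
    obtain x where x: "rel i x (z i b)" using rel_right[OF z_B] b(2) c'_one by blast
    then have "x \<in> K 0 i" using rel_mem by blast
    then have "x = base (x {})" "x {} \<in> S i X" using K_base[of x i] base_K[of "x {}" i] by auto
    then obtain a where "a \<in> carrier (C i)" "x = base (m i a)" using m_image by (metis imageE)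
    then show ?thesis using b x by (auto simp: R_def)
  qed
  have 6: "R a b \<Longrightarrow> a \<in> coboundaries C c i \<longleftrightarrow> b \<in> coboundaries ?C' ?c' i" for a b
    using rel_bd[of i "base (m i a)" "z i b"] bd bdB unfolding R_def by blast
  show "group (cohomology C c i)" using *(1)[OF 1 2 3 4 5 6] by blast
  show "cohomology C c i \<cong> simplicial_cohomology L i"
    unfolding simplicial_cohomology_def using *(2)[OF 1 2 3 4 5 6] by blast
qed

end

section \<open>Sheaves on finite topological spaces\<close>

lemma sheaf_presheaf: "sheaf X F \<Longrightarrow> presheaf X F"
  by (simp add: sheaf_def)

lemma presheaf_rules:
  assumes "presheaf X F"
  shows "openin X V \<Longrightarrow> comm_group (sec F V)"
    and "openin X V \<Longrightarrow> openin X W \<Longrightarrow> W \<subseteq> V \<Longrightarrow> res F V W \<in> hom (sec F V) (sec F W)"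
    and "openin X V \<Longrightarrow> s \<in> carrier (sec F V) \<Longrightarrow> res F V V s = s"
    and "openin X V \<Longrightarrow> openin X W \<Longrightarrow> openin X W' \<Longrightarrow> W' \<subseteq> W \<Longrightarrow> W \<subseteq> V \<Longrightarrow> s \<in> carrier (sec F V) \<Longrightarrow>
      res F W W' (res F V W s) = res F V W' s"
    and "openin X V \<Longrightarrow> openin X W \<Longrightarrow> W \<subseteq> V \<Longrightarrow> s \<in> carrier (sec F V) \<Longrightarrow> res F V W s \<in> carrier (sec F W)"
proof -
  note P = assms[unfolded presheaf_def]
  show "openin X V \<Longrightarrow> comm_group (sec F V)"
    using P[THEN conjunct1] by simp
  show hom: "openin X V \<Longrightarrow> openin X W \<Longrightarrow> W \<subseteq> V \<Longrightarrow> res F V W \<in> hom (sec F V) (sec F W)"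
    using P[THEN conjunct2, THEN conjunct1] by simp
  show "openin X V \<Longrightarrow> s \<in> carrier (sec F V) \<Longrightarrow> res F V V s = s"
    using P[THEN conjunct2, THEN conjunct2, THEN conjunct1] by simp
  show "openin X V \<Longrightarrow> openin X W \<Longrightarrow> openin X W' \<Longrightarrow> W' \<subseteq> W \<Longrightarrow> W \<subseteq> V \<Longrightarrow> s \<in> carrier (sec F V) \<Longrightarrow>
      res F W W' (res F V W s) = res F V W' s"
    using P[THEN conjunct2, THEN conjunct2, THEN conjunct2] by simp
  show "openin X V \<Longrightarrow> openin X W \<Longrightarrow> W \<subseteq> V \<Longrightarrow> s \<in> carrier (sec F V) \<Longrightarrow> res F V W s \<in> carrier (sec F W)"
    using hom hom_in_carrier by fast
qed

lemma presheaf_res_one: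
  assumes "presheaf X F" "openin X V" "openin X W" "W \<subseteq> V"
  shows "res F V W \<one>\<^bsub>sec F V\<^esub> = \<one>\<^bsub>sec F W\<^esub>"
  using presheaf_rules(1,2)[OF assms(1)] assms(2-) by (simp add: comm_group_def hom_one)

text \<open>The axiom indexes sections by the open sets themselves. A family with repeated sets
  reduces to this because agreement on the overlap forces equal sections on equal sets.\<close>

lemma sheaf_glue:
  assumes F: "sheaf X F"
    and s: "\<And>k. k \<in> A \<Longrightarrow> openin X (V k)" "\<And>k. k \<in> A \<Longrightarrow> s k \<in> carrier (sec F (V k))"
    and agree: "\<And>k l. k \<in> A \<Longrightarrow> l \<in> A \<Longrightarrow> res F (V k) (V k \<inter> V l) (s k) = res F (V l) (V k \<inter> V l) (s l)"
  shows "\<exists>!t. t \<in> carrier (sec F (\<Union>k\<in>A. V k)) \<and> (\<forall>k\<in>A. res F (\<Union>k\<in>A. V k) (V k) t = s k)"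
proof -
  note P = presheaf_rules[OF sheaf_presheaf[OF F]]
  define i where "i W = (SOME k. k \<in> A \<and> V k = W)" for W
  have i: "i W \<in> A \<and> V (i W) = W" if "W \<in> V ` A" for W
    unfolding i_def by (rule someI_ex) (use that in blast)
  have same: "s k = s l" if kl: "k \<in> A" "l \<in> A" "V k = V l" for k l
    using agree[OF kl(1,2)] kl(3) P(3)[OF s(1,2)[OF kl(1)]] P(3)[OF s(1,2)[OF kl(2)]] by simp
  have si: "s (i (V k)) = s k" if "k \<in> A" for k
    using that i[of "V k"] by (intro same) auto
  have "(\<forall>W\<in>V ` A. openin X W \<and> s (i W) \<in> carrier (sec F W)) \<and>
      (\<forall>W\<in>V ` A. \<forall>W'\<in>V ` A. res F W (W \<inter> W') (s (i W)) = res F W' (W \<inter> W') (s (i W')))"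
    by (simp add: si s) (intro ballI agree)
  then have "\<exists>!t. t \<in> carrier (sec F (\<Union>(V ` A))) \<and> (\<forall>W\<in>V ` A. res F (\<Union>(V ` A)) W t = s (i W))"
    by (rule F[unfolded sheaf_def, THEN conjunct2, THEN spec[of _ "V ` A"], THEN spec[of _ "\<lambda>W. s (i W)"], THEN mp])
  moreover have "(\<forall>W\<in>V ` A. res F (\<Union>(V ` A)) W t = s (i W)) \<longleftrightarrow> (\<forall>k\<in>A. res F (\<Union>(V ` A)) (V k) t = s k)" for t
    by (simp add: si)
  ultimately show ?thesis by (simp only:)
qed

text \<open>Both sections glue the restrictions of \<open>t\<close>, and the gluing is
  unique.\<close>

lemma sheaf_separated:
  assumes F: "sheaf X F" and V: "openin X V" and t: "t \<in> carrier (sec F V)" "t' \<in> carrier (sec F V)"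
    and local: "\<And>x. x \<in> V \<Longrightarrow> \<exists>W. openin X W \<and> x \<in> W \<and> W \<subseteq> V \<and> res F V W t = res F V W t'"
  shows "t = t'"
proof -
  note P = presheaf_rules[OF sheaf_presheaf[OF F]]
  obtain W where W: "\<And>x. x \<in> V \<Longrightarrow> openin X (W x) \<and> x \<in> W x \<and> W x \<subseteq> V \<and> res F V (W x) t = res F V (W x) t'"
    using local by metis
  have V_eq: "(\<Union>x\<in>V. W x) = V" using W by blast
  have op_Int: "openin X (W x \<inter> W y)" if "x \<in> V" "y \<in> V" for x y using W that by blast
  have "\<exists>!u. u \<in> carrier (sec F (\<Union>x\<in>V. W x)) \<and> (\<forall>x\<in>V. res F (\<Union>x\<in>V. W x) (W x) u = res F V (W x) t)"
  proof (rule sheaf_glue[OF F])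
    show "res F (W x) (W x \<inter> W y) (res F V (W x) t) = res F (W y) (W x \<inter> W y) (res F V (W y) t)"
      if xy: "x \<in> V" "y \<in> V" for x y
    proof -
      have "res F (W x) (W x \<inter> W y) (res F V (W x) t) = res F V (W x \<inter> W y) t"
        using W xy op_Int[OF xy] V t(1) by (intro P(4)) auto
      moreover have "res F (W y) (W x \<inter> W y) (res F V (W y) t) = res F V (W x \<inter> W y) t"
        using W xy op_Int[OF xy] V t(1) by (intro P(4)) auto
      ultimately show ?thesis by simp
    qed
  qed (use W V t P(5) in auto)
  then have *: "\<exists>!u. u \<in> carrier (sec F V) \<and> (\<forall>x\<in>V. res F V (W x) u = res F V (W x) t)" unfolding V_eq .
  then obtain u where u: "\<forall>v. v \<in> carrier (sec F V) \<and> (\<forall>x\<in>V. res F V (W x) v = res F V (W x) t) \<longrightarrow> v = u"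
    by (elim ex1E) (rule that)
  have "t = u" using t(1) by (intro u[rule_format]) simp
  moreover have "t' = u" using t(2) W by (intro u[rule_format]) simp
  ultimately show ?thesis by simp
qed

text \<open>Gluing along the empty cover leaves exactly one section.\<close>

lemma sheaf_empty:
  assumes "sheaf X F"
  shows "carrier (sec F {}) = {\<one>\<^bsub>sec F {}\<^esub>}"
proof -
  have "\<exists>!t. t \<in> carrier (sec F {})"
    using sheaf_glue[OF assms, of "{}"] by simp
  moreover have "comm_group (sec F {})"
    using presheaf_rules(1)[OF sheaf_presheaf[OF assms]] by simp
  then have "\<one>\<^bsub>sec F {}\<^esub> \<in> carrier (sec F {})"
    by (simp add: comm_group_def group.is_monoid monoid.one_closed)
  ultimately show ?thesis by auto
qed

section \<open>Minimal neighbourhoods and germs\<close>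

definition min_nbhd :: "'p topology \<Rightarrow> 'p \<Rightarrow> 'p set" where
  "min_nbhd X x = \<Inter>{W. openin X W \<and> x \<in> W}"

lemma min_nbhd:
  assumes "finite (topspace X)" "x \<in> topspace X"
  shows "openin X (min_nbhd X x)" "x \<in> min_nbhd X x"
proof -
  have "{W. openin X W \<and> x \<in> W} \<subseteq> Pow (topspace X)" using openin_subset by blast
  then have "finite {W. openin X W \<and> x \<in> W}" using assms(1) finite_subset by blast
  then show "openin X (min_nbhd X x)"
    unfolding min_nbhd_def using assms(2) by (intro openin_Inter) auto
qed (simp add: min_nbhd_def)

lemma min_nbhd_subset: "openin X W \<Longrightarrow> x \<in> W \<Longrightarrow> min_nbhd X x \<subseteq> W"
  by (auto simp: min_nbhd_def)

locale finite_space =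
  fixes X :: "'p topology"
  assumes finite_X: "finite (topspace X)"
begin

abbreviation "nb \<equiv> min_nbhd X"

lemma nb_open: "openin X V \<Longrightarrow> x \<in> V \<Longrightarrow> openin X (nb x)"
  using min_nbhd(1)[OF finite_X] openin_subset by blast

lemma nb_self [simp]: "x \<in> nb x"
  by (simp add: min_nbhd_def)

lemma nb_sub: "openin X V \<Longrightarrow> x \<in> V \<Longrightarrow> y \<in> nb x \<Longrightarrow> y \<in> V"
  by (rule subsetD[OF min_nbhd_subset])

lemma nb_trans: "openin X V \<Longrightarrow> x \<in> V \<Longrightarrow> y \<in> nb x \<Longrightarrow> nb y \<subseteq> nb x"
  by (rule min_nbhd_subset[OF nb_open])

text \<open>The sections on \<open>nb x\<close> are the stalk at \<open>x\<close>, so a sheaf on a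
  finite space is a functor on the specialization preorder: its sections are the compatible families
  of germs. Homomorphisms can then be defined germ by germ.\<close>

lemma sheaf_germs:
  assumes F: "sheaf X F" and V: "openin X V"
    and v: "\<And>x. x \<in> V \<Longrightarrow> v x \<in> carrier (sec F (nb x))"
    and compat: "\<And>x y. x \<in> V \<Longrightarrow> y \<in> nb x \<Longrightarrow> res F (nb x) (nb y) (v x) = v y"
  shows "\<exists>!t. t \<in> carrier (sec F V) \<and> (\<forall>x\<in>V. res F V (nb x) t = v x)"
proof -
  note P = presheaf_rules[OF sheaf_presheaf[OF F]]
  have V_eq: "(\<Union>x\<in>V. nb x) = V" using nb_sub[OF V] by auto
  have "\<exists>!t. t \<in> carrier (sec F (\<Union>x\<in>V. nb x)) \<and> (\<forall>x\<in>V. res F (\<Union>x\<in>V. nb x) (nb x) t = v x)"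
  proof (rule sheaf_glue[OF F])
    fix x y assume xy: "x \<in> V" "y \<in> V"
    note op = nb_open[OF V xy(1)] nb_open[OF V xy(2)]
    have op_Int: "openin X (nb x \<inter> nb y)" using op by blast
    show "res F (nb x) (nb x \<inter> nb y) (v x) = res F (nb y) (nb x \<inter> nb y) (v y)"
    \<comment> \<open>On an overlap, agreement is tested on minimal neighbourhoods, where both sides
      restrict to \<open>v z\<close>.\<close>
    proof (rule sheaf_separated[OF F op_Int])
      fix z assume z: "z \<in> nb x \<inter> nb y"
      then have zV: "z \<in> V" using nb_sub[OF V xy(1)] by blast
      have sub: "nb z \<subseteq> nb x \<inter> nb y" using min_nbhd_subset[OF op_Int z] .
      have "res F (nb x \<inter> nb y) (nb z) (res F (nb x) (nb x \<inter> nb y) (v x)) = v z"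
        using P(4)[OF op(1) op_Int nb_open[OF V zV] sub _ v[OF xy(1)]] compat[OF xy(1)] z by simp
      moreover have "res F (nb x \<inter> nb y) (nb z) (res F (nb y) (nb x \<inter> nb y) (v y)) = v z"
        using P(4)[OF op(2) op_Int nb_open[OF V zV] sub _ v[OF xy(2)]] compat[OF xy(2)] z by simp
      ultimately show "\<exists>W. openin X W \<and> z \<in> W \<and> W \<subseteq> nb x \<inter> nb y \<and>
          res F (nb x \<inter> nb y) W (res F (nb x) (nb x \<inter> nb y) (v x)) =
          res F (nb x \<inter> nb y) W (res F (nb y) (nb x \<inter> nb y) (v y))"
        using nb_open[OF V zV] sub by (intro exI[of _ "nb z"]) simp
    qed (use v xy op op_Int P(5) in auto)
  qed (use nb_open[OF V] v in auto)
  then show ?thesis unfolding V_eq .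
qed

end

text \<open>Transport of a presheaf along an injection \<open>e\<close> with left inverse \<open>g\<close>.\<close>

definition transport :: "('a \<Rightarrow> 'b) \<Rightarrow> ('b \<Rightarrow> 'a) \<Rightarrow> ('p, 'a) presheaf \<Rightarrow> ('p, 'b) presheaf" where
  "transport e g F =
    \<lparr>sec = (\<lambda>V. \<lparr>carrier = e ` carrier (sec F V),
        monoid.mult = (\<lambda>x y. e (g x \<otimes>\<^bsub>sec F V\<^esub> g y)), one = e \<one>\<^bsub>sec F V\<^esub>\<rparr>),
     res = (\<lambda>V W s. e (res F V W (g s)))\<rparr>"

lemma transport_simps [simp]:
  "carrier (sec (transport e g F) V) = e ` carrier (sec F V)"
  "x \<otimes>\<^bsub>sec (transport e g F) V\<^esub> y = e (g x \<otimes>\<^bsub>sec F V\<^esub> g y)"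
  "\<one>\<^bsub>sec (transport e g F) V\<^esub> = e \<one>\<^bsub>sec F V\<^esub>"
  "res (transport e g F) V W s = e (res F V W (g s))"
  by (simp_all add: transport_def)

lemma sheaf_transport:
  assumes F: "sheaf X F" and g: "\<And>V s. openin X V \<Longrightarrow> s \<in> carrier (sec F V) \<Longrightarrow> g (e s) = s"
  shows "sheaf X (transport e g F)"
proof -
  note P = presheaf_rules[OF sheaf_presheaf[OF F]]
  have grp: "group (sec F V)" "comm_monoid (sec F V)" "monoid (sec F V)" if "openin X V" for V
    using P(1)[OF that] by (simp_all add: comm_group_def group.is_monoid)
  have "comm_group (sec (transport e g F) V)" if V: "openin X V" for V
  proof -
    interpret comm_group "sec F V" using P(1)[OF V] .
    show ?thesis
    proof (rule comm_groupI)
      show "\<exists>y\<in>carrier (sec (transport e g F) V).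
          y \<otimes>\<^bsub>sec (transport e g F) V\<^esub> x = \<one>\<^bsub>sec (transport e g F) V\<^esub>"
        if "x \<in> carrier (sec (transport e g F) V)" for x
        using that g[OF V] by (auto intro!: bexI[of _ "inv\<^bsub>sec F V\<^esub> (g x)"])
    qed (use g[OF V] in \<open>auto simp: m_ac\<close>)
  qed
  moreover have "res (transport e g F) V W \<in> hom (sec (transport e g F) V) (sec (transport e g F) W)"
    if V: "openin X V" "openin X W" "W \<subseteq> V" for V W
  proof -
    interpret comm_group "sec F V" using P(1)[OF V(1)] .
    show ?thesis
      using g[OF V(1)] g[OF V(2)] P(5)[OF V] hom_mult[OF P(2)[OF V]] by (auto intro!: homI)
  qed
  ultimately have pre: "presheaf X (transport e g F)"
    unfolding presheaf_def
  proof (intro conjI allI impI ballI)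
    fix V W W' s
    assume o: "openin X V \<and> openin X W \<and> openin X W' \<and> W' \<subseteq> W \<and> W \<subseteq> V"
      and "s \<in> carrier (sec (transport e g F) V)"
    then obtain u where u: "u \<in> carrier (sec F V)" "s = e u" by auto
    have ru: "res F V W u \<in> carrier (sec F W)" using P(5) o u(1) by blast
    show "res (transport e g F) W W' (res (transport e g F) V W s) = res (transport e g F) V W' s"
      using P(4)[of V W W' u] o u g[of V u] g[OF _ ru] by simp
  next
    fix V s assume "openin X V" "s \<in> carrier (sec (transport e g F) V)"
    then show "res (transport e g F) V V s = s" using g[of V] P(3)[of V] by auto
  qed simp_all
  show ?thesis unfolding sheaf_def
  proof (intro conjI pre allI impI)
    fix \<W> s
    assume s: "(\<forall>W\<in>\<W>. openin X W \<and> s W \<in> carrier (sec (transport e g F) W)) \<and>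
      (\<forall>W\<in>\<W>. \<forall>W'\<in>\<W>. res (transport e g F) W (W \<inter> W') (s W) = res (transport e g F) W' (W \<inter> W') (s W'))"
    have op: "openin X W" and sW: "g (s W) \<in> carrier (sec F W)" "e (g (s W)) = s W" if "W \<in> \<W>" for W
      using s that g by auto
    have opU: "openin X (\<Union>\<W>)" using op by blast
    have "res F W (W \<inter> W') (g (s W)) = res F W' (W \<inter> W') (g (s W'))" if W: "W \<in> \<W>" "W' \<in> \<W>" for W W'
    proof -
      have o: "openin X (W \<inter> W')" using op W by blast
      have "g (e (res F W (W \<inter> W') (g (s W)))) = g (e (res F W' (W \<inter> W') (g (s W'))))" using s W by simp
      then show ?thesis
        using g[OF o P(5)[OF op[OF W(1)] o _ sW(1)[OF W(1)]]] g[OF o P(5)[OF op[OF W(2)] o _ sW(1)[OF W(2)]]] by simp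
    qed
    then have "(\<forall>W\<in>\<W>. openin X W \<and> g (s W) \<in> carrier (sec F W)) \<and>
        (\<forall>W\<in>\<W>. \<forall>W'\<in>\<W>. res F W (W \<inter> W') (g (s W)) = res F W' (W \<inter> W') (g (s W')))"
      using op sW by blast
    then have "\<exists>!t. t \<in> carrier (sec F (\<Union>\<W>)) \<and> (\<forall>W\<in>\<W>. res F (\<Union>\<W>) W t = g (s W))"
      by (rule F[unfolded sheaf_def, THEN conjunct2, THEN spec[of _ \<W>], THEN spec[of _ "\<lambda>W. g (s W)"], THEN mp])
    then obtain t where t: "t \<in> carrier (sec F (\<Union>\<W>))" "\<And>W. W \<in> \<W> \<Longrightarrow> res F (\<Union>\<W>) W t = g (s W)"
      and uniq: "\<And>t'. t' \<in> carrier (sec F (\<Union>\<W>)) \<Longrightarrow> (\<And>W. W \<in> \<W> \<Longrightarrow> res F (\<Union>\<W>) W t' = g (s W)) \<Longrightarrow> t' = t"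
      by blast
    show "\<exists>!t. t \<in> carrier (sec (transport e g F) (\<Union>\<W>)) \<and> (\<forall>W\<in>\<W>. res (transport e g F) (\<Union>\<W>) W t = s W)"
    proof (rule ex1I[of _ "e t"])
      show "e t \<in> carrier (sec (transport e g F) (\<Union>\<W>)) \<and> (\<forall>W\<in>\<W>. res (transport e g F) (\<Union>\<W>) W (e t) = s W)"
        using t g[OF opU] sW(2) by auto
      fix t' assume t': "t' \<in> carrier (sec (transport e g F) (\<Union>\<W>)) \<and> (\<forall>W\<in>\<W>. res (transport e g F) (\<Union>\<W>) W t' = s W)"
      then obtain u where u: "u \<in> carrier (sec F (\<Union>\<W>))" "t' = e u" by auto
      have "res F (\<Union>\<W>) W u = g (s W)" if W: "W \<in> \<W>" for W
      proof -
        have "g (e (res F (\<Union>\<W>) W u)) = g (s W)" using t' W u g[OF opU] by auto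
        then show ?thesis using g[OF op[OF W] P(5)[OF opU op[OF W] Union_upper[OF W] u(1)]] by simp
      qed
      then show "t' = e t" using uniq u by blast
    qed
  qed
qed

section \<open>Injective sheaves are flabby\<close>

text \<open>The extension by zero of the constant sheaf \<open>\<int>\<close> on the open set \<open>W\<close>.\<close>

definition int_ext_zero :: "'p topology \<Rightarrow> 'p set \<Rightarrow> ('p, 'p \<Rightarrow> int) presheaf" where
  "int_ext_zero X W =
    \<lparr>sec = (\<lambda>V. \<lparr>carrier = {s \<in> extensional V. (\<forall>x\<in>V. \<forall>y\<in>min_nbhd X x. s y = s x) \<and> (\<forall>x\<in>V - W. s x = 0)},
        monoid.mult = (\<lambda>s t. \<lambda>x\<in>V. s x + t x), one = (\<lambda>x\<in>V. 0)\<rparr>),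
     res = (\<lambda>V W s. restrict s W)\<rparr>"

lemma int_ext_zero_carrier:
  "s \<in> carrier (sec (int_ext_zero X W) V) \<longleftrightarrow>
     s \<in> extensional V \<and> (\<forall>x\<in>V. \<forall>y\<in>min_nbhd X x. s y = s x) \<and> (\<forall>x\<in>V - W. s x = 0)"
  by (simp add: int_ext_zero_def)

lemma int_ext_zero_simps [simp]:
  "s \<otimes>\<^bsub>sec (int_ext_zero X W) V\<^esub> t = (\<lambda>x\<in>V. s x + t x)"
  "\<one>\<^bsub>sec (int_ext_zero X W) V\<^esub> = (\<lambda>x\<in>V. 0)"
  "res (int_ext_zero X W) V V' s = restrict s V'"
  by (simp_all add: int_ext_zero_def)

lemma int_ext_zeroD:
  assumes "s \<in> carrier (sec (int_ext_zero X W) V)"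
  shows "s \<in> extensional V" and "x \<in> V \<Longrightarrow> y \<in> min_nbhd X x \<Longrightarrow> s y = s x" and "x \<in> V \<Longrightarrow> x \<notin> W \<Longrightarrow> s x = 0"
  using assms unfolding int_ext_zero_carrier by blast+

context finite_space
begin

lemma int_ext_zeroI:
  assumes V: "openin X V"
    and "\<And>x y. x \<in> V \<Longrightarrow> y \<in> V \<Longrightarrow> y \<in> nb x \<Longrightarrow> f y = f x" and "\<And>x. x \<in> V \<Longrightarrow> x \<notin> W \<Longrightarrow> f x = 0"
  shows "(\<lambda>x\<in>V. f x) \<in> carrier (sec (int_ext_zero X W) V)"
  unfolding int_ext_zero_carrier
proof (intro conjI ballI)
  fix x y assume "x \<in> V" "y \<in> nb x"
  moreover from this have "y \<in> V" by (rule nb_sub[OF V])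
  ultimately show "restrict f V y = restrict f V x" using assms(2)[of x y] by simp
qed (use assms(3) in auto)

text \<open>Constancy on minimal neighbourhoods and vanishing outside \<open>W\<close> are both
  local conditions, so functions with these properties glue pointwise.\<close>

lemma sheaf_int_ext_zero: "sheaf X (int_ext_zero X W)"
  unfolding sheaf_def presheaf_def
proof (intro conjI allI impI ballI)
  fix V assume V: "openin X V"
  show "comm_group (sec (int_ext_zero X W) V)"
  proof (rule comm_groupI)
    fix s t assume s: "s \<in> carrier (sec (int_ext_zero X W) V)" and t: "t \<in> carrier (sec (int_ext_zero X W) V)"
    show "s \<otimes>\<^bsub>sec (int_ext_zero X W) V\<^esub> t \<in> carrier (sec (int_ext_zero X W) V)"
      unfolding int_ext_zero_simps
    proof (rule int_ext_zeroI[OF V])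
      show "s y + t y = s x + t x" if "x \<in> V" "y \<in> nb x" for x y
        using int_ext_zeroD(2)[OF s that] int_ext_zeroD(2)[OF t that] by simp
      show "s x + t x = 0" if "x \<in> V" "x \<notin> W" for x
        using int_ext_zeroD(3)[OF s that] int_ext_zeroD(3)[OF t that] by simp
    qed
  next
    show "\<one>\<^bsub>sec (int_ext_zero X W) V\<^esub> \<in> carrier (sec (int_ext_zero X W) V)"
      unfolding int_ext_zero_simps by (rule int_ext_zeroI[OF V]) simp_all
  next
    fix s assume s: "s \<in> carrier (sec (int_ext_zero X W) V)"
    show "\<one>\<^bsub>sec (int_ext_zero X W) V\<^esub> \<otimes>\<^bsub>sec (int_ext_zero X W) V\<^esub> s = s"
      using int_ext_zeroD(1)[OF s] by (simp add: extensional_def fun_eq_iff)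
    have "(\<lambda>x\<in>V. - s x) \<in> carrier (sec (int_ext_zero X W) V)"
    proof (rule int_ext_zeroI[OF V])
      show "- s y = - s x" if "x \<in> V" "y \<in> nb x" for x y using int_ext_zeroD(2)[OF s that] by simp
      show "- s x = 0" if "x \<in> V" "x \<notin> W" for x using int_ext_zeroD(3)[OF s that] by simp
    qed
    moreover have "(\<lambda>x\<in>V. - s x) \<otimes>\<^bsub>sec (int_ext_zero X W) V\<^esub> s = \<one>\<^bsub>sec (int_ext_zero X W) V\<^esub>"
      by (simp add: fun_eq_iff)
    ultimately show "\<exists>t\<in>carrier (sec (int_ext_zero X W) V).
        t \<otimes>\<^bsub>sec (int_ext_zero X W) V\<^esub> s = \<one>\<^bsub>sec (int_ext_zero X W) V\<^esub>" by blast
  qed (simp_all add: fun_eq_iff)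
next
  fix V s assume "openin X V" "s \<in> carrier (sec (int_ext_zero X W) V)"
  then show "res (int_ext_zero X W) V V s = s" using int_ext_zeroD(1)[of s X W V] by (simp add: extensional_restrict)
next
  fix V V' assume V: "openin X V \<and> openin X V' \<and> V' \<subseteq> V"
  then have V'V: "x \<in> V" if "x \<in> V'" for x using that by blast
  show "res (int_ext_zero X W) V V' \<in> hom (sec (int_ext_zero X W) V) (sec (int_ext_zero X W) V')"
  proof (rule homI)
    fix s assume s: "s \<in> carrier (sec (int_ext_zero X W) V)"
    show "res (int_ext_zero X W) V V' s \<in> carrier (sec (int_ext_zero X W) V')"
      unfolding int_ext_zero_simps
    proof (rule int_ext_zeroI)
      show "openin X V'" using V by blast
      show "s y = s x" if "x \<in> V'" "y \<in> nb x" for x y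
        using int_ext_zeroD(2)[OF s V'V[OF that(1)] that(2)] .
      show "s x = 0" if "x \<in> V'" "x \<notin> W" for x
        using int_ext_zeroD(3)[OF s V'V[OF that(1)] that(2)] .
    qed
  qed (use V'V in \<open>simp add: fun_eq_iff\<close>)
next
  fix V V' V'' s assume "openin X V \<and> openin X V' \<and> openin X V'' \<and> V'' \<subseteq> V' \<and> V' \<subseteq> V"
  then have "V'' \<inter> V' = V''" "V' \<inter> V'' = V''" by blast+
  then show "res (int_ext_zero X W) V' V'' (res (int_ext_zero X W) V V' s) = res (int_ext_zero X W) V V'' s"
    by simp
next
  fix \<W> s
  assume s': "(\<forall>V\<in>\<W>. openin X V \<and> s V \<in> carrier (sec (int_ext_zero X W) V)) \<and>
    (\<forall>V\<in>\<W>. \<forall>V'\<in>\<W>. res (int_ext_zero X W) V (V \<inter> V') (s V) = res (int_ext_zero X W) V' (V \<inter> V') (s V'))"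
  have op: "openin X V" and s: "s V \<in> carrier (sec (int_ext_zero X W) V)" if "V \<in> \<W>" for V
    using s'[THEN conjunct1] that by simp_all
  have agree: "s V x = s V' x" if "V \<in> \<W>" "V' \<in> \<W>" "x \<in> V" "x \<in> V'" for V V' x
  proof -
    have "restrict (s V) (V \<inter> V') = restrict (s V') (V \<inter> V')" using s'[THEN conjunct2] that(1,2) by simp
    from fun_cong[OF this, of x] show ?thesis using that(3,4) by simp
  qed
  define c where "c x = (SOME V. V \<in> \<W> \<and> x \<in> V)" for x
  have c: "c x \<in> \<W> \<and> x \<in> c x" if "x \<in> \<Union>\<W>" for x
    unfolding c_def by (rule someI_ex) (use that in blast)
  define t where "t = (\<lambda>x\<in>\<Union>\<W>. s (c x) x)"
  have s_eq: "s (c x) x = s V x" if V: "V \<in> \<W>" "x \<in> V" for V x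
  proof -
    have "x \<in> \<Union>\<W>" using V by blast
    then show ?thesis using agree[of "c x" V x] c V by simp
  qed
  have t_eq: "t x = s V x" if V: "V \<in> \<W>" "x \<in> V" for V x
  proof -
    have "x \<in> \<Union>\<W>" using V by blast
    then show ?thesis using s_eq[OF V] unfolding t_def by simp
  qed
  show "\<exists>!t. t \<in> carrier (sec (int_ext_zero X W) (\<Union>\<W>)) \<and> (\<forall>V\<in>\<W>. res (int_ext_zero X W) (\<Union>\<W>) V t = s V)"
  proof (rule ex1I[of _ t])
    have "t \<in> carrier (sec (int_ext_zero X W) (\<Union>\<W>))"
      unfolding t_def
    proof (rule int_ext_zeroI)
      show "openin X (\<Union>\<W>)" using op by (rule openin_Union)
      fix x assume "x \<in> \<Union>\<W>"
      then obtain V where V: "V \<in> \<W>" "x \<in> V" by blast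
      show "s (c x) x = 0" if "x \<notin> W"
        using s_eq[OF V] int_ext_zeroD(3)[OF s[OF V(1)] V(2) that] by simp
      fix y assume y: "y \<in> nb x"
      then have "y \<in> V" by (rule nb_sub[OF op[OF V(1)] V(2)])
      then show "s (c y) y = s (c x) x"
        using s_eq[OF V] s_eq[OF V(1)] int_ext_zeroD(2)[OF s[OF V(1)] V(2) y] by simp
    qed
    moreover have "restrict t V = s V" if V: "V \<in> \<W>" for V
    proof
      fix x show "restrict t V x = s V x"
        using t_eq[OF V, of x] int_ext_zeroD(1)[OF s[OF V]] by (cases "x \<in> V") (simp_all add: extensional_def)
    qed
    ultimately show "t \<in> carrier (sec (int_ext_zero X W) (\<Union>\<W>)) \<and> (\<forall>V\<in>\<W>. res (int_ext_zero X W) (\<Union>\<W>) V t = s V)"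
      by simp
    fix t' assume t': "t' \<in> carrier (sec (int_ext_zero X W) (\<Union>\<W>)) \<and> (\<forall>V\<in>\<W>. res (int_ext_zero X W) (\<Union>\<W>) V t' = s V)"
    show "t' = t"
    proof
      fix x show "t' x = t x"
      proof (cases "x \<in> \<Union>\<W>")
        case True
        then obtain V where V: "V \<in> \<W>" "x \<in> V" by blast
        have "restrict t' V x = s V x" using t'[THEN conjunct2] V by simp
        then show ?thesis using t_eq[OF V] V(2) by simp
      next
        case False
        then show ?thesis using int_ext_zeroD(1)[OF t'[THEN conjunct1]] unfolding t_def extensional_def by simp
      qed
    qed
  qed
qed

text \<open>A section \<open>s\<close> on \<open>W\<close> is the same as a homomorphism to
  \<open>F\<close> from the extension by zero of \<int> on \<open>W\<close>. Injectivity extends it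
  to the constant sheaf \<int> on the whole space, and the image of 1 restricts to
  \<open>s\<close>.\<close>

theorem injective_sheaf_flabby:
  fixes F :: "('p, ('p, 'p \<Rightarrow> int) sheaf_universe) presheaf"
  assumes inj: "injective_sheaf X F" and W: "openin X W" and s: "s \<in> carrier (sec F W)"
  shows "\<exists>t\<in>carrier (sec F (topspace X)). res F (topspace X) W t = s"
proof -
  have F: "sheaf X F" using inj by (simp add: injective_sheaf_def)
  note P = presheaf_rules[OF sheaf_presheaf[OF F]]
  \<comment> \<open>Injectivity quantifies over test sheaves with sections in the universe, so
    integer functions are stored there as constant maps into the left summand.\<close>
  define e :: "('p \<Rightarrow> int) \<Rightarrow> ('p, 'p \<Rightarrow> int) sheaf_universe" where "e f = (\<lambda>_. Inl f)" for f
  define g :: "('p, 'p \<Rightarrow> int) sheaf_universe \<Rightarrow> 'p \<Rightarrow> int" where "g u = projl (u undefined)" for u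
  have ge: "g (e f) = f" for f by (simp add: e_def g_def)
  let ?A = "transport e g (int_ext_zero X W)" and ?B = "transport e g (int_ext_zero X (topspace X))"
  have A: "sheaf X ?A" and B: "sheaf X ?B" using ge by (auto intro!: sheaf_transport sheaf_int_ext_zero)
  have mono: "sheaf_mono X ?A ?B (\<lambda>V s. s)"
    unfolding sheaf_mono_def sheaf_hom_def
  proof (intro conjI allI impI ballI)
    fix V assume V: "openin X V"
    show "(\<lambda>s. s) \<in> hom (sec ?A V) (sec ?B V)"
    proof (rule homI)
      fix u assume "u \<in> carrier (sec ?A V)"
      then obtain f where f: "f \<in> carrier (sec (int_ext_zero X W) V)" "u = e f" unfolding transport_simps by (rule imageE)
      then have "f \<in> carrier (sec (int_ext_zero X (topspace X)) V)"
        using openin_subset[OF V] unfolding int_ext_zero_carrier by blast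
      then show "u \<in> carrier (sec ?B V)" using f(2) by simp
    qed simp
  qed (simp_all add: inj_on_def)
  \<comment> \<open>The germ at \<open>x\<close> of the multiple f s; outside \<open>W\<close>,
    where \<open>f\<close> vanishes, it is trivial.\<close>
  define germ where "germ x f = (if x \<in> W then res F W (nb x) s [^]\<^bsub>sec F (nb x)\<^esub> (f x :: int) else \<one>\<^bsub>sec F (nb x)\<^esub>)" for x f
  have resW: "res F W (nb x) s \<in> carrier (sec F (nb x))" if "x \<in> W" for x
    by (rule P(5)[OF W nb_open[OF W that] min_nbhd_subset[OF W that] s])
  have germ_in: "germ x f \<in> carrier (sec F (nb x))" if V: "openin X V" "x \<in> V" for x f V
  proof -
    interpret comm_group "sec F (nb x)" using P(1) nb_open[OF V] .
    show ?thesis using resW by (simp add: germ_def)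
  qed
  have germ_res: "res F (nb x) (nb y) (germ x f) = germ y f"
    if V: "openin X V" "x \<in> V" and y: "y \<in> nb x" and f: "f \<in> carrier (sec (int_ext_zero X W) V)" for V x y f
  proof -
    have yV: "y \<in> V" using nb_sub[OF V y] .
    have fy: "f y = f x" using int_ext_zeroD(2)[OF f V(2) y] .
    interpret G: comm_group "sec F (nb x)" using P(1) nb_open[OF V] .
    interpret H: comm_group "sec F (nb y)" using P(1) nb_open[OF V(1) yV] .
    have hom: "res F (nb x) (nb y) \<in> hom (sec F (nb x)) (sec F (nb y))"
      by (intro P(2) nb_open[OF V] nb_open[OF V(1) yV] nb_trans[OF V y])
    interpret h: group_hom "sec F (nb x)" "sec F (nb y)" "res F (nb x) (nb y)"
      using hom by unfold_locales
    show ?thesis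
    proof (cases "x \<in> W")
      case True
      then have "y \<in> W" using nb_sub[OF W True y] by simp
      moreover have "res F (nb x) (nb y) (res F W (nb x) s) = res F W (nb y) s"
        using True W s by (intro P(4) nb_open[OF V] nb_open[OF V(1) yV] nb_trans[OF V y] min_nbhd_subset)
      ultimately show ?thesis using True fy h.hom_int_pow[OF resW[OF True]] by (simp add: germ_def)
    next
      case False
      then have "f x = 0" using int_ext_zeroD(3)[OF f V(2)] by simp
      then show ?thesis using False fy by (simp add: germ_def)
    qed
  qed
  have ex: "\<exists>!t. t \<in> carrier (sec F V) \<and> (\<forall>x\<in>V. res F V (nb x) t = germ x f)"
    if V: "openin X V" and f: "f \<in> carrier (sec (int_ext_zero X W) V)" for V f
    by (rule sheaf_germs[OF F V]) (auto intro: germ_in[OF V] germ_res[OF V _ _ f])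
  define \<phi> where "\<phi> V u = (THE t. t \<in> carrier (sec F V) \<and> (\<forall>x\<in>V. res F V (nb x) t = germ x (g u)))" for V u
  have \<phi>_eq: "\<phi> V (e f) = t"
    if "openin X V" "f \<in> carrier (sec (int_ext_zero X W) V)" "t \<in> carrier (sec F V)"
      "\<And>x. x \<in> V \<Longrightarrow> res F V (nb x) t = germ x f" for V f t
    unfolding \<phi>_def ge using ex[OF that(1,2)] that(3,4) by (intro the1_equality) auto
  have \<phi>: "\<phi> V (e f) \<in> carrier (sec F V)" "x \<in> V \<Longrightarrow> res F V (nb x) (\<phi> V (e f)) = germ x f"
    if "openin X V" "f \<in> carrier (sec (int_ext_zero X W) V)" for V f x
    using theI'[OF ex[OF that]] by (auto simp: \<phi>_def ge)
  have \<phi>_hom: "sheaf_hom X ?A F \<phi>"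
    unfolding sheaf_hom_def
  proof (intro conjI allI impI ballI)
    fix V assume V: "openin X V"
    interpret G: comm_group "sec F V" using P(1)[OF V] .
    have carr_mult: "f \<otimes>\<^bsub>sec (int_ext_zero X W) V\<^esub> f' \<in> carrier (sec (int_ext_zero X W) V)"
      if "f \<in> carrier (sec (int_ext_zero X W) V)" "f' \<in> carrier (sec (int_ext_zero X W) V)" for f f'
      using presheaf_rules(1)[OF sheaf_presheaf[OF sheaf_int_ext_zero] V] comm_groupE(1) that by metis
    show "\<phi> V \<in> hom (sec ?A V) (sec F V)"
    proof (rule homI)
      show "\<phi> V u \<in> carrier (sec F V)" if "u \<in> carrier (sec ?A V)" for u
        using that \<phi>(1)[OF V] by auto
      fix u v assume uv: "u \<in> carrier (sec ?A V)" "v \<in> carrier (sec ?A V)"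
      obtain f where f: "f \<in> carrier (sec (int_ext_zero X W) V)" "u = e f" using uv(1) by auto
      obtain f' where f': "f' \<in> carrier (sec (int_ext_zero X W) V)" "v = e f'" using uv(2) by auto
      have "\<phi> V (e (\<lambda>x\<in>V. f x + f' x)) = \<phi> V (e f) \<otimes>\<^bsub>sec F V\<^esub> \<phi> V (e f')"
      proof (rule \<phi>_eq[OF V])
        show "(\<lambda>x\<in>V. f x + f' x) \<in> carrier (sec (int_ext_zero X W) V)"
          using carr_mult[OF f(1) f'(1)] by simp
        show "\<phi> V (e f) \<otimes>\<^bsub>sec F V\<^esub> \<phi> V (e f') \<in> carrier (sec F V)"
          using \<phi>(1)[OF V f(1)] \<phi>(1)[OF V f'(1)] by simp
        fix x assume x: "x \<in> V"
        interpret H: comm_group "sec F (nb x)" using P(1) nb_open[OF V x] .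
        have "res F V (nb x) (\<phi> V (e f) \<otimes>\<^bsub>sec F V\<^esub> \<phi> V (e f')) = germ x f \<otimes>\<^bsub>sec F (nb x)\<^esub> germ x f'"
          using hom_mult[OF P(2)[OF V nb_open[OF V x] min_nbhd_subset[OF V x]] \<phi>(1)[OF V f(1)] \<phi>(1)[OF V f'(1)]]
            \<phi>(2)[OF V f(1) x] \<phi>(2)[OF V f'(1) x] by simp
        also have "\<dots> = germ x (\<lambda>x\<in>V. f x + f' x)"
          using x resW by (simp add: germ_def H.int_pow_mult)
        finally show "res F V (nb x) (\<phi> V (e f) \<otimes>\<^bsub>sec F V\<^esub> \<phi> V (e f')) = germ x (\<lambda>x\<in>V. f x + f' x)" .
      qed
      then show "\<phi> V (u \<otimes>\<^bsub>sec ?A V\<^esub> v) = \<phi> V u \<otimes>\<^bsub>sec F V\<^esub> \<phi> V v"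
        by (simp add: f(2) f'(2) ge)
    qed
  next
    fix V V' u assume V': "openin X V \<and> openin X V' \<and> V' \<subseteq> V" and u: "u \<in> carrier (sec ?A V)"
    then obtain f where f: "f \<in> carrier (sec (int_ext_zero X W) V)" "u = e f" by auto
    have V: "openin X V" "openin X V'" "V' \<subseteq> V" using V' by auto
    have "\<phi> V' (e (restrict f V')) = res F V V' (\<phi> V (e f))"
    proof (rule \<phi>_eq[OF V(2)])
      show "restrict f V' \<in> carrier (sec (int_ext_zero X W) V')"
        using presheaf_rules(5)[OF sheaf_presheaf[OF sheaf_int_ext_zero] V f(1)] by simp
      show "res F V V' (\<phi> V (e f)) \<in> carrier (sec F V')" using P(5)[OF V \<phi>(1)[OF V(1) f(1)]] .
      fix x assume x: "x \<in> V'"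
      have "res F V' (nb x) (res F V V' (\<phi> V (e f))) = res F V (nb x) (\<phi> V (e f))"
        by (rule P(4)[OF V(1,2) nb_open[OF V(2) x] min_nbhd_subset[OF V(2) x] V(3) \<phi>(1)[OF V(1) f(1)]])
      also have "\<dots> = germ x f" using \<phi>(2)[OF V(1) f(1)] x V(3) by blast
      also have "\<dots> = germ x (restrict f V')" using x by (simp add: germ_def)
      finally show "res F V' (nb x) (res F V V' (\<phi> V (e f))) = germ x (restrict f V')" .
    qed
    then show "res F V V' (\<phi> V u) = \<phi> V' (res ?A V V' u)"
      by (simp add: f(2) ge)
  qed
  obtain \<psi> where \<psi>: "sheaf_hom X ?B F \<psi>" "\<And>V u. openin X V \<Longrightarrow> u \<in> carrier (sec ?A V) \<Longrightarrow> \<psi> V u = \<phi> V u"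
    using inj[unfolded injective_sheaf_def, THEN conjunct2, rule_format, of ?A ?B "\<lambda>V s. s" \<phi>] A B mono \<phi>_hom by blast
  let ?T = "topspace X"
  \<comment> \<open>The section 1, whose multiple of \<open>s\<close> on \<open>W\<close> is
    \<open>s\<close> itself.\<close>
  define c where "c V = (\<lambda>x\<in>V. 1 :: int)" for V :: "'p set"
  have cT: "e (c ?T) \<in> carrier (sec ?B ?T)" unfolding c_def transport_simps by (intro imageI int_ext_zeroI) auto
  have cW: "c W \<in> carrier (sec (int_ext_zero X W) W)" unfolding c_def by (intro int_ext_zeroI[OF W]) auto
  have WT: "W \<subseteq> ?T" using W openin_subset by blast
  have "res F ?T W (\<psi> ?T (e (c ?T))) = \<psi> W (res ?B ?T W (e (c ?T)))"
    using \<psi>(1) cT W WT unfolding sheaf_hom_def by blast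
  also have "res ?B ?T W (e (c ?T)) = e (c W)"
  proof -
    have "restrict (c ?T) W = c W" using WT by (auto simp: c_def fun_eq_iff)
    then show ?thesis by (simp add: ge)
  qed
  also have "\<psi> W (e (c W)) = \<phi> W (e (c W))" using cW by (intro \<psi>(2) W) auto
  also have "\<dots> = s"
  proof (rule \<phi>_eq[OF W cW s])
    fix x assume x: "x \<in> W"
    interpret comm_group "sec F (nb x)" using P(1) nb_open[OF W x] .
    show "res F W (nb x) s = germ x (c W)" using x resW by (simp add: germ_def c_def)
  qed
  finally have "res F ?T W (\<psi> ?T (e (c ?T))) = s" .
  moreover have "\<psi> ?T \<in> hom (sec ?B ?T) (sec F ?T)" using \<psi>(1) unfolding sheaf_hom_def by simp
  ultimately show ?thesis using hom_in_carrier[OF _ cT] by (intro bexI)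
qed

end

section \<open>Cohomology by means of an acyclic cover\<close>

lemma constant_sheaf_int_simps [simp]:
  "s \<otimes>\<^bsub>sec (constant_sheaf_int X) V\<^esub> t = (\<lambda>x\<in>V. s x + t x)"
  "\<one>\<^bsub>sec (constant_sheaf_int X) V\<^esub> = (\<lambda>x\<in>V. 0)"
  "res (constant_sheaf_int X) V W s = restrict s W"
  by (simp_all add: constant_sheaf_int_def)

lemma constant_sheaf_int_carrier:
  "s \<in> carrier (sec (constant_sheaf_int X) V) \<longleftrightarrow>
     s \<in> extensional V \<and> continuous_map (subtopology X V) (discrete_topology UNIV) s"
  by (simp add: constant_sheaf_int_def)

lemma const_in_constant_sheaf: "(\<lambda>x\<in>V. c) \<in> carrier (sec (constant_sheaf_int X) V)"
proof -
  have "continuous_map (subtopology X V) (discrete_topology UNIV) (\<lambda>x\<in>V. c)"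
    using continuous_map_eq[of "subtopology X V" "discrete_topology UNIV" "\<lambda>x. c" "\<lambda>x\<in>V. c"] by simp
  then show ?thesis by (simp add: constant_sheaf_int_carrier)
qed

text \<open>The fibre of \<open>s\<close> through \<open>x\<close> is an open neighbourhood of
  \<open>x\<close>, hence contains the minimal one.\<close>

lemma constant_sheaf_int_locally_constant:
  assumes "openin X V" "s \<in> carrier (sec (constant_sheaf_int X) V)" "x \<in> V" "y \<in> min_nbhd X x"
  shows "s y = s x"
proof -
  have "openin (subtopology X V) {z \<in> topspace (subtopology X V). s z \<in> {s x}}"
    using assms(2) unfolding constant_sheaf_int_carrier by (intro openin_continuous_map_preimage) auto
  then have "openin X {z \<in> topspace (subtopology X V). s z \<in> {s x}}"
    using assms(1) openin_trans_full by blast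
  moreover have "x \<in> {z \<in> topspace (subtopology X V). s z \<in> {s x}}"
    using assms(1,3) openin_subset by fastforce
  ultimately have "min_nbhd X x \<subseteq> {z \<in> topspace (subtopology X V). s z \<in> {s x}}"
    by (rule min_nbhd_subset)
  then show ?thesis using assms(4) by auto
qed

text \<open>An element of the image is locally in the image, with \<open>V\<close> itself as the
  neighbourhood.\<close>

lemma sheaf_exact_comp:
  assumes "sheaf_exact X A B C \<phi> \<psi>" "presheaf X B" "sheaf_hom X A B \<phi>" "openin X V" "s \<in> carrier (sec A V)"
  shows "\<psi> V (\<phi> V s) = \<one>\<^bsub>sec C V\<^esub>"
proof -
  have in_B: "\<phi> V s \<in> carrier (sec B V)"
    using assms(3,4,5) unfolding sheaf_hom_def by (auto intro: hom_in_carrier)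
  have "res B V V (\<phi> V s) = \<phi> V s" using presheaf_rules(3)[OF assms(2,4) in_B] .
  then have "\<exists>W. openin X W \<and> x \<in> W \<and> W \<subseteq> V \<and> (\<exists>u\<in>carrier (sec A W). \<phi> W u = res B V W (\<phi> V s))" if "x \<in> V" for x
    using that assms(4,5) by (intro exI[of _ V]) auto
  then show ?thesis
    using assms(1)[unfolded sheaf_exact_def, rule_format, OF assms(4) in_B] by simp
qed

text \<open>Inside a minimal neighbourhood of \<open>x\<close>, the only open set containing
  \<open>x\<close> is the whole neighbourhood, so a local preimage near \<open>x\<close> is already
  a preimage on all of it.\<close>

lemma sheaf_exact_min_nbhd:
  assumes "sheaf_exact X A B C \<phi> \<psi>" "presheaf X B" "openin X V" "x \<in> V" "V = min_nbhd X x"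
    and t: "t \<in> carrier (sec B V)" "\<psi> V t = \<one>\<^bsub>sec C V\<^esub>"
  shows "\<exists>s\<in>carrier (sec A V). \<phi> V s = t"
proof -
  have "\<forall>y\<in>V. \<exists>W. openin X W \<and> y \<in> W \<and> W \<subseteq> V \<and> (\<exists>s\<in>carrier (sec A W). \<phi> W s = res B V W t)"
    using assms(1)[unfolded sheaf_exact_def, rule_format, OF assms(3) t(1)] t(2) by simp
  from bspec[OF this assms(4)] obtain W
    where W: "openin X W" "x \<in> W" "W \<subseteq> V" "\<exists>s\<in>carrier (sec A W). \<phi> W s = res B V W t"
    by (elim exE conjE) (rule that)
  then have "W = V" using min_nbhd_subset[OF W(1,2)] assms(5) by simp
  then show ?thesis using W(4) presheaf_rules(3)[OF assms(2,3) t(1)] by simp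
qed

text \<open>\<open>V_min\<close> is the acyclicity of the cover: every nonempty intersection is a
  minimal neighbourhood.\<close>

locale resolution_cover = finite_space X for X :: "'p topology" +
  fixes I :: "nat \<Rightarrow> ('p, ('p, 'p \<Rightarrow> int) sheaf_universe) presheaf"
    and d :: "nat \<Rightarrow> 'p set \<Rightarrow> ('p, 'p \<Rightarrow> int) sheaf_universe \<Rightarrow> ('p, 'p \<Rightarrow> int) sheaf_universe"
    and e0 :: "'p set \<Rightarrow> ('p \<Rightarrow> int) \<Rightarrow> ('p, 'p \<Rightarrow> int) sheaf_universe"
    and V :: "nat \<Rightarrow> 'p set" and A :: "nat set"
  assumes resolution: "injective_resolution X (constant_sheaf_int X) e0 I d"
    and finite_A: "finite A" and V_open: "k \<in> A \<Longrightarrow> openin X (V k)"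
    and V_cover: "(\<Union>k\<in>A. V k) = topspace X"
    and V_min: "J \<subseteq> A \<Longrightarrow> J \<noteq> {} \<Longrightarrow> (\<Inter>k\<in>J. V k) \<noteq> {} \<Longrightarrow> \<exists>x. x \<in> (\<Inter>k\<in>J. V k) \<and> (\<Inter>k\<in>J. V k) = min_nbhd X x"
begin

abbreviation "T \<equiv> topspace X"

lemma I_sheaf: "sheaf X (I q)" and I_inj: "injective_sheaf X (I q)"
  using resolution unfolding injective_resolution_def injective_sheaf_def by blast+

lemma d_hom: "sheaf_hom X (I q) (I (Suc q)) (d q)"
  and e0_mono: "sheaf_mono X (constant_sheaf_int X) (I 0) e0"
  and exact_0: "sheaf_exact X (constant_sheaf_int X) (I 0) (I 1) e0 (d 0)"
  and exact_Suc: "sheaf_exact X (I q) (I (Suc q)) (I (Suc (Suc q))) (d q) (d (Suc q))"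
  using resolution unfolding injective_resolution_def by blast+

lemmas P = presheaf_rules[OF sheaf_presheaf[OF I_sheaf]]

lemma e0_hom: "sheaf_hom X (constant_sheaf_int X) (I 0) e0"
  using e0_mono by (simp add: sheaf_mono_def)

lemma d_hom_sec: "openin X W \<Longrightarrow> d q W \<in> hom (sec (I q) W) (sec (I (Suc q)) W)"
  using d_hom[of q] unfolding sheaf_hom_def by simp

lemma d_carrier: "openin X W \<Longrightarrow> s \<in> carrier (sec (I q) W) \<Longrightarrow> d q W s \<in> carrier (sec (I (Suc q)) W)"
  by (rule hom_in_carrier[OF d_hom_sec])

lemma d_mult: "openin X W \<Longrightarrow> s \<in> carrier (sec (I q) W) \<Longrightarrow> t \<in> carrier (sec (I q) W) \<Longrightarrow>
    d q W (s \<otimes>\<^bsub>sec (I q) W\<^esub> t) = d q W s \<otimes>\<^bsub>sec (I (Suc q)) W\<^esub> d q W t"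
  by (rule hom_mult[OF d_hom_sec])

lemma d_res: "openin X W \<Longrightarrow> openin X W' \<Longrightarrow> W' \<subseteq> W \<Longrightarrow> s \<in> carrier (sec (I q) W) \<Longrightarrow>
    res (I (Suc q)) W W' (d q W s) = d q W' (res (I q) W W' s)"
  using d_hom[of q, unfolded sheaf_hom_def, THEN conjunct2] by simp

lemma d_d: "openin X W \<Longrightarrow> s \<in> carrier (sec (I q) W) \<Longrightarrow> d (Suc q) W (d q W s) = \<one>\<^bsub>sec (I (Suc (Suc q))) W\<^esub>"
  by (rule sheaf_exact_comp[OF exact_Suc sheaf_presheaf[OF I_sheaf] d_hom])

text \<open>Moves the sections of \<open>I q\<close> on \<open>W\<close> into a class type. The
  encoding depends on \<open>q\<close> and \<open>W\<close>, as does the group operation, so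
  \<open>r\<close> and \<open>D\<close> below are the restriction and the differential conjugated by
  it.\<close>

definition enc :: "nat \<Rightarrow> 'p set \<Rightarrow> ('p, 'p \<Rightarrow> int) sheaf_universe \<Rightarrow> (('p, 'p \<Rightarrow> int) sheaf_universe \<Rightarrow> ratmod) \<Rightarrow> ratmod" where
  "enc q W = double_dual (sec (I q) W)"

definition dec :: "nat \<Rightarrow> 'p set \<Rightarrow> ((('p, 'p \<Rightarrow> int) sheaf_universe \<Rightarrow> ratmod) \<Rightarrow> ratmod) \<Rightarrow> ('p, 'p \<Rightarrow> int) sheaf_universe" where
  "dec q W = inv_into (carrier (sec (I q) W)) (enc q W)"

definition S :: "nat \<Rightarrow> 'p set \<Rightarrow> ((('p, 'p \<Rightarrow> int) sheaf_universe \<Rightarrow> ratmod) \<Rightarrow> ratmod) set" where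
  "S q W = enc q W ` carrier (sec (I q) W)"

definition r where
  "r q W W' g = enc q W' (res (I q) W W' (dec q W g))"

definition D where
  "D q W g = enc (Suc q) W (d q W (dec q W g))"

definition \<epsilon> where
  "\<epsilon> W c = enc 0 W (e0 W (\<lambda>x\<in>W. c))"

lemma enc_mult: "s \<in> carrier (sec (I q) W) \<Longrightarrow> t \<in> carrier (sec (I q) W) \<Longrightarrow>
    enc q W (s \<otimes>\<^bsub>sec (I q) W\<^esub> t) = enc q W s + enc q W t"
  by (simp add: enc_def double_dual_mult)

lemma enc_one: "openin X W \<Longrightarrow> enc q W \<one>\<^bsub>sec (I q) W\<^esub> = 0"
  using P(1)[of W q] by (simp add: enc_def double_dual_one comm_group_def)

lemma enc_inv: "openin X W \<Longrightarrow> s \<in> carrier (sec (I q) W) \<Longrightarrow> enc q W (inv\<^bsub>sec (I q) W\<^esub> s) = - enc q W s"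
  using P(1)[of W q] by (simp add: enc_def double_dual_inv comm_group_def)

lemma enc_inj: "openin X W \<Longrightarrow> inj_on (enc q W) (carrier (sec (I q) W))"
  unfolding enc_def by (rule inj_on_double_dual[OF P(1)])

lemma enc_eq: "openin X W \<Longrightarrow> s \<in> carrier (sec (I q) W) \<Longrightarrow> t \<in> carrier (sec (I q) W) \<Longrightarrow>
    enc q W s = enc q W t \<longleftrightarrow> s = t"
  by (rule inj_on_eq_iff[OF enc_inj])

lemma dec_enc [simp]: "openin X W \<Longrightarrow> s \<in> carrier (sec (I q) W) \<Longrightarrow> dec q W (enc q W s) = s"
  unfolding dec_def by (rule inv_into_f_f[OF enc_inj])

lemma r_enc: "openin X W \<Longrightarrow> s \<in> carrier (sec (I q) W) \<Longrightarrow> r q W W' (enc q W s) = enc q W' (res (I q) W W' s)"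
  by (simp add: r_def)

lemma D_enc: "openin X W \<Longrightarrow> s \<in> carrier (sec (I q) W) \<Longrightarrow> D q W (enc q W s) = enc (Suc q) W (d q W s)"
  by (simp add: D_def)

lemma S_E: "g \<in> S q W \<Longrightarrow> (\<And>s. s \<in> carrier (sec (I q) W) \<Longrightarrow> g = enc q W s \<Longrightarrow> R) \<Longrightarrow> R"
  by (auto simp: S_def)

lemma S_I: "s \<in> carrier (sec (I q) W) \<Longrightarrow> enc q W s \<in> S q W"
  by (simp add: S_def)

text \<open>The essential point is \<open>glue_extend\<close>: sections glue on the union, the
  result extends to \<open>T\<close> because injective sheaves are flabby, and is then restricted to
  \<open>W\<close>.\<close>

lemma flabby_cover_S: "flabby_cover (openin X) (S q) (r q) V A"
proof
  fix W W' W'' :: "'p set" and g h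
  assume W: "openin X W"
  interpret G: comm_group "sec (I q) W" by (rule P(1)[OF W])
  show "openin X W' \<Longrightarrow> openin X (W \<inter> W')" using W by blast
  show "0 \<in> S q W" using S_I[OF G.one_closed] enc_one[OF W] by simp
  show "g + h \<in> S q W" if "g \<in> S q W" "h \<in> S q W"
  proof -
    obtain s t where "s \<in> carrier (sec (I q) W)" "g = enc q W s" "t \<in> carrier (sec (I q) W)" "h = enc q W t"
      using \<open>g \<in> S q W\<close> \<open>h \<in> S q W\<close> by (elim S_E)
    then show ?thesis using S_I[OF G.m_closed] by (simp add: enc_mult[symmetric])
  qed
  show "- g \<in> S q W" if g: "g \<in> S q W"
  proof -
    obtain s where "s \<in> carrier (sec (I q) W)" "g = enc q W s" using g by (rule S_E)
    then show ?thesis using S_I[OF G.inv_closed] by (simp add: enc_inv[OF W, symmetric])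
  qed
  show "r q W W' g \<in> S q W'" if W': "openin X W'" "W' \<subseteq> W" and g: "g \<in> S q W"
  proof -
    obtain s where "s \<in> carrier (sec (I q) W)" "g = enc q W s" using g by (rule S_E)
    then show ?thesis using S_I[OF P(5)[OF W W']] by (simp add: r_enc[OF W])
  qed
  show "r q W W' (g + h) = r q W W' g + r q W W' h"
    if W': "openin X W'" "W' \<subseteq> W" and gh: "g \<in> S q W" "h \<in> S q W"
  proof -
    obtain s where s: "s \<in> carrier (sec (I q) W)" "g = enc q W s" using gh(1) by (rule S_E)
    obtain t where t: "t \<in> carrier (sec (I q) W)" "h = enc q W t" using gh(2) by (rule S_E)
    have "r q W W' (enc q W (s \<otimes>\<^bsub>sec (I q) W\<^esub> t)) = enc q W' (res (I q) W W' s \<otimes>\<^bsub>sec (I q) W'\<^esub> res (I q) W W' t)"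
      using r_enc[OF W G.m_closed[OF s(1) t(1)]] hom_mult[OF P(2)[OF W W'] s(1) t(1)] by simp
    then show ?thesis
      using s t P(5)[OF W W'] by (simp add: enc_mult r_enc[OF W])
  qed
  show "r q W' W'' (r q W W' g) = r q W W'' g"
    if o: "openin X W'" "openin X W''" "W'' \<subseteq> W'" "W' \<subseteq> W" and g: "g \<in> S q W"
  proof -
    obtain s where s: "s \<in> carrier (sec (I q) W)" "g = enc q W s" using g by (rule S_E)
    show ?thesis
      using r_enc[OF o(1) P(5)[OF W o(1,4) s(1)]] P(4)[OF W o s(1)] by (simp add: s(2) r_enc[OF W s(1)])
  qed
  fix B :: "nat set" and U :: "nat \<Rightarrow> 'p set" and f
  assume U: "\<And>k. k \<in> B \<Longrightarrow> openin X (U k) \<and> U k \<subseteq> W \<and> f k \<in> S q (U k)"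
    and agree: "\<And>k l. k \<in> B \<Longrightarrow> l \<in> B \<Longrightarrow> r q (U k) (U k \<inter> U l) (f k) = r q (U l) (U k \<inter> U l) (f l)"
  define s where "s k = dec q (U k) (f k)" for k
  have Uo: "openin X (U k)" and UW: "U k \<subseteq> W" if "k \<in> B" for k using U that by blast+
  have s: "s k \<in> carrier (sec (I q) (U k)) \<and> f k = enc q (U k) (s k)" if k: "k \<in> B" for k
  proof -
    have "f k \<in> S q (U k)" using U k by blast
    then show ?thesis unfolding s_def by (rule S_E) (simp add: Uo[OF k])
  qed
  have "\<exists>!t. t \<in> carrier (sec (I q) (\<Union>k\<in>B. U k)) \<and> (\<forall>k\<in>B. res (I q) (\<Union>k\<in>B. U k) (U k) t = s k)"
  proof (rule sheaf_glue[OF I_sheaf])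
    fix k l assume kl: "k \<in> B" "l \<in> B"
    have o: "openin X (U k \<inter> U l)" using Uo kl by blast
    have "enc q (U k \<inter> U l) (res (I q) (U k) (U k \<inter> U l) (s k)) = enc q (U k \<inter> U l) (res (I q) (U l) (U k \<inter> U l) (s l))"
      using agree[OF kl] r_enc[OF Uo[OF kl(1)] s[OF kl(1), THEN conjunct1]] r_enc[OF Uo[OF kl(2)] s[OF kl(2), THEN conjunct1]]
        s[OF kl(1)] s[OF kl(2)] by simp
    then show "res (I q) (U k) (U k \<inter> U l) (s k) = res (I q) (U l) (U k \<inter> U l) (s l)"
      using P(5)[OF Uo[OF kl(1)] o _ s[OF kl(1), THEN conjunct1]] P(5)[OF Uo[OF kl(2)] o _ s[OF kl(2), THEN conjunct1]]
      by (simp add: enc_eq[OF o])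
  qed (use s Uo in auto)
  then obtain t where t: "t \<in> carrier (sec (I q) (\<Union>k\<in>B. U k))" "\<And>k. k \<in> B \<Longrightarrow> res (I q) (\<Union>k\<in>B. U k) (U k) t = s k"
    by (elim ex1E) auto
  have Bo: "openin X (\<Union>k\<in>B. U k)" using Uo by blast
  have BW: "(\<Union>k\<in>B. U k) \<subseteq> W" using UW by blast
  have WT: "W \<subseteq> T" using W openin_subset by blast
  obtain u where u: "u \<in> carrier (sec (I q) T)" "res (I q) T (\<Union>k\<in>B. U k) u = t"
    using injective_sheaf_flabby[OF I_inj Bo t(1)] by blast
  define v where "v = res (I q) T W u"
  have v: "v \<in> carrier (sec (I q) W)" unfolding v_def by (rule P(5)[OF openin_topspace W WT u(1)])
  have "res (I q) W (U k) v = s k" if k: "k \<in> B" for k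
  proof -
    have kU: "U k \<subseteq> (\<Union>k\<in>B. U k)" using k by blast
    have "res (I q) W (U k) v = res (I q) T (U k) u"
      unfolding v_def by (rule P(4)[OF openin_topspace W Uo[OF k] UW[OF k] WT u(1)])
    also have "\<dots> = res (I q) (\<Union>k\<in>B. U k) (U k) (res (I q) T (\<Union>k\<in>B. U k) u)"
      using P(4)[OF openin_topspace Bo Uo[OF k] kU _ u(1)] BW WT by simp
    finally show ?thesis using u(2) t(2)[OF k] by simp
  qed
  then show "\<exists>t\<in>S q W. \<forall>k\<in>B. r q W (U k) t = f k"
    using s v by (intro bexI[of _ "enc q W v"] ballI S_I) (simp_all add: r_enc[OF W])
next
  show "finite A" by (rule finite_A)
  show "k \<in> A \<Longrightarrow> openin X (V k)" for k by (rule V_open)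
qed

lemma VX_eq: "J \<subseteq> A \<Longrightarrow> J \<noteq> {} \<Longrightarrow> cover_Int V T J = (\<Inter>k\<in>J. V k)"
  using V_open openin_subset by (fastforce simp: cover_Int_def)

lemma op_VX: "J \<subseteq> A \<Longrightarrow> openin X (cover_Int V T J)"
  using flabby_cover.op_VJ[OF flabby_cover_S openin_topspace] .

lemma S_empty: "S q {} = {0}"
  using sheaf_empty[OF I_sheaf, of q] enc_one[of "{}" q] by (simp add: S_def)

lemma e0_hom_sec: "openin X W \<Longrightarrow> e0 W \<in> hom (sec (constant_sheaf_int X) W) (sec (I 0) W)"
  using e0_hom unfolding sheaf_hom_def by simp

lemma e0_carrier: "openin X W \<Longrightarrow> e0 W (\<lambda>x\<in>W. c) \<in> carrier (sec (I 0) W)"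
  by (rule hom_in_carrier[OF e0_hom_sec const_in_constant_sheaf])

text \<open>Exactness on the intersections comes from \<open>sheaf_exact_min_nbhd\<close>,
  separation from the fact that the sets of the cover exhaust the space.\<close>

lemma resolved_cover_S: "resolved_cover (openin X) S r D \<epsilon> V A T"
proof (rule resolved_cover.intro)
  show "flabby_cover (openin X) (S q) (r q) V A" for q by (rule flabby_cover_S)
  show "openin X T" by simp
  fix W W' :: "'p set" and q g h
  show "D q W g \<in> S (Suc q) W" if W: "openin X W" and g: "g \<in> S q W"
    using g by (rule S_E) (simp add: D_enc[OF W] S_I d_carrier[OF W])
  show "D q W (g + h) = D q W g + D q W h" if W: "openin X W" and g: "g \<in> S q W" and h: "h \<in> S q W"
  proof -
    interpret G: comm_group "sec (I q) W" by (rule P(1)[OF W])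
    obtain s where s: "s \<in> carrier (sec (I q) W)" "g = enc q W s" using g by (rule S_E)
    obtain t where t: "t \<in> carrier (sec (I q) W)" "h = enc q W t" using h by (rule S_E)
    have "D q W (enc q W (s \<otimes>\<^bsub>sec (I q) W\<^esub> t)) = enc (Suc q) W (d q W s) + enc (Suc q) W (d q W t)"
      using D_enc[OF W G.m_closed[OF s(1) t(1)]] d_mult[OF W s(1) t(1)] d_carrier[OF W] s(1) t(1)
      by (simp add: enc_mult)
    then show ?thesis using s t by (simp add: enc_mult D_enc[OF W])
  qed
  show "r (Suc q) W W' (D q W g) = D q W' (r q W W' g)"
    if W: "openin X W" "openin X W'" "W' \<subseteq> W" and g: "g \<in> S q W"
    using g by (rule S_E) (simp add: D_enc W r_enc d_carrier P(5)[OF W] d_res[OF W])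
  show "D (Suc q) W (D q W g) = 0" if W: "openin X W" and g: "g \<in> S q W"
    using g by (rule S_E) (simp add: D_enc W d_carrier d_d enc_one)
  show "g = 0" if g: "g \<in> S q T" and z: "\<And>k. k \<in> A \<Longrightarrow> r q T (T \<inter> V k) g = 0"
  proof -
    obtain s where s: "s \<in> carrier (sec (I q) T)" "g = enc q T s" using g by (rule S_E)
    interpret G: comm_group "sec (I q) T" by (rule P(1)[OF openin_topspace])
    have "s = \<one>\<^bsub>sec (I q) T\<^esub>"
    proof (rule sheaf_separated[OF I_sheaf openin_topspace s(1) G.one_closed])
      fix x assume "x \<in> T"
      then obtain k where k: "k \<in> A" "x \<in> V k" using V_cover by blast
      have VT: "V k \<subseteq> T" using V_open[OF k(1)] openin_subset by blast
      then have TV: "T \<inter> V k = V k" by blast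
      note o = openin_topspace V_open[OF k(1)] VT
      have "enc q (V k) (res (I q) T (V k) s) = enc q (V k) \<one>\<^bsub>sec (I q) (V k)\<^esub>"
        using z[OF k(1)] TV s by (simp add: r_enc enc_one[OF o(2)])
      then have "res (I q) T (V k) s = \<one>\<^bsub>sec (I q) (V k)\<^esub>"
        using enc_eq[OF o(2)] P(5)[OF o s(1)] comm_groupE(2)[OF P(1)[OF o(2)]] by simp
      then show "\<exists>W. openin X W \<and> x \<in> W \<and> W \<subseteq> T \<and> res (I q) T W s = res (I q) T W \<one>\<^bsub>sec (I q) T\<^esub>"
        using k(2) o presheaf_res_one[OF sheaf_presheaf[OF I_sheaf] o] by (intro exI[of _ "V k"]) simp
    qed
    then show ?thesis using s(2) enc_one by simp
  qed
  show "S q {} = {0}" by (rule S_empty)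
  fix J J' :: "nat set"
  show "\<exists>t\<in>S q (cover_Int V T J). D q (cover_Int V T J) t = g"
    if J: "J \<subseteq> A" "J \<noteq> {}" and g: "g \<in> S (Suc q) (cover_Int V T J)" "D (Suc q) (cover_Int V T J) g = 0"
  proof -
    let ?W = "cover_Int V T J"
    note W = op_VX[OF J(1)]
    obtain s where s: "s \<in> carrier (sec (I (Suc q)) ?W)" "g = enc (Suc q) ?W s" using g(1) by (rule S_E)
    show ?thesis
    proof (cases "?W = {}")
      \<comment> \<open>\<open>V_min\<close> says nothing about an empty intersection, but there all
        groups are zero.\<close>
      case True
      interpret G: comm_group "sec (I q) ?W" by (rule P(1)[OF W])
      have "D q ?W (enc q ?W \<one>\<^bsub>sec (I q) ?W\<^esub>) \<in> S (Suc q) ?W"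
        using D_enc[OF W G.one_closed] S_I d_carrier[OF W G.one_closed] by simp
      then have "D q ?W (enc q ?W \<one>\<^bsub>sec (I q) ?W\<^esub>) = g" using g(1) True S_empty by simp
      then show ?thesis using S_I[OF G.one_closed] by (rule bexI)
    next
      case False
      then obtain x where x: "x \<in> ?W" "?W = min_nbhd X x" using V_min[OF J] VX_eq[OF J] by auto
      have "enc (Suc (Suc q)) ?W (d (Suc q) ?W s) = enc (Suc (Suc q)) ?W \<one>\<^bsub>sec (I (Suc (Suc q))) ?W\<^esub>"
        using g(2) s D_enc[OF W s(1)] enc_one[OF W] by simp
      then have "d (Suc q) ?W s = \<one>\<^bsub>sec (I (Suc (Suc q))) ?W\<^esub>"
        using enc_eq[OF W] d_carrier[OF W s(1)] comm_groupE(2)[OF P(1)[OF W]] by simp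
      then have "\<exists>t\<in>carrier (sec (I q) ?W). d q ?W t = s"
        by (rule sheaf_exact_min_nbhd[OF exact_Suc[of q] sheaf_presheaf[OF I_sheaf] W x s(1)])
      then obtain t where "t \<in> carrier (sec (I q) ?W)" "d q ?W t = s" by (elim bexE)
      then show ?thesis using s(2) S_I D_enc[OF W] by (intro bexI[of _ "enc q ?W t"]) simp_all
    qed
  qed
  show "\<epsilon> (cover_Int V T J) (a + b) = \<epsilon> (cover_Int V T J) a + \<epsilon> (cover_Int V T J) b"
    if J: "J \<subseteq> A" for a b
  proof -
    let ?W = "cover_Int V T J"
    note W = op_VX[OF J]
    have "e0 ?W ((\<lambda>x\<in>?W. a) \<otimes>\<^bsub>sec (constant_sheaf_int X) ?W\<^esub> (\<lambda>x\<in>?W. b)) =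
        e0 ?W (\<lambda>x\<in>?W. a) \<otimes>\<^bsub>sec (I 0) ?W\<^esub> e0 ?W (\<lambda>x\<in>?W. b)"
      by (rule hom_mult[OF e0_hom_sec[OF W] const_in_constant_sheaf const_in_constant_sheaf])
    moreover have "(\<lambda>x\<in>?W. a) \<otimes>\<^bsub>sec (constant_sheaf_int X) ?W\<^esub> (\<lambda>x\<in>?W. b) = (\<lambda>x\<in>?W. a + b)"
      by (auto simp: fun_eq_iff)
    ultimately show ?thesis using enc_mult[OF e0_carrier[OF W] e0_carrier[OF W]] by (simp add: \<epsilon>_def)
  qed
  show "a = 0" if J: "J \<subseteq> A" "cover_Int V T J \<noteq> {}" and a: "\<epsilon> (cover_Int V T J) a = 0" for a
  proof -
    let ?W = "cover_Int V T J"
    note W = op_VX[OF J(1)]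
    have "e0 ?W ((\<lambda>x\<in>?W. 0) \<otimes>\<^bsub>sec (constant_sheaf_int X) ?W\<^esub> (\<lambda>x\<in>?W. 0)) =
        e0 ?W (\<lambda>x\<in>?W. 0) \<otimes>\<^bsub>sec (I 0) ?W\<^esub> e0 ?W (\<lambda>x\<in>?W. 0)"
      by (rule hom_mult[OF e0_hom_sec[OF W] const_in_constant_sheaf const_in_constant_sheaf])
    moreover have "(\<lambda>x\<in>?W. 0) \<otimes>\<^bsub>sec (constant_sheaf_int X) ?W\<^esub> (\<lambda>x\<in>?W. 0) = (\<lambda>x\<in>?W. 0)"
      by (auto simp: fun_eq_iff)
    ultimately have "\<epsilon> ?W 0 + \<epsilon> ?W 0 = \<epsilon> ?W 0"
      using enc_mult[OF e0_carrier[OF W] e0_carrier[OF W], of 0 0] by (simp add: \<epsilon>_def)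
    then have "\<epsilon> ?W 0 = 0" by (metis add_cancel_right_right)
    then have "enc 0 ?W (e0 ?W (\<lambda>x\<in>?W. a)) = enc 0 ?W (e0 ?W (\<lambda>x\<in>?W. 0))"
      using a by (simp add: \<epsilon>_def)
    then have "e0 ?W (\<lambda>x\<in>?W. a) = e0 ?W (\<lambda>x\<in>?W. 0)"
      by (simp only: enc_eq[OF W e0_carrier[OF W] e0_carrier[OF W]])
    moreover have "inj_on (e0 ?W) (carrier (sec (constant_sheaf_int X) ?W))"
      using e0_mono W unfolding sheaf_mono_def by simp
    ultimately have "(\<lambda>x\<in>?W. a) = (\<lambda>x\<in>?W. 0)"
      using const_in_constant_sheaf by (intro inj_onD[of "e0 ?W"])
    moreover obtain x where "x \<in> ?W" using J(2) by blast
    ultimately show ?thesis by (metis restrict_apply')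
  qed
  show "(g \<in> S 0 (cover_Int V T J) \<and> D 0 (cover_Int V T J) g = 0) \<longleftrightarrow> g \<in> range (\<epsilon> (cover_Int V T J))"
    if J: "J \<subseteq> A" "J \<noteq> {}" "cover_Int V T J \<noteq> {}"
  proof -
    let ?W = "cover_Int V T J"
    note W = op_VX[OF J(1)]
    have d_one: "D 0 ?W (enc 0 ?W s) = 0 \<longleftrightarrow> d 0 ?W s = \<one>\<^bsub>sec (I 1) ?W\<^esub>" if s: "s \<in> carrier (sec (I 0) ?W)" for s
    proof -
      have "D 0 ?W (enc 0 ?W s) = 0 \<longleftrightarrow> enc 1 ?W (d 0 ?W s) = enc 1 ?W \<one>\<^bsub>sec (I 1) ?W\<^esub>"
        using D_enc[OF W s] enc_one[OF W, of 1] by simp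
      then show ?thesis using enc_eq[OF W] d_carrier[OF W s] comm_groupE(2)[OF P(1)[OF W]] by simp
    qed
    obtain x where x: "x \<in> ?W" "?W = min_nbhd X x" using V_min[OF J(1,2)] VX_eq[OF J(1,2)] J(3) by auto
    show ?thesis
    proof
      assume g: "g \<in> S 0 ?W \<and> D 0 ?W g = 0"
      then obtain s where s: "s \<in> carrier (sec (I 0) ?W)" "g = enc 0 ?W s" by (elim conjE S_E)
      then have "d 0 ?W s = \<one>\<^bsub>sec (I 1) ?W\<^esub>" using g d_one by simp
      then have "\<exists>u\<in>carrier (sec (constant_sheaf_int X) ?W). e0 ?W u = s"
        by (rule sheaf_exact_min_nbhd[OF exact_0 sheaf_presheaf[OF I_sheaf] W x s(1)])
      then obtain u where u: "u \<in> carrier (sec (constant_sheaf_int X) ?W)" "e0 ?W u = s" by (elim bexE)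
      \<comment> \<open>\<open>u\<close> is locally constant and its domain is the minimal
        neighbourhood of \<open>x\<close>, so it is the constant \<open>u x\<close>; this is where
        constants describe the kernel.\<close>
      have "u y = u x" if "y \<in> ?W" for y
        by (rule constant_sheaf_int_locally_constant[OF W u(1) x(1)]) (use that x(2) in blast)
      then have "u = (\<lambda>y\<in>?W. u x)"
        using u(1) by (auto simp: constant_sheaf_int_carrier extensional_def fun_eq_iff)
      then have "g = \<epsilon> ?W (u x)" using u(2) s(2) by (simp add: \<epsilon>_def)
      then show "g \<in> range (\<epsilon> ?W)" by simp
    next
      assume "g \<in> range (\<epsilon> ?W)"
      then obtain c where c: "g = \<epsilon> ?W c" by blast
      have "d 0 ?W (e0 ?W (\<lambda>x\<in>?W. c)) = \<one>\<^bsub>sec (I 1) ?W\<^esub>"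
        by (rule sheaf_exact_comp[OF exact_0 sheaf_presheaf[OF I_sheaf] e0_hom W const_in_constant_sheaf])
      then show "g \<in> S 0 ?W \<and> D 0 ?W g = 0"
        using c S_I[OF e0_carrier[OF W]] d_one[OF e0_carrier[OF W]] by (simp add: \<epsilon>_def)
    qed
  qed
  show "r 0 (cover_Int V T J) (cover_Int V T J') (\<epsilon> (cover_Int V T J) a) = \<epsilon> (cover_Int V T J') a"
    if J: "J \<subseteq> J'" "J' \<subseteq> A" for a
  proof -
    have JA: "J \<subseteq> A" using J by blast
    let ?W = "cover_Int V T J" and ?W' = "cover_Int V T J'"
    note W = op_VX[OF JA] and W' = op_VX[OF J(2)]
    have sub: "?W' \<subseteq> ?W" using J(1) by (auto simp: cover_Int_def)
    have "res (I 0) ?W ?W' (e0 ?W (\<lambda>x\<in>?W. a)) = e0 ?W' (res (constant_sheaf_int X) ?W ?W' (\<lambda>x\<in>?W. a))"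
      by (rule e0_hom[unfolded sheaf_hom_def, THEN conjunct2, rule_format])
        (use W W' sub const_in_constant_sheaf in auto)
    also have "res (constant_sheaf_int X) ?W ?W' (\<lambda>x\<in>?W. a) = (\<lambda>x\<in>?W'. a)"
      using sub by (auto simp: fun_eq_iff)
    finally have eq: "res (I 0) ?W ?W' (e0 ?W (\<lambda>x\<in>?W. a)) = e0 ?W' (\<lambda>x\<in>?W'. a)" .
    show ?thesis unfolding \<epsilon>_def r_enc[OF W e0_carrier[OF W]] eq ..
  qed
qed

lemma simplices_nerve: "simplices (nerve A V) p = {J. J \<subseteq> A \<and> card J = Suc p \<and> cover_Int V T J \<noteq> {}}"
proof -
  have "J \<in> simplices (nerve A V) p \<longleftrightarrow> J \<subseteq> A \<and> card J = Suc p \<and> cover_Int V T J \<noteq> {}" for J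
  proof (cases "J \<subseteq> A \<and> card J = Suc p")
    case True
    then have J: "J \<noteq> {}" "finite J" "J \<subseteq> A" using card_ge_0_finite[of J] by auto
    then show ?thesis using True unfolding VX_eq[OF J(3,1)] simplices_def nerve_def by blast
  next
    case False
    then show ?thesis unfolding simplices_def nerve_def by fastforce
  qed
  then show ?thesis by blast
qed

theorem cohomology_nerve:
  shows "group (cohomology (\<lambda>n. sec (I n) T) (\<lambda>n. d n T) i)"
    and "cohomology (\<lambda>n. sec (I n) T) (\<lambda>n. d n T) i \<cong> simplicial_cohomology (nerve A V) i"
proof -
  interpret R: resolved_cover "openin X" S r D \<epsilon> V A T by (rule resolved_cover_S)
  have C: "cochain_complex (\<lambda>n. sec (I n) T) (\<lambda>n. d n T)"
    unfolding cochain_complex_def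
    using P(1)[OF openin_topspace] d_d[OF openin_topspace] d_hom by (simp add: sheaf_hom_def)
  have nerve: "J' \<in> nerve A V" if "J \<in> nerve A V" "J' \<subseteq> J" for J J'
  proof -
    have "(\<Inter>k\<in>J. V k) \<subseteq> (\<Inter>k\<in>J'. V k)" using that(2) by (rule INF_superset_mono) simp
    then show ?thesis using that unfolding nerve_def by blast
  qed
  have *: "S q T = enc q T ` carrier (sec (I q) T)" "inj_on (enc q T) (carrier (sec (I q) T))" for q
    by (simp_all add: S_def enc_inj)
  note iso = R.cohomology_iso[OF C, where m = "\<lambda>q. enc q T" and L = "nerve A V" and i = i]
  have m: "enc q T (a \<otimes>\<^bsub>sec (I q) T\<^esub> b) = enc q T a + enc q T b"
    if "a \<in> carrier (sec (I q) T)" "b \<in> carrier (sec (I q) T)" for q a b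
    using that by (rule enc_mult)
  have m': "enc (Suc q) T (d q T a) = D q T (enc q T a)" if "a \<in> carrier (sec (I q) T)" for q a
    using that by (simp add: D_enc)
  have L: "simplices (nerve A V) p = R.N p" for p by (simp add: simplices_nerve R.N_def)
  show "group (cohomology (\<lambda>n. sec (I n) T) (\<lambda>n. d n T) i)"
    by (rule iso(1)[OF * m m' nerve L])
  show "cohomology (\<lambda>n. sec (I n) T) (\<lambda>n. d n T) i \<cong> simplicial_cohomology (nerve A V) i"
    by (rule iso(2)[OF * m m' nerve L])
qed

end

section \<open>Products of skyscraper sheaves\<close>

lemma sheaf_hom_rules:
  assumes "sheaf_hom X A B \<phi>"
  shows "openin X V \<Longrightarrow> \<phi> V \<in> hom (sec A V) (sec B V)"
    and "openin X V \<Longrightarrow> openin X W \<Longrightarrow> W \<subseteq> V \<Longrightarrow> s \<in> carrier (sec A V) \<Longrightarrow>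
      res B V W (\<phi> V s) = \<phi> W (res A V W s)"
  using assms[unfolded sheaf_hom_def, THEN conjunct1] assms[unfolded sheaf_hom_def, THEN conjunct2]
  by simp_all

text \<open>The product over all \<open>l\<close> of the skyscraper sheaves at \<open>h l\<close> with stalk \<open>D l\<close>.\<close>

definition skyscraper :: "('l \<Rightarrow> 'p) \<Rightarrow> ('l \<Rightarrow> 'c::ab_group_add set) \<Rightarrow> ('p, 'l \<Rightarrow> 'c) presheaf" where
  "skyscraper h D =
    \<lparr>sec = (\<lambda>V. additive_group {f. \<forall>l. f l \<in> D l \<and> (h l \<notin> V \<longrightarrow> f l = 0)}),
     res = (\<lambda>V W f l. if h l \<in> W then f l else 0)\<rparr>"

lemma skyscraper_simps [simp]:
  "f \<in> carrier (sec (skyscraper h D) V) \<longleftrightarrow> (\<forall>l. f l \<in> D l \<and> (h l \<notin> V \<longrightarrow> f l = 0))"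
  "f \<otimes>\<^bsub>sec (skyscraper h D) V\<^esub> g = f + g"
  "\<one>\<^bsub>sec (skyscraper h D) V\<^esub> = 0"
  "res (skyscraper h D) V W f = (\<lambda>l. if h l \<in> W then f l else 0)"
  by (simp_all add: skyscraper_def)

text \<open>Everything is coordinatewise: the coordinate \<open>l\<close> can be nonzero exactly on
  open sets that contain \<open>h l\<close>.\<close>

lemma sheaf_skyscraper:
  assumes D: "\<And>l. comm_group (additive_group (D l))"
  shows "sheaf X (skyscraper h D)"
proof -
  have zero: "0 \<in> D l" and add: "a \<in> D l \<Longrightarrow> b \<in> D l \<Longrightarrow> a + b \<in> D l" and uminus: "a \<in> D l \<Longrightarrow> - a \<in> D l" for l a b
  proof -
    interpret comm_group "additive_group (D l)" by (rule D)
    show "0 \<in> D l" using one_closed by simp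
    show "a \<in> D l \<Longrightarrow> b \<in> D l \<Longrightarrow> a + b \<in> D l" using m_closed[of a b] by simp
    show "- a \<in> D l" if a: "a \<in> D l"
    proof -
      obtain b where "b \<in> D l" "b + a = 0" using l_inv_ex[of a] a by auto
      then show ?thesis by (metis eq_neg_iff_add_eq_0)
    qed
  qed
  show ?thesis
    unfolding sheaf_def presheaf_def
  proof (intro conjI allI impI ballI)
    fix V
    show "comm_group (sec (skyscraper h D) V)"
      unfolding skyscraper_def presheaf.simps
      by (rule comm_group_additive_group) (auto simp: zero add uminus)
  next
    fix V f assume "f \<in> carrier (sec (skyscraper h D) V)"
    then show "res (skyscraper h D) V V f = f" by (auto simp: fun_eq_iff)
  next
    fix V W assume "openin X V \<and> openin X W \<and> W \<subseteq> V"
    then show "res (skyscraper h D) V W \<in> hom (sec (skyscraper h D) V) (sec (skyscraper h D) W)"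
      using zero by (intro homI) (auto simp: fun_eq_iff)
  next
    fix V W W' f assume "openin X V \<and> openin X W \<and> openin X W' \<and> W' \<subseteq> W \<and> W \<subseteq> V"
    then show "res (skyscraper h D) W W' (res (skyscraper h D) V W f) = res (skyscraper h D) V W' f"
      by (auto simp: fun_eq_iff)
  next
    fix \<W> s
    assume s': "(\<forall>W\<in>\<W>. openin X W \<and> s W \<in> carrier (sec (skyscraper h D) W)) \<and>
      (\<forall>W\<in>\<W>. \<forall>W'\<in>\<W>. res (skyscraper h D) W (W \<inter> W') (s W) = res (skyscraper h D) W' (W \<inter> W') (s W'))"
    have s: "s W l \<in> D l" "h l \<notin> W \<Longrightarrow> s W l = 0" if "W \<in> \<W>" for W l
      using s'[THEN conjunct1] that by auto
    have agree: "s W l = s W' l" if "W \<in> \<W>" "W' \<in> \<W>" "h l \<in> W" "h l \<in> W'" for W W' l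
    proof -
      have "res (skyscraper h D) W (W \<inter> W') (s W) = res (skyscraper h D) W' (W \<inter> W') (s W')"
        using s'[THEN conjunct2] that by blast
      from fun_cong[OF this, of l] show ?thesis using that by simp
    qed
    define c where "c l = (SOME W. W \<in> \<W> \<and> h l \<in> W)" for l
    have c: "c l \<in> \<W> \<and> h l \<in> c l" if "h l \<in> \<Union>\<W>" for l
      unfolding c_def by (rule someI_ex) (use that in blast)
    define t where "t l = (if h l \<in> \<Union>\<W> then s (c l) l else 0)" for l
    have t_eq: "t l = s W l" if "W \<in> \<W>" "h l \<in> W" for W l
    proof -
      have "h l \<in> \<Union>\<W>" using that by blast
      then show ?thesis using agree[of "c l" W l] c that unfolding t_def by simp
    qed
    show "\<exists>!t. t \<in> carrier (sec (skyscraper h D) (\<Union>\<W>)) \<and> (\<forall>W\<in>\<W>. res (skyscraper h D) (\<Union>\<W>) W t = s W)"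
    proof (rule ex1I[of _ t])
      have "t l \<in> D l" for l using c[of l] s(1)[of "c l" l] zero by (simp add: t_def)
      moreover have "t l = 0" if "h l \<notin> \<Union>\<W>" for l using that by (simp add: t_def)
      moreover have "(\<lambda>l. if h l \<in> W then t l else 0) = s W" if "W \<in> \<W>" for W
        using t_eq[OF that] s(2)[OF that] by (auto simp: fun_eq_iff)
      ultimately show "t \<in> carrier (sec (skyscraper h D) (\<Union>\<W>)) \<and> (\<forall>W\<in>\<W>. res (skyscraper h D) (\<Union>\<W>) W t = s W)"
        by simp
      fix u assume u: "u \<in> carrier (sec (skyscraper h D) (\<Union>\<W>)) \<and> (\<forall>W\<in>\<W>. res (skyscraper h D) (\<Union>\<W>) W u = s W)"
      show "u = t"
      proof
        fix l
        show "u l = t l"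
        proof (cases "h l \<in> \<Union>\<W>")
          case True
          then have W: "c l \<in> \<W>" "h l \<in> c l" using c by blast+
          have "res (skyscraper h D) (\<Union>\<W>) (c l) u = s (c l)" using u[THEN conjunct2] W(1) by blast
          from fun_cong[OF this, of l] show ?thesis using t_eq[OF W] W(2) by simp
        next
          case False
          then show ?thesis using u by (simp add: t_def)
        qed
      qed
    qed
  qed
qed

context finite_space
begin

text \<open>A homomorphism to the skyscraper at \<open>h l\<close> amounts to a homomorphism from
  the stalk there, the sections on \<open>nb (h l)\<close>, to the group \<open>D l\<close>. So each
  coordinate extends by divisibility, independently of the others.\<close>

lemma skyscraper_extension:
  assumes D: "\<And>l. divisible_group (additive_group (D l))"
    and A: "sheaf X A" and B: "sheaf X B" and mono: "sheaf_mono X A B \<iota>" and \<phi>: "sheaf_hom X A (skyscraper h D) \<phi>"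
  shows "\<exists>\<psi>. sheaf_hom X B (skyscraper h D) \<psi> \<and>
    (\<forall>V. openin X V \<longrightarrow> (\<forall>s\<in>carrier (sec A V). \<psi> V (\<iota> V s) = \<phi> V s))"
proof -
  note PA = presheaf_rules[OF sheaf_presheaf[OF A]] and PB = presheaf_rules[OF sheaf_presheaf[OF B]]
  have \<iota>_inj: "inj_on (\<iota> V) (carrier (sec A V))" if "openin X V" for V
    using mono that unfolding sheaf_mono_def by simp
  have \<iota>: "sheaf_hom X A B \<iota>" using mono unfolding sheaf_mono_def by (rule conjunct1)
  note \<iota>_hom = sheaf_hom_rules(1)[OF \<iota>] and \<iota>_res = sheaf_hom_rules(2)[OF \<iota>]
  note \<phi>_hom = sheaf_hom_rules(1)[OF \<phi>] and \<phi>_res = sheaf_hom_rules(2)[OF \<phi>]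
  have "\<exists>\<chi>\<in>hom (sec B (nb (h l))) (additive_group (D l)). \<forall>s\<in>carrier (sec A (nb (h l))).
      \<chi> (\<iota> (nb (h l)) s) = \<phi> (nb (h l)) s l" if l: "h l \<in> topspace X" for l
  proof -
    let ?W = "nb (h l)" and ?D = "additive_group (D l)"
    have W: "openin X ?W" by (rule nb_open[OF openin_topspace l])
    interpret GA: comm_group "sec A ?W" by (rule PA(1)[OF W])
    interpret GB: comm_group "sec B ?W" by (rule PB(1)[OF W])
    have Dc: "comm_group ?D" using D by (simp add: divisible_group_def)
    interpret GD: comm_group ?D by (rule Dc)
    interpret h: group_hom "sec A ?W" "sec B ?W" "\<iota> ?W"
      using \<iota>_hom[OF W] by unfold_locales
    have \<phi>l: "\<phi> ?W s l \<in> D l" if "s \<in> carrier (sec A ?W)" for s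
      using hom_in_carrier[OF \<phi>_hom[OF W] that] by simp
    have \<phi>l_mult: "\<phi> ?W (s \<otimes>\<^bsub>sec A ?W\<^esub> t) l = \<phi> ?W s l + \<phi> ?W t l"
      if "s \<in> carrier (sec A ?W)" "t \<in> carrier (sec A ?W)" for s t
      using hom_mult[OF \<phi>_hom[OF W] that] by simp
    interpret k: group_hom "sec A ?W" ?D "\<lambda>s. \<phi> ?W s l"
      using \<phi>l \<phi>l_mult by unfold_locales (auto intro: homI)
    \<comment> \<open>The homomorphism to be extended is defined on the image of
      \<open>\<iota>\<close>; injectivity of \<open>\<iota>\<close> makes it single-valued.\<close>
    define R where "R = {(\<iota> ?W s, \<phi> ?W s l) | s. s \<in> carrier (sec A ?W)}"
    have R: "R = (\<lambda>s. (\<iota> ?W s, \<phi> ?W s l)) ` carrier (sec A ?W)" by (auto simp: R_def)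
    interpret p: group_hom "sec A ?W" "sec B ?W \<times>\<times> ?D" "\<lambda>s. (\<iota> ?W s, \<phi> ?W s l)"
      by (intro group_hom.intro GA.is_group DirProd_group GB.is_group GD.is_group group_hom_axioms.intro)
        (rule homI, use h.hom_closed \<phi>l \<phi>l_mult in auto)
    have "partial_hom (sec B ?W) ?D R"
      unfolding partial_hom_def
    proof (intro conjI allI impI)
      show "subgroup R (sec B ?W \<times>\<times> ?D)" unfolding R by (rule p.img_is_subgroup)
      fix y assume "(\<one>\<^bsub>sec B ?W\<^esub>, y) \<in> R"
      then obtain s where s: "s \<in> carrier (sec A ?W)" "\<iota> ?W s = \<one>\<^bsub>sec B ?W\<^esub>" "y = \<phi> ?W s l"
        by (auto simp: R_def)
      then have "s = \<one>\<^bsub>sec A ?W\<^esub>"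
        using \<iota>_inj[OF W] h.hom_one by (metis inj_onD GA.one_closed)
      then show "y = \<one>\<^bsub>?D\<^esub>" using s(3) k.hom_one by simp
    qed
    from partial_hom_extends[OF GB.comm_group_axioms D this]
    obtain \<chi> where \<chi>: "\<chi> \<in> hom (sec B ?W) ?D" "\<forall>(g, x)\<in>R. \<chi> g = x" by blast
    have "\<chi> (\<iota> ?W s) = \<phi> ?W s l" if "s \<in> carrier (sec A ?W)" for s
      using \<chi>(2) that by (auto simp: R_def)
    then show ?thesis using \<chi>(1) by blast
  qed
  then have "\<exists>\<chi>. \<forall>l. h l \<in> topspace X \<longrightarrow> \<chi> l \<in> hom (sec B (nb (h l))) (additive_group (D l)) \<and>
      (\<forall>s\<in>carrier (sec A (nb (h l))). \<chi> l (\<iota> (nb (h l)) s) = \<phi> (nb (h l)) s l)"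
    by (intro choice allI) blast
  then obtain \<chi> where
    \<chi>: "\<And>l. h l \<in> topspace X \<Longrightarrow> \<chi> l \<in> hom (sec B (nb (h l))) (additive_group (D l))"
    and \<chi>\<iota>: "\<And>l s. h l \<in> topspace X \<Longrightarrow> s \<in> carrier (sec A (nb (h l))) \<Longrightarrow> \<chi> l (\<iota> (nb (h l)) s) = \<phi> (nb (h l)) s l"
    by blast
  have zero: "0 \<in> D l" for l
    using D[of l] comm_groupE(2)[of "additive_group (D l)"] by (simp add: divisible_group_def)
  \<comment> \<open>Take the germ at \<open>h l\<close> and apply the extended homomorphism.\<close>
  define \<psi> where "\<psi> V t = (\<lambda>l. if h l \<in> V then \<chi> l (res B V (nb (h l)) t) else 0)" for V t
  have res_nb: "res B V (nb x) t \<in> carrier (sec B (nb x))" if "openin X V" "x \<in> V" "t \<in> carrier (sec B V)" for V x t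
    by (rule PB(5)[OF that(1) nb_open[OF that(1,2)] min_nbhd_subset[OF that(1,2)] that(3)])
  have top: "x \<in> topspace X" if "openin X V" "x \<in> V" for V x
    using that openin_subset by blast
  have "sheaf_hom X B (skyscraper h D) \<psi>"
    unfolding sheaf_hom_def
  proof (intro conjI allI impI ballI)
    fix V assume V: "openin X V"
    show "\<psi> V \<in> hom (sec B V) (sec (skyscraper h D) V)"
    proof (rule homI)
      fix t u assume t: "t \<in> carrier (sec B V)" and u: "u \<in> carrier (sec B V)"
      have "\<psi> V t l \<in> D l" for l
        using hom_in_carrier[OF \<chi> res_nb[OF V _ t]] top[OF V] zero by (simp add: \<psi>_def)
      then show "\<psi> V t \<in> carrier (sec (skyscraper h D) V)" by (simp add: \<psi>_def)
      have "\<chi> l (res B V (nb (h l)) (t \<otimes>\<^bsub>sec B V\<^esub> u)) = \<chi> l (res B V (nb (h l)) t) + \<chi> l (res B V (nb (h l)) u)"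
        if l: "h l \<in> V" for l
        using hom_mult[OF PB(2)[OF V nb_open[OF V l] min_nbhd_subset[OF V l]] t u]
          hom_mult[OF \<chi>[OF top[OF V l]] res_nb[OF V l t] res_nb[OF V l u]] by simp
      then show "\<psi> V (t \<otimes>\<^bsub>sec B V\<^esub> u) = \<psi> V t \<otimes>\<^bsub>sec (skyscraper h D) V\<^esub> \<psi> V u"
        by (auto simp: \<psi>_def fun_eq_iff)
    qed
  next
    fix V W t assume V: "openin X V \<and> openin X W \<and> W \<subseteq> V" and t: "t \<in> carrier (sec B V)"
    have "res B W (nb (h l)) (res B V W t) = res B V (nb (h l)) t" if l: "h l \<in> W" for l
      using V t nb_open[of W "h l"] min_nbhd_subset[of X W "h l"] l by (intro PB(4)) auto
    then show "res (skyscraper h D) V W (\<psi> V t) = \<psi> W (res B V W t)"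
      using V by (auto simp: \<psi>_def fun_eq_iff)
  qed
  moreover have "\<psi> V (\<iota> V s) = \<phi> V s" if V: "openin X V" and s: "s \<in> carrier (sec A V)" for V s
  proof
    fix l
    show "\<psi> V (\<iota> V s) l = \<phi> V s l"
    proof (cases "h l \<in> V")
      case True
      note W = nb_open[OF V True] min_nbhd_subset[OF V True]
      have "\<psi> V (\<iota> V s) l = \<chi> l (\<iota> (nb (h l)) (res A V (nb (h l)) s))"
        using True \<iota>_res[OF V W s] by (simp add: \<psi>_def)
      also have "\<dots> = \<phi> (nb (h l)) (res A V (nb (h l)) s) l"
        by (rule \<chi>\<iota>[OF top[OF V True] PA(5)[OF V W s]])
      also have "\<dots> = res (skyscraper h D) V (nb (h l)) (\<phi> V s) l" using \<phi>_res[OF V W s] by metis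
      also have "\<dots> = \<phi> V s l" by simp
      finally show ?thesis .
    next
      case False
      then show ?thesis using hom_in_carrier[OF \<phi>_hom[OF V] s] by (simp add: \<psi>_def)
    qed
  qed
  ultimately show ?thesis by blast
qed

text \<open>Injectivity tests with sheaves whose sections have the type of the sheaf itself, so it
  is stated after the transport. \<open>skyscraper_extension\<close> admits test sheaves of any
  type, and \<open>e\<close> and \<open>g\<close> convert only the target.\<close>

lemma injective_transport_skyscraper:
  fixes e :: "('l \<Rightarrow> 'c::ab_group_add) \<Rightarrow> 'u"
  assumes D: "\<And>l. divisible_group (additive_group (D l))"
    and g: "\<And>V s. openin X V \<Longrightarrow> s \<in> carrier (sec (skyscraper h D) V) \<Longrightarrow> g (e s) = s"
  shows "injective_sheaf X (transport e g (skyscraper h D))"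
  unfolding injective_sheaf_def
proof (intro conjI allI impI)
  have Dc: "comm_group (additive_group (D l))" for l using D by (simp add: divisible_group_def)
  show "sheaf X (transport e g (skyscraper h D))"
    by (rule sheaf_transport[OF sheaf_skyscraper[OF Dc] g])
  fix A B :: "('p, 'u) presheaf" and \<iota> \<phi>
  assume "sheaf X A \<and> sheaf X B \<and> sheaf_mono X A B \<iota> \<and> sheaf_hom X A (transport e g (skyscraper h D)) \<phi>"
  then have A: "sheaf X A" and B: "sheaf X B" and mono: "sheaf_mono X A B \<iota>"
    and \<phi>: "sheaf_hom X A (transport e g (skyscraper h D)) \<phi>" by blast+
  let ?S = "skyscraper h D"
  have S: "sheaf X ?S" by (rule sheaf_skyscraper[OF Dc])
  note PA = presheaf_rules[OF sheaf_presheaf[OF A]] and PS = presheaf_rules[OF sheaf_presheaf[OF S]]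
  note \<phi>_hom = sheaf_hom_rules(1)[OF \<phi>] and \<phi>_res = sheaf_hom_rules(2)[OF \<phi>]
  have g\<phi>: "g (\<phi> V s) \<in> carrier (sec ?S V)" "e (g (\<phi> V s)) = \<phi> V s"
    if V: "openin X V" and s: "s \<in> carrier (sec A V)" for V s
  proof -
    have "\<phi> V s \<in> e ` carrier (sec ?S V)" using hom_in_carrier[OF \<phi>_hom[OF V] s] by (simp only: transport_simps)
    then obtain f where "\<phi> V s = e f" "f \<in> carrier (sec ?S V)" by (rule imageE)
    then show "g (\<phi> V s) \<in> carrier (sec ?S V)" "e (g (\<phi> V s)) = \<phi> V s" using g[OF V] by simp_all
  qed
  have "sheaf_hom X A ?S (\<lambda>V s. g (\<phi> V s))"
    unfolding sheaf_hom_def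
  proof (intro conjI allI impI ballI)
    fix V assume V: "openin X V"
    interpret GS: comm_group "sec ?S V" by (rule PS(1)[OF V])
    show "(\<lambda>s. g (\<phi> V s)) \<in> hom (sec A V) (sec ?S V)"
    proof (rule homI)
      show "g (\<phi> V s) \<in> carrier (sec ?S V)" if "s \<in> carrier (sec A V)" for s by (rule g\<phi>(1)[OF V that])
      fix s t assume st: "s \<in> carrier (sec A V)" "t \<in> carrier (sec A V)"
      show "g (\<phi> V (s \<otimes>\<^bsub>sec A V\<^esub> t)) = g (\<phi> V s) \<otimes>\<^bsub>sec ?S V\<^esub> g (\<phi> V t)"
        unfolding hom_mult[OF \<phi>_hom[OF V] st] transport_simps(2)
        by (rule g[OF V GS.m_closed[OF g\<phi>(1)[OF V st(1)] g\<phi>(1)[OF V st(2)]]])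
    qed
  next
    fix V W s assume V: "openin X V \<and> openin X W \<and> W \<subseteq> V" and s: "s \<in> carrier (sec A V)"
    then have o: "openin X V" "openin X W" "W \<subseteq> V" by blast+
    show "res ?S V W (g (\<phi> V s)) = g (\<phi> W (res A V W s))"
      unfolding \<phi>_res[OF o s, symmetric] transport_simps(4)
      by (rule g[OF o(2) PS(5)[OF o g\<phi>(1)[OF o(1) s]], symmetric])
  qed
  from skyscraper_extension[OF D A B mono this]
  obtain \<psi> where \<psi>: "sheaf_hom X B ?S \<psi>"
    and \<psi>\<iota>: "\<And>V s. openin X V \<Longrightarrow> s \<in> carrier (sec A V) \<Longrightarrow> \<psi> V (\<iota> V s) = g (\<phi> V s)" by blast
  have "sheaf_hom X B (transport e g ?S) (\<lambda>V t. e (\<psi> V t))"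
    unfolding sheaf_hom_def
  proof (intro conjI allI impI ballI)
    fix V assume V: "openin X V"
    note \<psi>V = sheaf_hom_rules(1)[OF \<psi> V]
    show "(\<lambda>t. e (\<psi> V t)) \<in> hom (sec B V) (sec (transport e g ?S) V)"
    proof (rule homI)
      show "e (\<psi> V t) \<in> carrier (sec (transport e g ?S) V)" if "t \<in> carrier (sec B V)" for t
        unfolding transport_simps by (rule imageI[OF hom_in_carrier[OF \<psi>V that]])
      show "e (\<psi> V (s \<otimes>\<^bsub>sec B V\<^esub> t)) = e (\<psi> V s) \<otimes>\<^bsub>sec (transport e g ?S) V\<^esub> e (\<psi> V t)"
        if "s \<in> carrier (sec B V)" "t \<in> carrier (sec B V)" for s t
        unfolding hom_mult[OF \<psi>V that] transport_simps(2)
          g[OF V hom_in_carrier[OF \<psi>V that(1)]] g[OF V hom_in_carrier[OF \<psi>V that(2)]] ..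
    qed
  next
    fix V W t assume V: "openin X V \<and> openin X W \<and> W \<subseteq> V" and t: "t \<in> carrier (sec B V)"
    then have o: "openin X V" by blast
    note \<psi>V = sheaf_hom_rules(1)[OF \<psi> o]
    have "res ?S V W (\<psi> V t) = \<psi> W (res B V W t)"
      using V t by (intro sheaf_hom_rules(2)[OF \<psi>]) auto
    then show "res (transport e g ?S) V W (e (\<psi> V t)) = e (\<psi> W (res B V W t))"
      unfolding transport_simps(4) g[OF o hom_in_carrier[OF \<psi>V t]] by (rule arg_cong)
  qed
  moreover have "e (\<psi> V (\<iota> V s)) = \<phi> V s" if "openin X V" "s \<in> carrier (sec A V)" for V s
    unfolding \<psi>\<iota>[OF that] by (rule g\<phi>(2)[OF that])
  ultimately show "\<exists>\<psi>. sheaf_hom X B (transport e g ?S) \<psi> \<and>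
      (\<forall>V. openin X V \<longrightarrow> (\<forall>s\<in>carrier (sec A V). \<psi> V (\<iota> V s) = \<phi> V s))"
    by (intro exI[of _ "\<lambda>V t. e (\<psi> V t)"]) simp
qed

end

section \<open>An injective resolution of the constant sheaf\<close>

text \<open>The coboundary of simplicial cochains \<open>f\<close> on lists of vertices, by recursion on the
  list: with \<open>x\<close> in front, the faces are the list without \<open>x\<close> and \<open>x\<close> followed by the other faces.\<close>

fun delta :: "('p list \<Rightarrow> 'a::ab_group_add) \<Rightarrow> 'p list \<Rightarrow> 'a" where
  "delta f [] = 0"
| "delta f (x # c) = f c - delta (\<lambda>c'. f (x # c')) c"

lemma delta_zero [simp]: "delta (\<lambda>_. 0) c = 0"
  by (induction c) auto

lemma delta_add: "delta (\<lambda>c. f c + g c) c = delta f c + delta g c"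
  by (induction c arbitrary: f g) (auto simp: algebra_simps)

lemma delta_diff: "delta (\<lambda>c. f c - g c) c = delta f c - delta g c"
  by (induction c arbitrary: f g) (auto simp: algebra_simps)

lemma delta_ratmod_of: "delta (\<lambda>c. ratmod_of (f c)) c = ratmod_of (delta f c)"
  by (induction c arbitrary: f) (auto simp: ratmod_of_diff)

text \<open>On \<open>x # c\<close>, expanding the inner coboundary cancels the term
  \<open>delta f c\<close> and leaves the same claim for the cochain with \<open>x\<close> put in
  front.\<close>

lemma delta_delta: "delta (delta f) c = 0"
  by (induction c arbitrary: f) (simp_all add: delta_diff)

text \<open>\<open>delta\<close> evaluates its argument only on sublists, and these inherit
  sortedness.\<close>

lemma delta_cong:
  assumes "sorted_wrt Q c" "\<And>c'. set c' \<subseteq> set c \<Longrightarrow> sorted_wrt Q c' \<Longrightarrow> f c' = g c'"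
  shows "delta f c = delta g c"
  using assms
proof (induction c arbitrary: f g)
  case (Cons x c)
  have "delta (\<lambda>c'. f (x # c')) c = delta (\<lambda>c'. g (x # c')) c"
    using Cons.prems(1) by (intro Cons.IH Cons.prems(2)) auto
  moreover have "f c = g c" using Cons.prems(1) by (intro Cons.prems(2)) auto
  ultimately show ?case by simp
qed simp

lemma delta_length: "(\<And>c. length c \<noteq> m \<Longrightarrow> f c = 0) \<Longrightarrow> length c \<noteq> Suc m \<Longrightarrow> delta f c = 0"
proof (induction c arbitrary: f m)
  case (Cons x c)
  have "delta (\<lambda>c'. f (x # c')) c = 0"
  proof (cases m)
    case 0
    then have "(\<lambda>c'. f (x # c')) = (\<lambda>_. 0)" using Cons.prems(1) by auto
    then show ?thesis by simp
  next
    case (Suc m')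
    then show ?thesis using Cons.prems by (intro Cons.IH[of m']) auto
  qed
  then show ?case using Cons.prems by simp
qed simp

lemma delta_Nil: "delta (\<lambda>c. if c = [] then a else 0) c = (if length c = 1 then a else 0)"
  by (cases c) auto

text \<open>Constants on vertices are cocycles, being the coboundary of a value at the empty
  list.\<close>

lemma delta_length_1: "delta (\<lambda>c. if length c = 1 then a else 0) c = 0"
proof (cases c)
  case (Cons x c')
  have "(\<lambda>c'. if length (x # c') = 1 then a else 0) = (\<lambda>c'. if c' = [] then a else 0)" by auto
  then show ?thesis using delta_Nil[of a c'] by (simp add: Cons)
qed simp

text \<open>The left term is kept general, with \<open>a\<close> in place of \<open>e\<close>,
  because the resolution begins with the constant sheaf itself, where \<open>a\<close> is the
  identity.\<close>

lemma sheaf_exact_transport: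
  assumes ex: "sheaf_exact X A B C \<phi> \<psi>"
    and B: "presheaf X B" and \<psi>: "sheaf_hom X B C \<psi>" and C: "presheaf X C"
    and g: "\<And>V t. openin X V \<Longrightarrow> t \<in> carrier (sec B V) \<Longrightarrow> g (e t) = t"
    and g': "\<And>V t. openin X V \<Longrightarrow> t \<in> carrier (sec C V) \<Longrightarrow> g (e t) = t"
    and A': "\<And>V. openin X V \<Longrightarrow> carrier (sec A' V) = a ` carrier (sec A V)"
    and \<phi>': "\<And>V s. openin X V \<Longrightarrow> s \<in> carrier (sec A V) \<Longrightarrow> \<phi>' V (a s) = e (\<phi> V s)"
    and \<phi>: "\<And>V s. openin X V \<Longrightarrow> s \<in> carrier (sec A V) \<Longrightarrow> \<phi> V s \<in> carrier (sec B V)"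
  shows "sheaf_exact X A' (transport e g B) (transport e g C) \<phi>' (\<lambda>V t. e (\<psi> V (g t)))"
  unfolding sheaf_exact_def
proof (intro allI impI ballI)
  fix V t' assume V: "openin X V" and t': "t' \<in> carrier (sec (transport e g B) V)"
  obtain t where t: "t \<in> carrier (sec B V)" "t' = e t" using t' by auto
  have gt: "g (e t) = t" by (rule g[OF V t(1)])
  have \<psi>t: "\<psi> V t \<in> carrier (sec C V)" by (rule hom_in_carrier[OF sheaf_hom_rules(1)[OF \<psi> V] t(1)])
  have one: "\<one>\<^bsub>sec C V\<^esub> \<in> carrier (sec C V)" using comm_groupE(2)[OF presheaf_rules(1)[OF C V]] .
  have "e (\<psi> V (g t')) = \<one>\<^bsub>sec (transport e g C) V\<^esub> \<longleftrightarrow> \<psi> V t = \<one>\<^bsub>sec C V\<^esub>"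
  proof
    assume "e (\<psi> V (g t')) = \<one>\<^bsub>sec (transport e g C) V\<^esub>"
    then have "g (e (\<psi> V t)) = g (e \<one>\<^bsub>sec C V\<^esub>)" by (simp add: t(2) gt)
    then show "\<psi> V t = \<one>\<^bsub>sec C V\<^esub>" unfolding g'[OF V \<psi>t] g'[OF V one] .
  qed (simp add: t(2) gt)
  also have "\<dots> \<longleftrightarrow> (\<forall>x\<in>V. \<exists>W. openin X W \<and> x \<in> W \<and> W \<subseteq> V \<and> (\<exists>s\<in>carrier (sec A W). \<phi> W s = res B V W t))"
    using ex[unfolded sheaf_exact_def, rule_format, OF V t(1)] .
  also have "\<dots> \<longleftrightarrow> (\<forall>x\<in>V. \<exists>W. openin X W \<and> x \<in> W \<and> W \<subseteq> V \<and>
      (\<exists>s\<in>carrier (sec A' W). \<phi>' W s = res (transport e g B) V W t'))"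
  proof -
    have "(\<exists>s\<in>carrier (sec A W). \<phi> W s = res B V W t) \<longleftrightarrow>
        (\<exists>s\<in>carrier (sec A' W). \<phi>' W s = res (transport e g B) V W t')" if W: "openin X W" "W \<subseteq> V" for W
    proof -
      have "\<phi>' W (a s) = res (transport e g B) V W t' \<longleftrightarrow> \<phi> W s = res B V W t" if s: "s \<in> carrier (sec A W)" for s
      proof -
        note gs = g[OF W(1) \<phi>[OF W(1) s]] g[OF W(1) presheaf_rules(5)[OF B V W t(1)]]
        have "\<phi> W s = res B V W t" if eq: "e (\<phi> W s) = e (res B V W t)"
        proof -
          have "g (e (\<phi> W s)) = g (e (res B V W t))" using eq by simp
          then show ?thesis unfolding gs .
        qed
        then show ?thesis unfolding \<phi>'[OF W(1) s] transport_simps(4) t(2) gt by auto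
      qed
      then show ?thesis unfolding A'[OF W(1)] by simp
    qed
    then show ?thesis by (intro ball_cong HOL.refl ex_cong1) blast
  qed
  finally show "e (\<psi> V (g t')) = \<one>\<^bsub>sec (transport e g C) V\<^esub> \<longleftrightarrow> (\<forall>x\<in>V. \<exists>W. openin X W \<and> x \<in> W \<and> W \<subseteq> V \<and>
      (\<exists>s\<in>carrier (sec A' W). \<phi>' W s = res (transport e g B) V W t'))" .
qed

context finite_space
begin

text \<open>On a finite space exactness is a condition on stalks, and these are the sections on
  minimal neighbourhoods.\<close>

lemma sheaf_exactI:
  assumes B: "presheaf X B" and C: "sheaf X C" and \<phi>: "sheaf_hom X A B \<phi>" and \<psi>: "sheaf_hom X B C \<psi>"
    and comp: "\<And>V s. openin X V \<Longrightarrow> s \<in> carrier (sec A V) \<Longrightarrow> \<psi> V (\<phi> V s) = \<one>\<^bsub>sec C V\<^esub>"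
    and ex: "\<And>x t. x \<in> topspace X \<Longrightarrow> t \<in> carrier (sec B (nb x)) \<Longrightarrow> \<psi> (nb x) t = \<one>\<^bsub>sec C (nb x)\<^esub> \<Longrightarrow>
      \<exists>s\<in>carrier (sec A (nb x)). \<phi> (nb x) s = t"
  shows "sheaf_exact X A B C \<phi> \<psi>"
  unfolding sheaf_exact_def
proof (intro allI impI ballI iffI)
  fix V t x assume V: "openin X V" and t: "t \<in> carrier (sec B V)" and 1: "\<psi> V t = \<one>\<^bsub>sec C V\<^esub>" and x: "x \<in> V"
  note W = nb_open[OF V x] min_nbhd_subset[OF V x]
  have "\<psi> (nb x) (res B V (nb x) t) = \<one>\<^bsub>sec C (nb x)\<^esub>"
    using sheaf_hom_rules(2)[OF \<psi> V W t] presheaf_res_one[OF sheaf_presheaf[OF C] V W] 1 by simp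
  then have "\<exists>s\<in>carrier (sec A (nb x)). \<phi> (nb x) s = res B V (nb x) t"
    using openin_subset[OF V] x by (intro ex presheaf_rules(5)[OF B V W t]) auto
  then show "\<exists>W. openin X W \<and> x \<in> W \<and> W \<subseteq> V \<and> (\<exists>s\<in>carrier (sec A W). \<phi> W s = res B V W t)"
    using W by (intro exI[of _ "nb x"]) simp
next
  fix V t assume V: "openin X V" and t: "t \<in> carrier (sec B V)"
    and loc: "\<forall>x\<in>V. \<exists>W. openin X W \<and> x \<in> W \<and> W \<subseteq> V \<and> (\<exists>s\<in>carrier (sec A W). \<phi> W s = res B V W t)"
  show "\<psi> V t = \<one>\<^bsub>sec C V\<^esub>"
  proof (rule sheaf_separated[OF C V])
    show "\<psi> V t \<in> carrier (sec C V)" by (rule hom_in_carrier[OF sheaf_hom_rules(1)[OF \<psi> V] t])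
    show "\<one>\<^bsub>sec C V\<^esub> \<in> carrier (sec C V)"
      using comm_groupE(2)[OF presheaf_rules(1)[OF sheaf_presheaf[OF C] V]] .
    fix x assume "x \<in> V"
    from bspec[OF loc this] obtain W s where W: "openin X W" "x \<in> W" "W \<subseteq> V"
      and s: "s \<in> carrier (sec A W)" "\<phi> W s = res B V W t" by (elim exE conjE bexE)
    have "res C V W (\<psi> V t) = \<one>\<^bsub>sec C W\<^esub>"
      using sheaf_hom_rules(2)[OF \<psi> V W(1,3) t] comp[OF W(1) s(1)] s(2) by simp
    then show "\<exists>W. openin X W \<and> x \<in> W \<and> W \<subseteq> V \<and> res C V W (\<psi> V t) = res C V W \<one>\<^bsub>sec C V\<^esub>"
      using W presheaf_res_one[OF sheaf_presheaf[OF C] V W(1,3)] by (intro exI[of _ W]) simp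
  qed
qed

text \<open>Chains of the specialization preorder, with repetitions allowed: prepending
  \<open>x\<close> to any chain in \<open>nb x\<close> must give a chain even if \<open>x\<close>
  occurs already, which the contracting homotopy uses.\<close>

definition chain :: "'p list \<Rightarrow> bool" where
  "chain c \<longleftrightarrow> c \<noteq> [] \<and> set c \<subseteq> topspace X \<and> sorted_wrt (\<lambda>x y. y \<in> nb x) c"

text \<open>The reason for placing the skyscrapers at the heads: if the head lies in
  \<open>V\<close>, so do all vertices, and hence all faces of the chain belong to
  \<open>V\<close>.\<close>

lemma chain_open:
  assumes "chain c" "openin X V" "hd c \<in> V"
  shows "set c \<subseteq> V"
proof -
  obtain x c' where c: "c = x # c'" using assms(1) by (cases c) (auto simp: chain_def)
  then have "set c' \<subseteq> nb x" using assms(1) by (auto simp: chain_def)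
  then show ?thesis using min_nbhd_subset[OF assms(2), of x] assms(3) c by auto
qed

text \<open>The sheaf \<open>R n\<close> is the degree \<open>n\<close> part of the mapping cone of the cochains with rational
  coefficients, mapped to the cochains with coefficients in \<open>ratmod\<close>.\<close>

definition stalk :: "nat \<Rightarrow> 'p list \<Rightarrow> (rat \<times> ratmod) set" where
  "stalk n c = {(a, b). (a \<noteq> 0 \<longrightarrow> chain c \<and> length c = Suc n) \<and> (b \<noteq> 0 \<longrightarrow> chain c \<and> length c = n)}"

definition R :: "nat \<Rightarrow> ('p, 'p list \<Rightarrow> rat \<times> ratmod) presheaf" where
  "R n = skyscraper hd (stalk n)"

text \<open>The differential of the cone, (a, b) \<mapsto> (\<delta> a, \<pi> a - \<delta> b) with
  \<pi> the reduction modulo \<int>. It squares to zero since \<pi> commutes with \<delta>. The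
  second component lives on chains with one vertex less.\<close>

definition dR :: "nat \<Rightarrow> 'p set \<Rightarrow> ('p list \<Rightarrow> rat \<times> ratmod) \<Rightarrow> 'p list \<Rightarrow> rat \<times> ratmod" where
  "dR n V f c = (if chain c \<and> hd c \<in> V
     then (delta (\<lambda>c. fst (f c)) c, ratmod_of (fst (f c)) - delta (\<lambda>c. snd (f c)) c) else 0)"

definition eR :: "'p set \<Rightarrow> ('p \<Rightarrow> int) \<Rightarrow> 'p list \<Rightarrow> rat \<times> ratmod" where
  "eR V s c = (if chain c \<and> length c = 1 \<and> hd c \<in> V then (of_int (s (hd c)), 0) else 0)"

section \<open>Stalks and differentials of the sheaves \<open>R n\<close>\<close>

lemma stalk_iff: "p \<in> stalk n c \<longleftrightarrow>
    (fst p \<noteq> 0 \<longrightarrow> chain c \<and> length c = Suc n) \<and> (snd p \<noteq> 0 \<longrightarrow> chain c \<and> length c = n)"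
  by (cases p) (simp add: stalk_def)

lemma pow_rat_ratmod:
  "(a, ratmod_of b) [^]\<^bsub>additive_group A\<^esub> (m::nat) = (of_nat m * a, ratmod_of (of_nat m * b))"
  by (induction m) (simp_all add: zero_prod_def ratmod_of_add[symmetric] algebra_simps)

lemma divisible_stalk: "divisible_group (additive_group (stalk n c))"
  unfolding divisible_group_def
proof (intro conjI ballI allI impI)
  show "comm_group (additive_group (stalk n c))"
    by (rule comm_group_additive_group) (auto simp: stalk_iff)
  fix p and m :: nat assume p: "p \<in> carrier (additive_group (stalk n c))" and m: "m > 0"
  obtain a b where ab: "p = (a, b)" by (cases p)
  \<comment> \<open>The representative of 0 must be 0: an integer divided by \<open>m\<close> could
    be nonzero modulo \<int> and leave the stalk.\<close>
  obtain b' where b': "ratmod_of b' = b" "b = 0 \<longrightarrow> b' = 0"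
    using ratmod_of_surj[of b] ratmod_of_zero by metis
  have "(a / of_nat m, ratmod_of (b' / of_nat m)) \<in> stalk n c"
    using p b' by (auto simp: ab stalk_iff)
  moreover have "(a / of_nat m, ratmod_of (b' / of_nat m)) [^]\<^bsub>additive_group (stalk n c)\<^esub> m = p"
    using m b' by (simp add: pow_rat_ratmod ab)
  ultimately show "\<exists>z\<in>carrier (additive_group (stalk n c)). z [^]\<^bsub>additive_group (stalk n c)\<^esub> m = p"
    by (metis additive_group_simps(1))
qed

lemma sheaf_R: "sheaf X (R n)"
  unfolding R_def using divisible_stalk by (intro sheaf_skyscraper) (simp add: divisible_group_def)

lemma R_carrier: "f \<in> carrier (sec (R n) V) \<longleftrightarrow>
    (\<forall>c. (fst (f c) \<noteq> 0 \<longrightarrow> chain c \<and> length c = Suc n \<and> hd c \<in> V) \<and> (snd (f c) \<noteq> 0 \<longrightarrow> chain c \<and> length c = n \<and> hd c \<in> V))"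
  by (auto simp: R_def stalk_iff prod_eq_iff)

lemma R_simps [simp]:
  "f \<otimes>\<^bsub>sec (R n) V\<^esub> g = f + g" "\<one>\<^bsub>sec (R n) V\<^esub> = 0"
  "res (R n) V W f = (\<lambda>c. if hd c \<in> W then f c else 0)"
  by (simp_all add: R_def)

lemma R_D:
  assumes "f \<in> carrier (sec (R n) V)"
  shows "\<not> chain c \<Longrightarrow> f c = 0" "hd c \<notin> V \<Longrightarrow> f c = 0"
    "length c \<noteq> Suc n \<Longrightarrow> fst (f c) = 0" "length c \<noteq> n \<Longrightarrow> snd (f c) = 0"
  using assms by (auto simp: R_carrier prod_eq_iff)

lemma chain_Nil [simp]: "\<not> chain []"
  by (simp add: chain_def)

lemma chain_sub:
  assumes "chain c" "set c' \<subseteq> set c" "sorted_wrt (\<lambda>x y. y \<in> nb x) c'" "c' \<noteq> []"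
  shows "chain c'"
  using assms by (auto simp: chain_def)

text \<open>The empty list is no chain but is the face of a vertex, so agreement there is a
  condition of its own.\<close>

lemma delta_chain_cong:
  assumes "chain c" "openin X V" "hd c \<in> V" "f [] = g []" "\<And>c'. chain c' \<Longrightarrow> hd c' \<in> V \<Longrightarrow> f c' = g c'"
  shows "delta f c = delta g c"
proof (rule delta_cong)
  show "sorted_wrt (\<lambda>x y. y \<in> nb x) c" using assms(1) by (simp add: chain_def)
  fix c' assume c': "set c' \<subseteq> set c" "sorted_wrt (\<lambda>x y. y \<in> nb x) c'"
  show "f c' = g c'"
  proof (cases "c' = []")
    case False
    then have "hd c' \<in> V" using chain_open[OF assms(1-3)] c'(1) by (meson hd_in_set subsetD)
    then show ?thesis using chain_sub[OF assms(1) c' False] assms(5) by blast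
  qed (simp add: assms(4))
qed

lemma dR_hom: "sheaf_hom X (R n) (R (Suc n)) (dR n)"
  unfolding sheaf_hom_def
proof (intro conjI allI impI ballI)
  fix V assume V: "openin X V"
  show "dR n V \<in> hom (sec (R n) V) (sec (R (Suc n)) V)"
  proof (rule homI)
    fix f assume f: "f \<in> carrier (sec (R n) V)"
    have A: "delta (\<lambda>c. fst (f c)) c = 0" if "length c \<noteq> Suc (Suc n)" for c
      using R_D(3)[OF f] that by (rule delta_length)
    have B: "ratmod_of (fst (f c)) - delta (\<lambda>c. snd (f c)) c = 0" if "length c \<noteq> Suc n" for c
      using delta_length[OF R_D(4)[OF f] that] R_D(3)[OF f that] by simp
    show "dR n V f \<in> carrier (sec (R (Suc n)) V)"
      unfolding R_carrier
    proof (rule allI)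
      fix c
      have "dR n V f c = (delta (\<lambda>c. fst (f c)) c, ratmod_of (fst (f c)) - delta (\<lambda>c. snd (f c)) c)"
        if "chain c \<and> hd c \<in> V" using that by (simp only: dR_def if_True simp_thms)
      moreover have "dR n V f c = 0" if "\<not> (chain c \<and> hd c \<in> V)" using that by (simp only: dR_def if_False)
      ultimately show "(fst (dR n V f c) \<noteq> 0 \<longrightarrow> chain c \<and> length c = Suc (Suc n) \<and> hd c \<in> V) \<and>
          (snd (dR n V f c) \<noteq> 0 \<longrightarrow> chain c \<and> length c = Suc n \<and> hd c \<in> V)"
        using A[of c] B[of c] by (cases "chain c \<and> hd c \<in> V") auto
    qed
  next
    fix f g
    show "dR n V (f \<otimes>\<^bsub>sec (R n) V\<^esub> g) = dR n V f \<otimes>\<^bsub>sec (R (Suc n)) V\<^esub> dR n V g"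
      by (auto simp: dR_def fun_eq_iff delta_add ratmod_of_add)
  qed
next
  fix V W f assume V: "openin X V \<and> openin X W \<and> W \<subseteq> V" and f: "f \<in> carrier (sec (R n) V)"
  show "res (R (Suc n)) V W (dR n V f) = dR n W (res (R n) V W f)"
  proof
    fix c
    show "res (R (Suc n)) V W (dR n V f) c = dR n W (res (R n) V W f) c"
    proof (cases "chain c \<and> hd c \<in> W")
      case True
      have z: "f [] = 0" by (rule R_D(1)[OF f]) simp
      have "delta (\<lambda>c. fst (res (R n) V W f c)) c = delta (\<lambda>c. fst (f c)) c"
        "delta (\<lambda>c. snd (res (R n) V W f c)) c = delta (\<lambda>c. snd (f c)) c"
        using True V z by (intro delta_chain_cong[where V = W]; simp)+
      then show ?thesis using True V by (auto simp: dR_def)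
    qed (auto simp: dR_def)
  qed
qed

lemma dR_carrier: "openin X V \<Longrightarrow> f \<in> carrier (sec (R n) V) \<Longrightarrow> dR n V f \<in> carrier (sec (R (Suc n)) V)"
  by (rule hom_in_carrier[OF sheaf_hom_rules(1)[OF dR_hom]])

lemma dR_dR:
  assumes V: "openin X V" and f: "f \<in> carrier (sec (R n) V)"
  shows "dR (Suc n) V (dR n V f) = 0"
proof
  fix c
  show "dR (Suc n) V (dR n V f) c = 0 c"
  proof (cases "chain c \<and> hd c \<in> V")
    case True
    have z: "f [] = 0" by (rule R_D(1)[OF f]) simp
    have "delta (\<lambda>c. fst (dR n V f c)) c = delta (delta (\<lambda>c. fst (f c))) c"
      using True V by (intro delta_chain_cong[where V = V]) (auto simp: dR_def)
    moreover have "delta (\<lambda>c. snd (dR n V f c)) c =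
        delta (\<lambda>c. ratmod_of (fst (f c)) - delta (\<lambda>c. snd (f c)) c) c"
      using True V z by (intro delta_chain_cong[where V = V]) (auto simp: dR_def)
    ultimately show ?thesis
      using True by (simp add: dR_def[of "Suc n"] delta_delta delta_diff delta_ratmod_of)
        (simp add: dR_def zero_prod_def)
  qed (auto simp: dR_def)
qed

text \<open>Prepending \<open>x\<close> to a chain in the minimal neighbourhood of \<open>x\<close> is a contracting homotopy.\<close>

lemma dR_exact:
  assumes x: "x \<in> topspace X" and f: "f \<in> carrier (sec (R (Suc n)) (nb x))" and df: "dR (Suc n) (nb x) f = 0"
  shows "\<exists>s\<in>carrier (sec (R n) (nb x)). dR n (nb x) s = f"
proof -
  let ?f = "\<lambda>c. fst (f c)" and ?g = "\<lambda>c. snd (f c)"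
  note W = min_nbhd(1)[OF finite_X x]
  \<comment> \<open>Prepending \<open>x\<close> alone would require the value -?g [x] at the empty
    list, which is not a chain. The defect is a constant in \<rat>/\<int>, removed by adding a
    rational lift of it to the first component. Lifting 0 to 0 confines the correction to
    \<open>n = 0\<close>.\<close>
  obtain \<rho> where \<rho>: "ratmod_of \<rho> = ?g [x]" "?g [x] = 0 \<longrightarrow> \<rho> = 0"
    using ratmod_of_surj[of "?g [x]"] ratmod_of_zero by metis
  have chain_x: "chain (x # c)" if "chain c" "hd c \<in> nb x" for c
    using that chain_open[OF that(1) W that(2)] x by (auto simp: chain_def)
  define s where "s c = (if chain c \<and> hd c \<in> nb x
    then (?f (x # c) + (if length c = 1 then \<rho> else 0), - ?g (x # c)) else 0)" for c
  have \<rho>0: "n = 0" if "\<rho> \<noteq> 0"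
  proof -
    have "length [x] = Suc n" using that \<rho>(2) R_D(4)[OF f, of "[x]"] by blast
    then show ?thesis by simp
  qed
  have "s \<in> carrier (sec (R n) (nb x))"
    unfolding R_carrier
  proof (intro allI conjI impI)
    fix c
    show "chain c" "hd c \<in> nb x" if "fst (s c) \<noteq> 0" using that by (auto simp: s_def split: if_splits)
    show "chain c" "hd c \<in> nb x" if "snd (s c) \<noteq> 0" using that by (auto simp: s_def split: if_splits)
    show "length c = Suc n" if nz: "fst (s c) \<noteq> 0"
    proof (cases "?f (x # c) = 0")
      case True
      then have "\<rho> \<noteq> 0 \<and> length c = 1" using nz by (auto simp: s_def split: if_splits)
      then show ?thesis using \<rho>0 by simp
    next
      case False
      then have "length (x # c) = Suc (Suc n)" using R_D(3)[OF f, of "x # c"] by blast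
      then show ?thesis by simp
    qed
    show "length c = n" if nz: "snd (s c) \<noteq> 0"
    proof -
      have "?g (x # c) \<noteq> 0" using nz by (auto simp: s_def split: if_splits)
      then have "length (x # c) = Suc n" using R_D(4)[OF f, of "x # c"] by blast
      then show ?thesis by simp
    qed
  qed
  moreover have "dR n (nb x) s c = f c" for c
  proof (cases "chain c \<and> hd c \<in> nb x")
    case True
    then have xc: "chain (x # c) \<and> hd (x # c) \<in> nb x" using chain_x by simp
    \<comment> \<open>By the recursion of \<open>delta\<close>, the cocycle equations at
      \<open>x # c\<close> are the homotopy formula at \<open>c\<close>.\<close>
    have "dR (Suc n) (nb x) f (x # c) = 0" using df by simp
    then have 1: "delta ?f (x # c) = 0" and 2: "ratmod_of (?f (x # c)) = delta ?g (x # c)"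
      unfolding dR_def using xc by (auto simp: zero_prod_def)
    have fx: "?f [x] = 0" by (rule R_D(3)[OF f]) simp
    have s0: "s [] = 0" by (simp add: s_def)
    have "delta (\<lambda>c. fst (s c)) c = delta (\<lambda>c'. ?f (x # c') + (if length c' = 1 then \<rho> else 0)) c"
      using True fx s0 by (intro delta_chain_cong[OF _ W]) (simp_all add: s_def)
    also have "\<dots> = delta (\<lambda>c'. ?f (x # c')) c" by (simp only: delta_add delta_length_1 add_0_right)
    also have "\<dots> = ?f c" using 1 by simp
    finally have A: "delta (\<lambda>c. fst (s c)) c = ?f c" .
    \<comment> \<open>The extra term compensates for -?g [x] at the empty list, where
      \<open>s\<close> vanishes.\<close>
    have "delta (\<lambda>c. snd (s c)) c = delta (\<lambda>c'. (if c' = [] then ?g [x] else 0) - ?g (x # c')) c"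
      using True s0 by (intro delta_chain_cong[OF _ W]) (auto simp: s_def)
    also have "\<dots> = (if length c = 1 then ?g [x] else 0) - delta (\<lambda>c'. ?g (x # c')) c"
      by (simp only: delta_diff delta_Nil)
    also have "delta (\<lambda>c'. ?g (x # c')) c = ?g c - ratmod_of (?f (x # c))" using 2 by simp
    finally have B: "delta (\<lambda>c. snd (s c)) c = (if length c = 1 then ?g [x] else 0) - (?g c - ratmod_of (?f (x # c)))" .
    have C: "ratmod_of (fst (s c)) = ratmod_of (?f (x # c)) + (if length c = 1 then ?g [x] else 0)"
      using True \<rho>(1) by (simp add: s_def ratmod_of_add)
    show ?thesis unfolding dR_def A B C using True by (simp add: prod_eq_iff)
  next
    case False
    then have "f c = 0" using R_D(1,2)[OF f] by blast
    then show ?thesis using False by (auto simp: dR_def)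
  qed
  ultimately show ?thesis by blast
qed

section \<open>The augmentation by the constant sheaf\<close>

lemma chain_singleton: "chain [x] \<longleftrightarrow> x \<in> topspace X"
  by (simp add: chain_def)

lemma eR_hom: "sheaf_hom X (constant_sheaf_int X) (R 0) eR"
  unfolding sheaf_hom_def
proof (intro conjI allI impI ballI)
  fix V assume V: "openin X V"
  show "eR V \<in> hom (sec (constant_sheaf_int X) V) (sec (R 0) V)"
    by (rule homI) (auto simp: R_carrier eR_def fun_eq_iff)
next
  fix V W s assume "openin X V \<and> openin X W \<and> W \<subseteq> V" "s \<in> carrier (sec (constant_sheaf_int X) V)"
  then show "res (R 0) V W (eR V s) = eR W (res (constant_sheaf_int X) V W s)"
    by (auto simp: eR_def fun_eq_iff)
qed

lemma eR_mono: "sheaf_mono X (constant_sheaf_int X) (R 0) eR"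
  unfolding sheaf_mono_def
proof (intro conjI eR_hom allI impI inj_onI)
  fix V s t assume V: "openin X V" and s: "s \<in> carrier (sec (constant_sheaf_int X) V)"
    and t: "t \<in> carrier (sec (constant_sheaf_int X) V)" and eq: "eR V s = eR V t"
  have "s x = t x" if "x \<in> V" for x
  proof -
    have "x \<in> topspace X" using V that openin_subset by blast
    then have "eR V s [x] = (of_int (s x), 0)" "eR V t [x] = (of_int (t x), 0)"
      using that by (simp_all add: eR_def chain_singleton)
    then show ?thesis using eq by simp
  qed
  then show "s = t" using s t unfolding constant_sheaf_int_carrier by (auto intro: extensionalityI)
qed

lemma dR_eR:
  assumes V: "openin X V" and s: "s \<in> carrier (sec (constant_sheaf_int X) V)"
  shows "dR 0 V (eR V s) = 0"
proof
  fix c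
  show "dR 0 V (eR V s) c = 0 c"
  proof (cases "chain c \<and> hd c \<in> V")
    case True
    have snd0: "(\<lambda>c. snd (eR V s c)) = (\<lambda>_. 0)" by (auto simp: eR_def)
    have "delta (\<lambda>c. fst (eR V s c)) c = 0"
    proof (cases "length c = Suc (Suc 0)")
      case False
      show ?thesis by (rule delta_length[OF _ False]) (auto simp: eR_def)
    next
      case 2: True
      then obtain x y where c: "c = [x, y]" by (auto simp: length_Suc_conv)
      have xy: "x \<in> V" "y \<in> nb x" "x \<in> topspace X" "y \<in> topspace X" using True c by (auto simp: chain_def)
      have "y \<in> V" by (rule nb_sub[OF V xy(1,2)])
      moreover have "s y = s x" by (rule constant_sheaf_int_locally_constant[OF V s xy(1,2)])
      ultimately show ?thesis using xy by (simp add: c eR_def chain_singleton)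
    qed
    moreover have "ratmod_of (fst (eR V s c)) = 0" by (simp add: eR_def ratmod_of_eq_0_iff)
    ultimately show ?thesis using True by (simp add: dR_def snd0 zero_prod_def)
  qed (auto simp: dR_def)
qed

text \<open>The second component of the differential at [x] says that the value at \<open>x\<close>
  is an integer, the first component at [x, y] that the value at \<open>y\<close> is the
  same.\<close>

lemma eR_exact:
  assumes x: "x \<in> topspace X" and f: "f \<in> carrier (sec (R 0) (nb x))" and df: "dR 0 (nb x) f = 0"
  shows "\<exists>s\<in>carrier (sec (constant_sheaf_int X) (nb x)). eR (nb x) s = f"
proof -
  have snd0: "snd (f c) = 0" for c using R_D(4)[OF f, of c] R_D(1)[OF f, of c] by (cases c) auto
  have f0: "f [] = 0" by (rule R_D(1)[OF f]) simp
  have "dR 0 (nb x) f [x] = 0" using df by simp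
  then have "ratmod_of (fst (f [x])) = 0"
    using x by (simp add: dR_def chain_singleton snd0 zero_prod_def)
  then obtain k where k: "fst (f [x]) = of_int k" by (auto simp: ratmod_of_eq_0_iff elim: Ints_cases)
  have fy: "fst (f [y]) = of_int k" if y: "y \<in> nb x" for y
  proof -
    have "y \<in> topspace X" by (rule nb_sub[OF openin_topspace x y])
    then have "chain [x, y]" using x y by (simp add: chain_def)
    moreover have "dR 0 (nb x) f [x, y] = 0" using df by simp
    ultimately have "delta (\<lambda>c. fst (f c)) [x, y] = 0" by (auto simp: dR_def zero_prod_def)
    then show ?thesis using k f0 by simp
  qed
  have "eR (nb x) (\<lambda>y\<in>nb x. k) c = f c" for c
  proof (cases "chain c \<and> length c = 1 \<and> hd c \<in> nb x")
    case True
    then obtain y where "c = [y]" by (auto simp: length_Suc_conv)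
    then show ?thesis using True fy[of y] snd0 by (simp add: eR_def prod_eq_iff)
  next
    case False
    then have "f c = 0"
      using R_D(1,2)[OF f, of c] R_D(3)[OF f, of c] snd0[of c] by (cases "length c = 1") (auto simp: prod_eq_iff)
    then show ?thesis using False by (auto simp: eR_def)
  qed
  then show ?thesis using const_in_constant_sheaf by (intro bexI[of _ "\<lambda>y\<in>nb x. k"]) auto
qed

text \<open>A section of \<open>R n\<close> vanishes off the lists of length at most
  \<open>n + 1\<close> over the finite space and has values in a countable group. Countability is
  what lets the sections be coded by natural numbers.\<close>

lemma R_countable: "\<exists>S. countable S \<and> (\<forall>n V. carrier (sec (R n) V) \<subseteq> S)"
proof -
  define C where "C n = {c. set c \<subseteq> topspace X \<and> length c \<le> Suc n}" for n
  define S where "S n = {f :: 'p list \<Rightarrow> rat \<times> ratmod. \<forall>c. c \<notin> C n \<longrightarrow> f c = 0}" for n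
  have "countable (range ratmod_of)" by simp
  moreover have "range ratmod_of = (UNIV :: ratmod set)" using ratmod_of_surj by (metis surj_def)
  ultimately have "countable (UNIV :: ratmod set)" by simp
  then have "countable ((UNIV :: rat set) \<times> (UNIV :: ratmod set))" by (intro countable_SIGMA) auto
  then have *: "countable (UNIV :: (rat \<times> ratmod) set)" by simp
  have "countable (S n)" for n
  proof -
    have "finite (C n)" unfolding C_def by (rule finite_lists_length_le[OF finite_X])
    then obtain cs where cs: "set cs = C n" using finite_list by blast
    have "countable ((\<lambda>f. map f cs) ` S n)"
      by (rule countable_subset[OF _ countable_lists[OF *]]) auto
    moreover have "inj_on (\<lambda>f. map f cs) (S n)"
    proof (rule inj_onI, rule ext)
      fix f f' c assume f: "f \<in> S n" "f' \<in> S n" "map f cs = map f' cs"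
      show "f c = f' c"
      proof (cases "c \<in> C n")
        case True
        then show ?thesis using f(3) cs by simp
      next
        case False
        then show ?thesis using f(1,2) by (simp add: S_def)
      qed
    qed
    ultimately show ?thesis by (rule countable_image_inj_on)
  qed
  moreover have "carrier (sec (R n) V) \<subseteq> S n" for n V
  proof
    fix f assume f: "f \<in> carrier (sec (R n) V)"
    have "f c = 0" if "c \<notin> C n" for c
    proof (cases "chain c")
      case True
      then have "\<not> length c \<le> Suc n" using that by (simp add: C_def chain_def)
      then show ?thesis using R_D(3,4)[OF f, of c] by (simp add: prod_eq_iff)
    qed (rule R_D(1)[OF f])
    then show "f \<in> S n" by (simp add: S_def)
  qed
  ultimately have "countable (\<Union>n. S n)" "\<forall>n V. carrier (sec (R n) V) \<subseteq> (\<Union>n. S n)" by blast+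
  then show ?thesis by (intro exI conjI)
qed

theorem injective_resolution_constant_sheaf:
  "\<exists>(I :: nat \<Rightarrow> ('p, ('p, 'p \<Rightarrow> int) sheaf_universe) presheaf) d e. injective_resolution X (constant_sheaf_int X) e I d"
proof -
  obtain S where S: "countable S" "\<And>n V. carrier (sec (R n) V) \<subseteq> S" using R_countable by blast
  \<comment> \<open>A section is stored as its number, in the right summand of the universe. One
    enumeration serves all degrees and open sets, so a single inverse \<open>g\<close>
    suffices.\<close>
  define e :: "('p list \<Rightarrow> rat \<times> ratmod) \<Rightarrow> ('p, 'p \<Rightarrow> int) sheaf_universe" where
    "e f = (\<lambda>_. Inr (to_nat_on S f))" for f
  define g :: "('p, 'p \<Rightarrow> int) sheaf_universe \<Rightarrow> 'p list \<Rightarrow> rat \<times> ratmod" where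
    "g u = from_nat_into S (projr (u undefined))" for u
  have g: "g (e f) = f" if f: "f \<in> carrier (sec (R n) V)" for f n V
    using from_nat_into_to_nat_on[OF S(1) subsetD[OF S(2) f]] by (simp add: e_def g_def)
  define I where "I n = transport e g (R n)" for n
  define d where "d n V u = e (dR n V (g u))" for n V u
  have sh: "sheaf X (I n)" for n unfolding I_def by (rule sheaf_transport[OF sheaf_R]) (rule g)
  have inj: "injective_sheaf X (I n)" for n
    unfolding I_def R_def
    by (rule injective_transport_skyscraper[OF divisible_stalk]) (rule g[unfolded R_def])
  have d_hom: "sheaf_hom X (I n) (I (Suc n)) (d n)" for n
    unfolding sheaf_hom_def
  proof (intro conjI allI impI ballI)
    fix V assume V: "openin X V"
    show "d n V \<in> hom (sec (I n) V) (sec (I (Suc n)) V)"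
    proof (rule homI)
      fix u assume "u \<in> carrier (sec (I n) V)"
      then obtain f where f: "u = e f" "f \<in> carrier (sec (R n) V)" unfolding I_def transport_simps by (rule imageE)
      then show "d n V u \<in> carrier (sec (I (Suc n)) V)"
        using dR_carrier[OF V f(2)] by (simp add: I_def d_def g[OF f(2)])
      fix v assume "v \<in> carrier (sec (I n) V)"
      then obtain f' where f': "v = e f'" "f' \<in> carrier (sec (R n) V)" unfolding I_def transport_simps by (rule imageE)
      have ff': "f + f' \<in> carrier (sec (R n) V)"
        using comm_groupE(1)[OF presheaf_rules(1)[OF sheaf_presheaf[OF sheaf_R] V] f(2) f'(2)] by simp
      have "dR n V (f + f') = dR n V f + dR n V f'"
        using hom_mult[OF sheaf_hom_rules(1)[OF dR_hom V] f(2) f'(2)] by simp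
      then show "d n V (u \<otimes>\<^bsub>sec (I n) V\<^esub> v) = d n V u \<otimes>\<^bsub>sec (I (Suc n)) V\<^esub> d n V v"
        by (simp add: I_def d_def f(1) f'(1) g[OF f(2)] g[OF f'(2)] g[OF ff'] g[OF dR_carrier[OF V f(2)]]
            g[OF dR_carrier[OF V f'(2)]])
    qed
  next
    fix V W u assume V: "openin X V \<and> openin X W \<and> W \<subseteq> V" and u: "u \<in> carrier (sec (I n) V)"
    then have o: "openin X V" "openin X W" "W \<subseteq> V" by blast+
    obtain f where f: "u = e f" "f \<in> carrier (sec (R n) V)" using u unfolding I_def transport_simps by (rule imageE)
    have "res (R (Suc n)) V W (dR n V f) = dR n W (res (R n) V W f)"
      by (rule sheaf_hom_rules(2)[OF dR_hom o f(2)])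
    moreover have "g (e (res (R n) V W f)) = res (R n) V W f"
      by (rule g[OF presheaf_rules(5)[OF sheaf_presheaf[OF sheaf_R] o f(2)]])
    ultimately show "res (I (Suc n)) V W (d n V u) = d n W (res (I n) V W u)"
      unfolding I_def d_def f(1) transport_simps(4) g[OF f(2)] g[OF dR_carrier[OF o(1) f(2)]] by simp
  qed
  define e0 where "e0 V s = e (eR V s)" for V s
  have eR_carrier: "eR V s \<in> carrier (sec (R 0) V)" if "openin X V" "s \<in> carrier (sec (constant_sheaf_int X) V)" for V s
    by (rule hom_in_carrier[OF sheaf_hom_rules(1)[OF eR_hom that(1)] that(2)])
  have e0_mono: "sheaf_mono X (constant_sheaf_int X) (I 0) e0"
    unfolding sheaf_mono_def sheaf_hom_def
  proof (intro conjI allI impI ballI)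
    fix V assume V: "openin X V"
    show "e0 V \<in> hom (sec (constant_sheaf_int X) V) (sec (I 0) V)"
    proof (rule homI)
      fix s t assume s: "s \<in> carrier (sec (constant_sheaf_int X) V)" and t: "t \<in> carrier (sec (constant_sheaf_int X) V)"
      show "e0 V s \<in> carrier (sec (I 0) V)" using eR_carrier[OF V s] by (simp add: I_def e0_def)
      show "e0 V (s \<otimes>\<^bsub>sec (constant_sheaf_int X) V\<^esub> t) = e0 V s \<otimes>\<^bsub>sec (I 0) V\<^esub> e0 V t"
        unfolding I_def e0_def transport_simps(2) g[OF eR_carrier[OF V s]] g[OF eR_carrier[OF V t]]
          hom_mult[OF sheaf_hom_rules(1)[OF eR_hom V] s t] ..
    qed
    show "inj_on (e0 V) (carrier (sec (constant_sheaf_int X) V))"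
    proof (rule inj_onI)
      fix s t assume s: "s \<in> carrier (sec (constant_sheaf_int X) V)" and t: "t \<in> carrier (sec (constant_sheaf_int X) V)"
        and "e0 V s = e0 V t"
      then have "g (e (eR V s)) = g (e (eR V t))" by (simp add: e0_def)
      then have "eR V s = eR V t" by (simp only: g[OF eR_carrier[OF V s]] g[OF eR_carrier[OF V t]])
      moreover have "inj_on (eR V) (carrier (sec (constant_sheaf_int X) V))"
        using eR_mono V by (simp add: sheaf_mono_def)
      ultimately show "s = t" using s t by (meson inj_onD)
    qed
  next
    fix V W s assume V: "openin X V \<and> openin X W \<and> W \<subseteq> V" and s: "s \<in> carrier (sec (constant_sheaf_int X) V)"
    then have o: "openin X V" "openin X W" "W \<subseteq> V" by blast+
    show "res (I 0) V W (e0 V s) = e0 W (res (constant_sheaf_int X) V W s)"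
      unfolding I_def e0_def transport_simps(4) g[OF eR_carrier[OF o(1) s]] sheaf_hom_rules(2)[OF eR_hom o s] ..
  qed
  have ex0: "sheaf_exact X (constant_sheaf_int X) (R 0) (R (Suc 0)) eR (dR 0)"
    by (rule sheaf_exactI[OF sheaf_presheaf[OF sheaf_R] sheaf_R eR_hom dR_hom])
      (simp_all add: dR_eR eR_exact)
  have exn: "sheaf_exact X (R n) (R (Suc n)) (R (Suc (Suc n))) (dR n) (dR (Suc n))" for n
    by (rule sheaf_exactI[OF sheaf_presheaf[OF sheaf_R] sheaf_R dR_hom dR_hom])
      (simp_all add: dR_dR dR_exact)
  have "sheaf_exact X (constant_sheaf_int X) (I 0) (I (Suc 0)) e0 (d 0)"
    unfolding I_def d_def[abs_def]
    by (rule sheaf_exact_transport[where a = "\<lambda>s. s", OF ex0 sheaf_presheaf[OF sheaf_R] dR_hom sheaf_presheaf[OF sheaf_R]])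
      (simp_all add: g e0_def eR_carrier)
  moreover have "sheaf_exact X (I n) (I (Suc n)) (I (Suc (Suc n))) (d n) (d (Suc n))" for n
    unfolding I_def d_def[abs_def]
    by (rule sheaf_exact_transport[where a = e, OF exn sheaf_presheaf[OF sheaf_R] dR_hom sheaf_presheaf[OF sheaf_R]])
      (simp_all add: g dR_carrier)
  ultimately have "injective_resolution X (constant_sheaf_int X) e0 I d"
    unfolding injective_resolution_def using inj d_hom e0_mono by simp
  then show ?thesis by blast
qed

end

section \<open>Cech cohomology and the nerve\<close>

text \<open>Here \<open>V_min\<close> forces every section of the constant sheaf on an intersection
  to be constant.\<close>

locale minimal_cover =
  fixes X :: "'p topology" and V :: "nat \<Rightarrow> 'p set" and A :: "nat set"
  assumes finite_A: "finite A" and V_open: "k \<in> A \<Longrightarrow> openin X (V k)"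
    and V_min: "J \<subseteq> A \<Longrightarrow> J \<noteq> {} \<Longrightarrow> (\<Inter>k\<in>J. V k) \<noteq> {} \<Longrightarrow> \<exists>x. x \<in> (\<Inter>k\<in>J. V k) \<and> (\<Inter>k\<in>J. V k) = min_nbhd X x"
begin

abbreviation "Z \<equiv> constant_sheaf_int X"
abbreviation "C \<equiv> cech_cochains Z A V"
abbreviation "VI J \<equiv> \<Inter>k\<in>J. V k"

text \<open>A nonempty intersection is a minimal neighbourhood, where locally constant functions are
  constant. An empty one has a single section, which is the constant function for every
  \<open>c\<close>.\<close>

lemma sections_constant:
  assumes "J \<subseteq> A" "J \<noteq> {}"
  shows "carrier (sec Z (VI J)) = range (\<lambda>c. \<lambda>x\<in>VI J. c)"
proof
  show "range (\<lambda>c. \<lambda>x\<in>VI J. c) \<subseteq> carrier (sec Z (VI J))"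
    using const_in_constant_sheaf by blast
  show "carrier (sec Z (VI J)) \<subseteq> range (\<lambda>c. \<lambda>x\<in>VI J. c)"
  proof
    fix s assume s: "s \<in> carrier (sec Z (VI J))"
    have ext: "s \<in> extensional (VI J)" using s by (simp add: constant_sheaf_int_carrier)
    show "s \<in> range (\<lambda>c. \<lambda>x\<in>VI J. c)"
    proof (cases "VI J = {}")
      case True
      then have "s = (\<lambda>x\<in>VI J. 0)" using ext by (auto simp: extensional_def)
      then show ?thesis by (rule range_eqI)
    next
      case False
      then obtain x where x: "x \<in> VI J" "VI J = min_nbhd X x" using V_min[OF assms] by blast
      have "finite J" using assms(1) finite_A finite_subset by blast
      then have op: "openin X (VI J)"
        using assms V_open by (intro openin_Inter) auto
      have "s y = s x" if y: "y \<in> VI J" for y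
        by (rule constant_sheaf_int_locally_constant[OF op s x(1)]) (use y x(2) in blast)
      then have "s = (\<lambda>y\<in>VI J. s x)" using ext by (auto simp: extensional_def)
      then show ?thesis by (rule range_eqI)
    qed
  qed
qed

lemma comm_group_sec:
  assumes "J \<subseteq> A" "J \<noteq> {}"
  shows "comm_group (sec Z (VI J))"
proof (rule comm_groupI)
  fix s t u assume "s \<in> carrier (sec Z (VI J))" "t \<in> carrier (sec Z (VI J))"
  then obtain a b where ab: "s = (\<lambda>x\<in>VI J. a)" "t = (\<lambda>x\<in>VI J. b)" unfolding sections_constant[OF assms] by blast
  have "s \<otimes>\<^bsub>sec Z (VI J)\<^esub> t = (\<lambda>x\<in>VI J. a + b)" by (auto simp: ab)
  then show "s \<otimes>\<^bsub>sec Z (VI J)\<^esub> t \<in> carrier (sec Z (VI J))" using const_in_constant_sheaf by metis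
next
  fix s assume "s \<in> carrier (sec Z (VI J))"
  then obtain a where a: "s = (\<lambda>x\<in>VI J. a)" unfolding sections_constant[OF assms] by blast
  show "\<one>\<^bsub>sec Z (VI J)\<^esub> \<otimes>\<^bsub>sec Z (VI J)\<^esub> s = s" by (auto simp: a)
  have "(\<lambda>x\<in>VI J. - a) \<otimes>\<^bsub>sec Z (VI J)\<^esub> s = \<one>\<^bsub>sec Z (VI J)\<^esub>" by (auto simp: a)
  then show "\<exists>t\<in>carrier (sec Z (VI J)). t \<otimes>\<^bsub>sec Z (VI J)\<^esub> s = \<one>\<^bsub>sec Z (VI J)\<^esub>"
    using const_in_constant_sheaf by blast
next
  show "\<one>\<^bsub>sec Z (VI J)\<^esub> \<in> carrier (sec Z (VI J))"
    unfolding constant_sheaf_int_simps by (rule const_in_constant_sheaf)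
qed (auto simp: fun_eq_iff)

lemma inv_const:
  assumes "J \<subseteq> A" "J \<noteq> {}"
  shows "inv\<^bsub>sec Z (VI J)\<^esub> (\<lambda>x\<in>VI J. c) = (\<lambda>x\<in>VI J. - c)"
proof -
  interpret comm_group "sec Z (VI J)" by (rule comm_group_sec[OF assms])
  have "(\<lambda>x\<in>VI J. - c) \<otimes>\<^bsub>sec Z (VI J)\<^esub> (\<lambda>x\<in>VI J. c) = \<one>\<^bsub>sec Z (VI J)\<^esub>" by (auto simp: fun_eq_iff)
  then show ?thesis using const_in_constant_sheaf by (intro inv_equality)
qed

lemma sign_pow_const:
  assumes "J \<subseteq> A" "J \<noteq> {}"
  shows "(\<lambda>x\<in>VI J. c) [^]\<^bsub>sec Z (VI J)\<^esub> face_sign J' k = (\<lambda>x\<in>VI J. face_sign J' k * c)"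
proof -
  interpret comm_group "sec Z (VI J)" by (rule comm_group_sec[OF assms])
  have c: "(\<lambda>x\<in>VI J. c) \<in> carrier (sec Z (VI J))" by (rule const_in_constant_sheaf)
  note p1 = int_pow_1[OF c]
  have p2: "(\<lambda>x\<in>VI J. c) [^]\<^bsub>sec Z (VI J)\<^esub> (- 1 :: int) = (\<lambda>x\<in>VI J. - c)"
    unfolding int_pow_neg[OF c] p1 by (rule inv_const[OF assms])
  consider "face_sign J' k = 1" | "face_sign J' k = -1"
    unfolding face_sign_def by (metis minus_one_power_iff)
  then show ?thesis
  proof cases
    case 1
    show ?thesis unfolding 1 mult_1 by (rule p1)
  next
    case 2
    show ?thesis unfolding 2 mult_minus1 by (rule p2)
  qed
qed

lemma finprod_constant_sections:
  assumes "J \<subseteq> A" "J \<noteq> {}" "finite B"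
  shows "finprod (sec Z (VI J)) (\<lambda>k. \<lambda>x\<in>VI J. f k) B = (\<lambda>x\<in>VI J. sum f B)"
proof -
  interpret comm_group "sec Z (VI J)" by (rule comm_group_sec[OF assms(1,2)])
  show ?thesis using assms(3)
  proof (induction B rule: finite_induct)
    case (insert k B)
    have "finprod (sec Z (VI J)) (\<lambda>k. \<lambda>x\<in>VI J. f k) (insert k B) =
        (\<lambda>x\<in>VI J. f k) \<otimes>\<^bsub>sec Z (VI J)\<^esub> finprod (sec Z (VI J)) (\<lambda>k. \<lambda>x\<in>VI J. f k) B"
      using insert.hyps const_in_constant_sheaf by (intro finprod_insert) auto
    also have "\<dots> = (\<lambda>x\<in>VI J. sum f (insert k B))"
      unfolding insert.IH using insert.hyps by (auto simp: fun_eq_iff)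
    finally show ?case .
  qed simp
qed

text \<open>Both complexes are quotients of the integer functions on all index sets:
  \<open>\<kappa>\<close> maps onto the Cech cochains, \<open>\<rho>\<close> onto the simplicial
  ones, and the same formula \<open>E\<close> induces both coboundaries. They identify the same
  functions, so the two quotients agree.\<close>

definition \<kappa> :: "nat \<Rightarrow> (nat set \<Rightarrow> int) \<Rightarrow> nat set \<Rightarrow> 'p \<Rightarrow> int" where
  "\<kappa> p c = (\<lambda>J\<in>subsets_dim p A. \<lambda>x\<in>VI J. c J)"

definition \<rho> :: "nat \<Rightarrow> (nat set \<Rightarrow> int) \<Rightarrow> nat set \<Rightarrow> int" where
  "\<rho> p c = restrict c (simplices (nerve A V) p)"

definition E :: "(nat set \<Rightarrow> int) \<Rightarrow> nat set \<Rightarrow> int" where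
  "E c J = (\<Sum>k\<in>J. face_sign J k * c (J - {k}))"

lemma subsets_dimD: "J \<in> subsets_dim p A \<Longrightarrow> J \<subseteq> A \<and> J \<noteq> {} \<and> finite J"
  by (auto simp: subsets_dim_def)

lemma carrier_C: "carrier (C p) = range (\<kappa> p)"
proof
  show "range (\<kappa> p) \<subseteq> carrier (C p)"
    using const_in_constant_sheaf by (auto simp: cech_cochains_def \<kappa>_def)
  show "carrier (C p) \<subseteq> range (\<kappa> p)"
  proof
    fix s assume s: "s \<in> carrier (C p)"
    then have "\<exists>c. s J = (\<lambda>x\<in>VI J. c)" if "J \<in> subsets_dim p A" for J
      using sections_constant[of J] subsetD[OF equalityD1[OF sections_constant[of J]]] subsets_dimD[OF that] that
      by (auto simp: cech_cochains_def PiE_iff)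
    then obtain c where c: "\<And>J. J \<in> subsets_dim p A \<Longrightarrow> s J = (\<lambda>x\<in>VI J. c J)" by metis
    have "s \<in> extensional (subsets_dim p A)" using s by (auto simp: cech_cochains_def PiE_def)
    then have "s = \<kappa> p c" using c by (auto simp: \<kappa>_def extensional_def fun_eq_iff)
    then show "s \<in> range (\<kappa> p)" by blast
  qed
qed

lemma comm_group_C: "comm_group (C p)"
  unfolding cech_cochains_def
proof (rule comm_group_product_group)
  show "comm_group (sec Z (VI J))" if "J \<in> subsets_dim p A" for J
    using subsets_dimD[OF that] by (intro comm_group_sec) auto
qed

lemma \<kappa>_add: "\<kappa> p c \<otimes>\<^bsub>C p\<^esub> \<kappa> p c' = \<kappa> p (c + c')"
  by (auto simp: cech_cochains_def \<kappa>_def fun_eq_iff)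

lemma \<kappa>_one: "\<one>\<^bsub>C p\<^esub> = \<kappa> p 0"
  by (auto simp: cech_cochains_def \<kappa>_def fun_eq_iff)

lemma \<kappa>_inv: "inv\<^bsub>C p\<^esub> (\<kappa> p c) = \<kappa> p (- c)"
proof -
  interpret comm_group "C p" by (rule comm_group_C)
  have "\<kappa> p (- c) \<otimes>\<^bsub>C p\<^esub> \<kappa> p c = \<one>\<^bsub>C p\<^esub>" by (simp add: \<kappa>_add \<kappa>_one)
  then show ?thesis using carrier_C by (intro inv_equality) auto
qed

lemma simplices_nerve_iff: "J \<in> simplices (nerve A V) p \<longleftrightarrow> J \<in> subsets_dim p A \<and> VI J \<noteq> {}"
  unfolding simplices_def nerve_def subsets_dim_def by fastforce

text \<open>On an empty intersection all constants are the same function, so \<open>\<kappa>\<close>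
  forgets exactly the values outside the nerve, as \<open>\<rho>\<close> does.\<close>

lemma \<kappa>_eq_iff: "\<kappa> p c = \<kappa> p c' \<longleftrightarrow> \<rho> p c = \<rho> p c'"
proof -
  have "\<kappa> p c = \<kappa> p c' \<longleftrightarrow> (\<forall>J\<in>subsets_dim p A. (\<lambda>x\<in>VI J. c J) = (\<lambda>x\<in>VI J. c' J))"
    by (auto simp: \<kappa>_def fun_eq_iff)
  also have "\<dots> \<longleftrightarrow> (\<forall>J\<in>subsets_dim p A. VI J \<noteq> {} \<longrightarrow> c J = c' J)"
  proof (intro ball_cong HOL.refl)
    fix J
    show "(\<lambda>x\<in>VI J. c J) = (\<lambda>x\<in>VI J. c' J) \<longleftrightarrow> (VI J \<noteq> {} \<longrightarrow> c J = c' J)"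
      by (cases "VI J = {}") (auto simp: fun_eq_iff)
  qed
  also have "\<dots> \<longleftrightarrow> \<rho> p c = \<rho> p c'"
    using simplices_nerve_iff[of _ p] by (auto simp: \<rho>_def fun_eq_iff restrict_def)
  finally show ?thesis .
qed

lemma cech_coboundary_\<kappa>: "cech_coboundary Z A V p (\<kappa> p c) = \<kappa> (Suc p) (E c)"
proof
  fix J
  show "cech_coboundary Z A V p (\<kappa> p c) J = \<kappa> (Suc p) (E c) J"
  proof (cases "J \<in> subsets_dim (Suc p) A")
    case True
    then have J: "J \<subseteq> A" "J \<noteq> {}" "finite J" using subsets_dimD by blast+
    interpret comm_group "sec Z (VI J)" by (rule comm_group_sec[OF J(1,2)])
    have "res Z (VI (J - {k})) (VI J) (\<kappa> p c (J - {k})) [^]\<^bsub>sec Z (VI J)\<^esub> face_sign J k =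
        (\<lambda>x\<in>VI J. face_sign J k * c (J - {k}))" if k: "k \<in> J" for k
    proof -
      have "J - {k} \<in> subsets_dim p A" using True k by (auto simp: subsets_dim_def)
      then have "res Z (VI (J - {k})) (VI J) (\<kappa> p c (J - {k})) = (\<lambda>x\<in>VI J. c (J - {k}))"
        by (auto simp: \<kappa>_def fun_eq_iff)
      then show ?thesis using sign_pow_const[OF J(1,2)] by simp
    qed
    then have "finprod (sec Z (VI J)) (\<lambda>k. res Z (VI (J - {k})) (VI J) (\<kappa> p c (J - {k})) [^]\<^bsub>sec Z (VI J)\<^esub> face_sign J k) J =
        finprod (sec Z (VI J)) (\<lambda>k. \<lambda>x\<in>VI J. face_sign J k * c (J - {k})) J"
      using const_in_constant_sheaf by (intro finprod_cong') auto
    also have "\<dots> = (\<lambda>x\<in>VI J. E c J)" unfolding E_def by (rule finprod_constant_sections[OF J])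
    finally show ?thesis using True by (simp add: cech_coboundary_def \<kappa>_def)
  qed (simp add: cech_coboundary_def \<kappa>_def)
qed

lemma simplicial_coboundary_\<rho>: "simplicial_coboundary (nerve A V) p (\<rho> p c) = \<rho> (Suc p) (E c)"
proof
  fix J
  show "simplicial_coboundary (nerve A V) p (\<rho> p c) J = \<rho> (Suc p) (E c) J"
  proof (cases "J \<in> simplices (nerve A V) (Suc p)")
    case True
    have "J - {k} \<in> simplices (nerve A V) p" if "k \<in> J" for k
    proof -
      have "J - {k} \<in> subsets_dim p A" using True that by (auto simp: simplices_nerve_iff subsets_dim_def)
      moreover have "VI J \<subseteq> VI (J - {k})" by blast
      ultimately show ?thesis using True unfolding simplices_nerve_iff by blast
    qed
    then show ?thesis using True by (simp add: simplicial_coboundary_def \<rho>_def E_def)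
  qed (simp add: simplicial_coboundary_def \<rho>_def)
qed

theorem cech_cohomology_nerve:
  shows "group (cech_cohomology Z A V i)" and "cech_cohomology Z A V i \<cong> simplicial_cohomology (nerve A V) i"
proof -
  let ?d = "cech_coboundary Z A V" and ?L = "nerve A V"
  let ?C' = "simplicial_cochains ?L" and ?d' = "simplicial_coboundary ?L"
  have "J' \<in> ?L" if "J \<in> ?L" "J' \<subseteq> J" for J J'
  proof -
    have "VI J \<subseteq> VI J'" using that(2) by blast
    then show ?thesis using that unfolding nerve_def by blast
  qed
  then have C': "cochain_complex ?C' ?d'" by (rule cochain_complex_simplicial)
  have carrier_C': "carrier (?C' p) = range (\<rho> p)" for p
  proof -
    have "b = \<rho> p b" if "b \<in> carrier (?C' p)" for b
      using that by (simp add: simplicial_cochains_def PiE_def \<rho>_def extensional_restrict)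
    moreover have "\<rho> p b \<in> carrier (?C' p)" for b by (simp add: simplicial_cochains_def \<rho>_def)
    ultimately show ?thesis by blast
  qed
  have \<rho>_add: "\<rho> p c \<otimes>\<^bsub>?C' p\<^esub> \<rho> p c' = \<rho> p (c + c')" and \<rho>_one: "\<one>\<^bsub>?C' p\<^esub> = \<rho> p 0" for p c c'
    by (auto simp: simplicial_cochains_def \<rho>_def fun_eq_iff)
  have \<rho>_inv: "inv\<^bsub>?C' p\<^esub> (\<rho> p c) = \<rho> p (- c)" for p c
  proof -
    interpret comm_group "?C' p" by (rule comm_group_simplicial_cochains)
    have "\<rho> p (- c) \<otimes>\<^bsub>?C' p\<^esub> \<rho> p c = \<one>\<^bsub>?C' p\<^esub>" by (simp add: \<rho>_add \<rho>_one)
    then show ?thesis using carrier_C' by (intro inv_equality) auto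
  qed
  have one_iff: "\<kappa> p c = \<one>\<^bsub>C p\<^esub> \<longleftrightarrow> \<rho> p c = \<one>\<^bsub>?C' p\<^esub>" for p c
    unfolding \<kappa>_one \<rho>_one by (rule \<kappa>_eq_iff)
  have C: "cochain_complex C ?d"
    unfolding cochain_complex_def
  proof (intro allI conjI ballI comm_group_C)
    fix p
    show "?d p \<in> hom (C p) (C (Suc p))"
    proof (rule homI)
      fix s t assume "s \<in> carrier (C p)" "t \<in> carrier (C p)"
      then obtain c c' where s: "s = \<kappa> p c" "t = \<kappa> p c'" unfolding carrier_C by blast
      have "E (c + c') = E c + E c'" by (auto simp: E_def fun_eq_iff sum.distrib algebra_simps)
      then show "?d p (s \<otimes>\<^bsub>C p\<^esub> t) = ?d p s \<otimes>\<^bsub>C (Suc p)\<^esub> ?d p t"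
        by (simp add: s \<kappa>_add cech_coboundary_\<kappa>)
      show "?d p s \<in> carrier (C (Suc p))" by (simp add: s cech_coboundary_\<kappa> carrier_C)
    qed
    fix s assume "s \<in> carrier (C p)"
    then obtain c where s: "s = \<kappa> p c" unfolding carrier_C by blast
    have "?d' (Suc p) (?d' p (\<rho> p c)) = \<one>\<^bsub>?C' (Suc (Suc p))\<^esub>"
      using C' carrier_C' unfolding cochain_complex_def by blast
    then have "\<rho> (Suc (Suc p)) (E (E c)) = \<one>\<^bsub>?C' (Suc (Suc p))\<^esub>" by (simp only: simplicial_coboundary_\<rho>)
    then show "?d (Suc p) (?d p s) = \<one>\<^bsub>C (Suc (Suc p))\<^esub>"
      unfolding s cech_coboundary_\<kappa> one_iff .
  qed
  \<comment> \<open>Cocycles are related if they come from one and the same integer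
    function.\<close>
  define R where "R a b \<longleftrightarrow> (\<exists>c. a = \<kappa> i c \<and> b = \<rho> i c \<and> \<kappa> (Suc i) (E c) = \<one>\<^bsub>C (Suc i)\<^esub>)" for a b
  have 1: "a \<in> carrier (C i) \<and> ?d i a = \<one>\<^bsub>C (Suc i)\<^esub> \<and> b \<in> carrier (?C' i) \<and> ?d' i b = \<one>\<^bsub>?C' (Suc i)\<^esub>"
    if R: "R a b" for a b
  proof -
    obtain c where c: "a = \<kappa> i c" "b = \<rho> i c" "\<kappa> (Suc i) (E c) = \<one>\<^bsub>C (Suc i)\<^esub>" using R unfolding R_def by blast
    show ?thesis
      using c(3) c(3)[unfolded one_iff]
      unfolding c(1,2) cech_coboundary_\<kappa> simplicial_coboundary_\<rho> carrier_C carrier_C' by blast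
  qed
  have E_add: "E (c + c') = E c + E c'" and E_uminus: "E (- c) = - E c" for c c'
    by (auto simp: E_def fun_eq_iff sum.distrib sum_negf algebra_simps)
  have 2: "R (a \<otimes>\<^bsub>C i\<^esub> a') (b \<otimes>\<^bsub>?C' i\<^esub> b')" if R: "R a b" "R a' b'" for a b a' b'
  proof -
    obtain c where c: "a = \<kappa> i c" "b = \<rho> i c" "\<kappa> (Suc i) (E c) = \<one>\<^bsub>C (Suc i)\<^esub>" using R(1) unfolding R_def by blast
    obtain c' where c': "a' = \<kappa> i c'" "b' = \<rho> i c'" "\<kappa> (Suc i) (E c') = \<one>\<^bsub>C (Suc i)\<^esub>" using R(2) unfolding R_def by blast
    interpret comm_group "C (Suc i)" by (rule comm_group_C)
    have "\<kappa> (Suc i) (E (c + c')) = \<one>\<^bsub>C (Suc i)\<^esub>"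
      unfolding E_add \<kappa>_add[symmetric] c(3) c'(3) by simp
    then show ?thesis unfolding R_def c(1,2) c'(1,2) \<kappa>_add \<rho>_add by blast
  qed
  have 3: "R (inv\<^bsub>C i\<^esub> a) (inv\<^bsub>?C' i\<^esub> b)" if R: "R a b" for a b
  proof -
    obtain c where c: "a = \<kappa> i c" "b = \<rho> i c" "\<kappa> (Suc i) (E c) = \<one>\<^bsub>C (Suc i)\<^esub>" using R unfolding R_def by blast
    interpret comm_group "C (Suc i)" by (rule comm_group_C)
    have "\<kappa> (Suc i) (E (- c)) = \<one>\<^bsub>C (Suc i)\<^esub>"
      unfolding E_uminus \<kappa>_inv[symmetric] c(3) by simp
    then show ?thesis unfolding R_def c(1,2) \<kappa>_inv \<rho>_inv by blast
  qed
  have 4: "\<exists>b. R a b" if a: "a \<in> carrier (C i)" "?d i a = \<one>\<^bsub>C (Suc i)\<^esub>" for a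
  proof -
    obtain c where "a = \<kappa> i c" using a(1) unfolding carrier_C by blast
    then show ?thesis using a(2) unfolding R_def by (auto simp: cech_coboundary_\<kappa>)
  qed
  have 5: "\<exists>a. R a b" if b: "b \<in> carrier (?C' i)" "?d' i b = \<one>\<^bsub>?C' (Suc i)\<^esub>" for b
  proof -
    obtain c where c: "b = \<rho> i c" using b(1) unfolding carrier_C' by blast
    then have "\<kappa> (Suc i) (E c) = \<one>\<^bsub>C (Suc i)\<^esub>" using b(2) unfolding one_iff by (simp only: simplicial_coboundary_\<rho>)
    then show ?thesis using c unfolding R_def by blast
  qed
  have 6: "a \<in> coboundaries C ?d i \<longleftrightarrow> b \<in> coboundaries ?C' ?d' i" if R: "R a b" for a b
  proof -
    obtain c where c: "a = \<kappa> i c" "b = \<rho> i c" using R unfolding R_def by blast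
    show ?thesis
    proof (cases i)
      case 0
      then show ?thesis using one_iff[of 0 c] by (simp add: c)
    next
      case (Suc p)
      have "a \<in> coboundaries C ?d i \<longleftrightarrow> (\<exists>c'. \<kappa> i c = \<kappa> i (E c'))"
        unfolding Suc coboundaries.simps carrier_C c by (auto simp: image_iff cech_coboundary_\<kappa> Suc)
      also have "\<dots> \<longleftrightarrow> (\<exists>c'. \<rho> i c = \<rho> i (E c'))" unfolding \<kappa>_eq_iff ..
      also have "\<dots> \<longleftrightarrow> b \<in> coboundaries ?C' ?d' i"
        unfolding Suc coboundaries.simps carrier_C' c by (auto simp: image_iff simplicial_coboundary_\<rho> Suc)
      finally show ?thesis .
    qed
  qed
  note iso = cohomology_iso_of_relation[OF C C', where n = i and R = R, OF 1 2 3 4 5 6]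
  show "group (cech_cohomology Z A V i)"
    unfolding cech_cohomology_def by (rule iso(1))
  show "cech_cohomology Z A V i \<cong> simplicial_cohomology (nerve A V) i"
    unfolding cech_cohomology_def simplicial_cohomology_def by (rule iso(2))
qed

end

section \<open>Spectra of binoids\<close>

text \<open>A prime contains a product exactly if it contains a factor: one direction is the ideal
  property, the other that the complement is a submonoid.\<close>

lemma basic_open_Int:
  assumes M: "binoid M" and f: "f \<in> carrier M" and g: "g \<in> carrier M"
  shows "basic_open M f \<inter> basic_open M g = basic_open M (f \<otimes>\<^bsub>M\<^esub> g)"
proof -
  interpret comm_monoid M using M by (simp add: binoid_def)
  have "f \<otimes>\<^bsub>M\<^esub> g \<notin> P \<longleftrightarrow> f \<notin> P \<and> g \<notin> P" if P: "binoid_prime P M" for P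
  proof -
    have "h \<otimes>\<^bsub>M\<^esub> k \<in> P" if "h \<in> P" "k \<in> carrier M" for h k
      using P that unfolding binoid_prime_def binoid_ideal_def by blast
    then have "f \<in> P \<or> g \<in> P \<Longrightarrow> f \<otimes>\<^bsub>M\<^esub> g \<in> P" using f g m_comm[OF f g] by metis
    moreover have "f \<notin> P \<Longrightarrow> g \<notin> P \<Longrightarrow> f \<otimes>\<^bsub>M\<^esub> g \<notin> P"
      using submonoid.m_closed[of "carrier M - P" M f g] P f g unfolding binoid_prime_def by blast
    ultimately show ?thesis by blast
  qed
  then show ?thesis by (auto simp: basic_open_def binoid_Spec_def)
qed

lemma basic_open_INT:
  assumes M: "binoid M" and "finite J" "J \<noteq> {}" "\<And>k. k \<in> J \<Longrightarrow> f k \<in> carrier M"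
  shows "\<exists>g\<in>carrier M. (\<Inter>k\<in>J. basic_open M (f k)) = basic_open M g"
  using assms(2-)
proof (induction J rule: finite_ne_induct)
  case (insert k J)
  then obtain g where g: "g \<in> carrier M" "(\<Inter>k\<in>J. basic_open M (f k)) = basic_open M g" by auto
  interpret comm_monoid M using M by (simp add: binoid_def)
  have "(\<Inter>k\<in>insert k J. basic_open M (f k)) = basic_open M (f k \<otimes>\<^bsub>M\<^esub> g)"
    using basic_open_Int[OF M _ g(1), of "f k"] insert.prems g(2) by simp
  then show ?case using insert.prems g(1) by (intro bexI[of _ "f k \<otimes>\<^bsub>M\<^esub> g"]) auto
qed auto

text \<open>With only one operation, unions of ideals are ideals, and the complement of a union of
  primes is an intersection of submonoids. So \<open>basic_open M f\<close> has a largest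
  element.\<close>

lemma Union_basic_open:
  assumes "basic_open M f \<noteq> {}"
  shows "\<Union>(basic_open M f) \<in> basic_open M f"
proof -
  let ?P = "\<Union>(basic_open M f)"
  have D: "binoid_ideal P M" "submonoid (carrier M - P) M" "f \<notin> P" if "P \<in> basic_open M f" for P
    using that by (simp_all add: basic_open_def binoid_Spec_def binoid_prime_def)
  obtain P0 where P0: "P0 \<in> basic_open M f" using assms by blast
  have "binoid_ideal ?P M"
    using D(1) P0 unfolding binoid_ideal_def by blast
  moreover have "submonoid (carrier M - ?P) M"
  proof
    show "carrier M - ?P \<subseteq> carrier M" by blast
    show "\<one>\<^bsub>M\<^esub> \<in> carrier M - ?P" using submonoid.one_closed[OF D(2)] P0 by blast
    show "x \<otimes>\<^bsub>M\<^esub> y \<in> carrier M - ?P" if "x \<in> carrier M - ?P" "y \<in> carrier M - ?P" for x y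
      using submonoid.m_closed[OF D(2), of _ x y] that P0 by blast
  qed
  moreover have "f \<notin> ?P" using D(3) by blast
  ultimately show ?thesis by (simp add: basic_open_def binoid_Spec_def binoid_prime_def)
qed

text \<open>Open sets are closed under passing to smaller primes, since this holds for the basic
  ones and survives unions and intersections.\<close>

lemma openin_Spec_Union_basic_open:
  assumes "openin (Spec_topology M) T" "\<Union>(basic_open M f) \<in> T"
  shows "basic_open M f \<subseteq> T"
proof -
  have "generate_topology_on (basic_open M ` carrier M) T"
    using assms(1) by (simp add: Spec_topology_def openin_topology_generated_by_iff)
  then have "\<Union>(basic_open M f) \<in> T \<longrightarrow> basic_open M f \<subseteq> T"
  proof induction
    case (Basis T)
    then show ?case unfolding basic_open_def by blast
  qed blast+
  then show ?thesis using assms(2) by blast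
qed

section \<open>Primes of a simplicial binoid\<close>

lemma simplicial_binoid_mult:
  assumes "finite V" "x \<in> free_carrier V" "y \<in> free_carrier V"
  shows "simplicial_class V K x \<otimes>\<^bsub>simplicial_binoid V K\<^esub> simplicial_class V K y =
    simplicial_class V K (free_add x y)"
proof -
  have mem: "y \<in> simplicial_class V K x \<longleftrightarrow> simplicial_cong V K x y" for x y
    by (simp add: simplicial_class_def)
  have comm: "free_add a b = free_add b a" for a b :: "'a multiset option"
    by (cases a; cases b) auto
  have eq: "simplicial_class V K (free_add x' y') = simplicial_class V K (free_add x y)"
    if xy: "x' \<in> simplicial_class V K x" "y' \<in> simplicial_class V K y" for x' y'
  proof -
    have "simplicial_cong V K (free_add x y) (free_add x' y)"
      using xy assms(3) unfolding mem by (intro simplicial_cong.add)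
    moreover have "x' \<in> free_carrier V"
      using simplicial_cong_carrier[OF assms(1)] xy(1) unfolding mem by blast
    then have "simplicial_cong V K (free_add x' y) (free_add x' y')"
      using simplicial_cong.add[of V K y y' x'] xy(2) unfolding mem comm[of x'] by blast
    ultimately have "simplicial_cong V K (free_add x y) (free_add x' y')"
      by (rule simplicial_cong.trans)
    then show ?thesis
      unfolding simplicial_class_def by (blast intro: simplicial_cong.trans simplicial_cong.sym)
  qed
  have xy: "x \<in> simplicial_class V K x" "y \<in> simplicial_class V K y"
    unfolding mem using assms(2,3) by (auto intro: simplicial_cong.refl)
  have "(\<Union>x'\<in>simplicial_class V K x. \<Union>y'\<in>simplicial_class V K y. simplicial_class V K (free_add x' y')) =
      simplicial_class V K (free_add x y)"
  proof (intro equalityI UN_least)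
    show "simplicial_class V K (free_add x' y') \<subseteq> simplicial_class V K (free_add x y)"
      if "x' \<in> simplicial_class V K x" "y' \<in> simplicial_class V K y" for x' y'
      using eq[OF that] by (rule equalityD1)
    show "simplicial_class V K (free_add x y) \<subseteq>
        (\<Union>x'\<in>simplicial_class V K x. \<Union>y'\<in>simplicial_class V K y. simplicial_class V K (free_add x' y'))"
      by (intro subsetI UN_I[OF xy(1)] UN_I[OF xy(2)])
  qed
  then show ?thesis by (simp add: simplicial_binoid_def)
qed

text \<open>A prime is determined by the generators it contains, so there are at most as many primes
  as subsets of \<open>V\<close>.\<close>

lemma finite_Spec_simplicial_binoid:
  assumes V: "finite V"
  shows "finite (binoid_Spec (simplicial_binoid V K))"
proof -
  let ?M = "simplicial_binoid V K" and ?gen = "simplicial_gen V K"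
  \<comment> \<open>Primality, applied along the multiset: a sum of generators is in
    \<open>P\<close> exactly if one summand is.\<close>
  have mem_iff: "simplicial_class V K (Some m) \<in> P \<longleftrightarrow> (\<exists>v\<in>#m. ?gen v \<in> P)"
    if P: "binoid_prime P ?M" and m: "set_mset m \<subseteq> V" for P m
    using m
  proof (induction m)
    case empty
    have "\<one>\<^bsub>?M\<^esub> \<in> carrier ?M - P" using P submonoid.one_closed by (auto simp: binoid_prime_def)
    then show ?case by (simp add: simplicial_binoid_def)
  next
    case (add v m)
    have in_carrier: "simplicial_class V K (Some a) \<in> carrier ?M" if "set_mset a \<subseteq> V" for a
      using that by (auto simp: simplicial_binoid_def free_carrier_def)
    have "simplicial_class V K (Some (add_mset v m)) = ?gen v \<otimes>\<^bsub>?M\<^esub> simplicial_class V K (Some m)"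
      using simplicial_binoid_mult[OF V, of "Some {#v#}" "Some m" K] add.prems
      by (simp add: simplicial_gen_def free_carrier_def)
    moreover have "?gen v \<otimes>\<^bsub>?M\<^esub> simplicial_class V K (Some m) \<notin> P \<longleftrightarrow> ?gen v \<notin> P \<and> simplicial_class V K (Some m) \<notin> P"
    proof -
      have "P \<in> basic_open ?M f \<inter> basic_open ?M g \<longleftrightarrow> P \<in> basic_open ?M (f \<otimes>\<^bsub>?M\<^esub> g)"
        if "f \<in> carrier ?M" "g \<in> carrier ?M" for f g
        using basic_open_Int[OF binoid_simplicial_binoid[OF V] that] by blast
      from this[of "?gen v" "simplicial_class V K (Some m)"] show ?thesis
        using P in_carrier add.prems by (simp add: basic_open_def binoid_Spec_def simplicial_gen_def)
    qed
    ultimately show ?case using add by auto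
  qed
  have "inj_on (\<lambda>P. {v \<in> V. ?gen v \<in> P}) (binoid_Spec ?M)"
  proof (rule inj_onI)
    fix P Q assume PQ: "P \<in> binoid_Spec ?M" "Q \<in> binoid_Spec ?M" "{v \<in> V. ?gen v \<in> P} = {v \<in> V. ?gen v \<in> Q}"
    then have P: "binoid_prime P ?M" and Q: "binoid_prime Q ?M" by (simp_all add: binoid_Spec_def)
    have "y \<in> P \<longleftrightarrow> y \<in> Q" if y: "y \<in> carrier ?M" for y
    proof -
      obtain x where x: "x \<in> free_carrier V" "y = simplicial_class V K x"
        using y by (auto simp: simplicial_binoid_def)
      show ?thesis
      proof (cases x)
        case None
        then have "y = absorbing ?M" using x by (simp add: simplicial_binoid_def)
        then show ?thesis using P Q by (simp add: binoid_prime_def binoid_ideal_def)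
      next
        case (Some m)
        then have m: "set_mset m \<subseteq> V" using x(1) by (auto simp: free_carrier_def)
        have "(\<exists>v\<in>#m. ?gen v \<in> P) \<longleftrightarrow> (\<exists>v\<in>#m. ?gen v \<in> Q)" using PQ(3) m by blast
        then show ?thesis using mem_iff[OF P m] mem_iff[OF Q m] x(2) Some by simp
      qed
    qed
    moreover have "P \<subseteq> carrier ?M" "Q \<subseteq> carrier ?M"
      using P Q by (simp_all add: binoid_prime_def binoid_ideal_def)
    ultimately show "P = Q" by blast
  qed
  moreover have "finite ((\<lambda>P. {v \<in> V. ?gen v \<in> P}) ` binoid_Spec ?M)"
    by (rule finite_subset[of _ "Pow V"]) (use V in auto)
  ultimately show ?thesis using finite_imageD by blast
qed

theorem corollary2p21:
  fixes n j i :: nat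
    and \<Delta> :: "nat set set"
    and F :: "nat \<Rightarrow> nat set"
    and U :: "nat multiset option set set set"
  assumes "simplicial_complex {1..n} \<Delta>"
    and "openin (punctured_Spec_topology (simplicial_binoid {1..n} \<Delta>)) U"
    and "minimally_covered {1..n} \<Delta> U {1..j} F"
  shows "let X = subtopology (Spec_topology (simplicial_binoid {1..n} \<Delta>)) U;
             \<V> = (\<lambda>k. face_open {1..n} \<Delta> (F k))
         in sheaf_cohomology X (constant_sheaf_int X) i
              \<cong> cech_cohomology (constant_sheaf_int X) {1..j} \<V> i \<and>
            cech_cohomology (constant_sheaf_int X) {1..j} \<V> i
              \<cong> simplicial_cohomology (nerve {1..j} \<V>) i"
proof -
  define M where "M = simplicial_binoid {1..n} \<Delta>"
  define X where "X = subtopology (Spec_topology M) U"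
  define \<V> where "\<V> = (\<lambda>k. face_open {1..n} \<Delta> (F k))"
  define f where "f k = finprod M (simplicial_gen {1..n} \<Delta>) (F k)" for k
  have M: "binoid M" unfolding M_def by (rule binoid_simplicial_binoid) simp
  interpret comm_monoid M using M by (simp add: binoid_def)
  have gen: "simplicial_gen {1..n} \<Delta> v \<in> carrier M" if "v \<in> {1..n}" for v
    using that by (auto simp: M_def simplicial_binoid_def simplicial_gen_def free_carrier_def)
  have f: "f k \<in> carrier M" if k: "k \<in> {1..j}" for k
  proof -
    have "F k \<in> \<Delta>" using assms(3) k unfolding minimally_covered_def by blast
    then have "F k \<subseteq> {1..n}" using assms(1) unfolding simplicial_complex_def by blast
    then show ?thesis unfolding f_def using gen by (intro finprod_closed) auto
  qed
  have \<V>: "\<V> k = basic_open M (f k)" for k by (simp add: \<V>_def f_def face_open_def M_def)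
  have U: "U = (\<Union>k\<in>{1..j}. \<V> k)" using assms(3) unfolding minimally_covered_def \<V>_def by blast
  have open_basic: "openin (Spec_topology M) (basic_open M g)" if "g \<in> carrier M" for g
    unfolding Spec_topology_def by (rule topology_generated_by_Basis) (use that in blast)
  have "\<V> k \<subseteq> topspace (Spec_topology M)" if "k \<in> {1..j}" for k
    unfolding \<V> by (rule openin_subset[OF open_basic[OF f[OF that]]])
  then have "U \<subseteq> topspace (Spec_topology M)" unfolding U by (rule UN_least)
  then have top: "topspace X = U" unfolding X_def by (rule topspace_subtopology_subset)
  have \<V>_open: "openin X (\<V> k)" if k: "k \<in> {1..j}" for k
  proof -
    have "\<V> k = \<V> k \<inter> U" using U k by blast
    then show ?thesis using open_basic[OF f[OF k]] unfolding X_def openin_subtopology \<V> by blast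
  qed
  have "U \<subseteq> binoid_Spec M" unfolding U \<V> basic_open_def by blast
  then have finite_U: "finite (topspace X)"
    unfolding top M_def using finite_Spec_simplicial_binoid finite_subset by blast
  have \<V>_min: "\<exists>x. x \<in> (\<Inter>k\<in>J. \<V> k) \<and> (\<Inter>k\<in>J. \<V> k) = min_nbhd X x"
    if J: "J \<subseteq> {1..j}" "J \<noteq> {}" "(\<Inter>k\<in>J. \<V> k) \<noteq> {}" for J
  proof -
    have fin: "finite J" using J(1) finite_subset by blast
    obtain g where g: "g \<in> carrier M" "(\<Inter>k\<in>J. \<V> k) = basic_open M g"
      using basic_open_INT[OF M fin J(2), of f] f J(1) unfolding \<V> by blast
    let ?x = "\<Union>(basic_open M g)"
    have x: "?x \<in> basic_open M g" using J(3) g(2) by (intro Union_basic_open) simp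
    have sub: "basic_open M g \<subseteq> U" using g(2) J(1,2) U by blast
    have "openin X (\<Inter>k\<in>J. \<V> k)" using fin J(1,2) \<V>_open by (intro openin_Inter) auto
    then have "min_nbhd X ?x \<subseteq> basic_open M g" using x unfolding g(2) by (rule min_nbhd_subset)
    moreover have "basic_open M g \<subseteq> W" if W: "openin X W" "?x \<in> W" for W
    proof -
      obtain T where "openin (Spec_topology M) T" "W = T \<inter> U"
        using W(1) unfolding X_def openin_subtopology by blast
      then show ?thesis using openin_Spec_Union_basic_open[of M T g] W(2) sub by blast
    qed
    then have "basic_open M g \<subseteq> min_nbhd X ?x" unfolding min_nbhd_def by blast
    ultimately show ?thesis using x g(2) by blast
  qed
  interpret finite_space X by unfold_locales (rule finite_U)
  interpret Cech: minimal_cover X \<V> "{1..j}"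
    by unfold_locales (use \<V>_open \<V>_min in auto)
  obtain I d where Id: "chosen_injective_resolution X (constant_sheaf_int X) = (I, d)" by (rule prod.exhaust)
  obtain I\<^sub>0 :: "nat \<Rightarrow> (nat multiset option set set,
      (nat multiset option set set, nat multiset option set set \<Rightarrow> int) sheaf_universe) presheaf" and d\<^sub>0 e\<^sub>0
    where res0: "injective_resolution X (constant_sheaf_int X) e\<^sub>0 I\<^sub>0 d\<^sub>0"
    using injective_resolution_constant_sheaf by blast
  \<comment> \<open>As some injective resolution with sections in the universe exists, the choice
    returns one.\<close>
  have "case (I, d) of (I, d) \<Rightarrow> \<exists>e. injective_resolution X (constant_sheaf_int X) e I d"
    unfolding Id[symmetric] chosen_injective_resolution_def
    by (rule someI[of _ "(I\<^sub>0, d\<^sub>0)"]) (use res0 in auto)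
  then obtain e where e: "injective_resolution X (constant_sheaf_int X) e I d" by auto
  interpret Res: resolution_cover X I d e \<V> "{1..j}"
    by unfold_locales (use e \<V>_open \<V>_min top U in auto)
  have "sheaf_cohomology X (constant_sheaf_int X) i = cohomology (\<lambda>n. sec (I n) (topspace X)) (\<lambda>n. d n (topspace X)) i"
    by (simp add: sheaf_cohomology_def Id)
  then have "sheaf_cohomology X (constant_sheaf_int X) i \<cong> simplicial_cohomology (nerve {1..j} \<V>) i"
    using Res.cohomology_nerve(2) by simp
  \<comment> \<open>Symmetry of \<open>\<cong>\<close> uses that Cech cohomology is a group, the
    first part of \<open>cech_cohomology_nerve\<close>.\<close>
  moreover have "simplicial_cohomology (nerve {1..j} \<V>) i \<cong> cech_cohomology (constant_sheaf_int X) {1..j} \<V> i"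
    using group.iso_sym[OF Cech.cech_cohomology_nerve] .
  ultimately have "sheaf_cohomology X (constant_sheaf_int X) i \<cong> cech_cohomology (constant_sheaf_int X) {1..j} \<V> i"
    by (rule iso_trans)
  then show ?thesis
    using Cech.cech_cohomology_nerve(2) unfolding Let_def X_def \<V>_def M_def by blast
qed

end
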